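(* All associahedra of type $A$, $B/C$ and $D$ have the non-leaving-face property. In other words, in each of the combinatorial models described in the context, for any two triangulations $T$ and $\widetilde T$, no diagonal belonging to both $T$ and $\widetilde T$ is flipped along any geodesic (shortest path in the flip graph) between $T$ and $\widetilde T$; i.e. every triangulation on such a geodesic contains $T \cap \widetilde T$.
   Context: A polytope $P$ has the non-leaving-face property if every geodesic in the graph of $P$ between two vertices stays in the minimal face of $P$ containing both. For the associahedra considered, the graph is the flip graph of the following models, where faces correspond to the sets of triangulations containing a given crossing-free set of diagonals. Type $A$: "triangulations" are triangulations of a convex polygon (by noncrossing diagonals), "diagonals" are diagonals of the polygon. Type $B/C$: "triangulations" are centrally symmetric triangulations of a convex centrally symmetric $2m$-gon, and a "diagonal" is either a centrally symmetric pair of (non-long) diagonals or a long diagonal (joining opposite vertices). Type $D$: for $n\ge 2$ let $\mathcal{D}_n$ be a regular $2n$-gon with a small closed disk $\mathbb{D}$ at its center meeting only the long diagonals; its chords are the non-long diagonals of the $2n$-gon and, for each vertex $p$, the two segments $p^{L}$, $p^{R}$ from $p$ tangent to $\mathbb{D}$ on the left and on the right; "triangulations" are inclusion-maximal crossing-free centrally symmetric sets of chords (centrally symmetric pseudotriangulations of $\mathcal{D}_n$), and a "diagonal" is a centrally symmetric pair of chords. In every type, a flip replaces one diagonal of a triangulation by the unique other diagonal producing again a triangulation, and the flip graph has triangulations as vertices and flips as edges. *)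

theory Defs
  imports "HOL-Analysis.Analysis"
begin

text \<open>The plane is the complex plane. A chord is the closed segment it occupies, as a set of
  points. So two chords with the same underlying segment are equal, and a set of chords has
  type \<^typ>\<open>complex set set\<close>.\<close>

type_synonym chord = "complex set"

definition convex_polygon :: "complex set \<Rightarrow> bool" where
  "convex_polygon P \<longleftrightarrow> polytope P \<and> aff_dim P = 2"

definition vertices :: "complex set \<Rightarrow> complex set" where
  "vertices P = {p. p extreme_point_of P}"

definition diagonals :: "complex set \<Rightarrow> chord set" where
  "diagonals P = {closed_segment p q | p q.
     p \<in> vertices P \<and> q \<in> vertices P \<and> p \<noteq> q \<and> \<not> closed_segment p q edge_of P}"

text \<open>Chords may share an endpoint without crossing; they cross when their relative interiors
  meet.\<close>

definition crossing :: "chord \<Rightarrow> chord \<Rightarrow> bool" where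
  "crossing s t \<longleftrightarrow> s \<noteq> t \<and> rel_interior s \<inter> rel_interior t \<noteq> {}"

definition crossing_free :: "chord set \<Rightarrow> bool" where
  "crossing_free X \<longleftrightarrow> (\<forall>s\<in>X. \<forall>t\<in>X. \<not> crossing s t)"

definition point_reflection :: "complex \<Rightarrow> complex \<Rightarrow> complex" where
  "point_reflection c z = 2 * c - z"

definition centrally_symmetric :: "complex \<Rightarrow> complex set \<Rightarrow> bool" where
  "centrally_symmetric c P \<longleftrightarrow> point_reflection c ` P = P"

definition centrally_symmetric_chords :: "complex \<Rightarrow> chord set \<Rightarrow> bool" where
  "centrally_symmetric_chords c X \<longleftrightarrow> (\<lambda>s. point_reflection c ` s) ` X = X"

definition long_diagonals :: "complex \<Rightarrow> complex set \<Rightarrow> chord set" where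
  "long_diagonals c P = {closed_segment p (point_reflection c p) | p. p \<in> vertices P}"

text \<open>A model consists of a family \<open>\<T>\<close> of triangulations, each a set of chords, and a family
  \<open>\<D>\<close> of ``diagonals'', the units that a flip exchanges. A ``diagonal'' is itself a set of
  chords: a singleton in type A, a centrally symmetric pair in type D, and in type B/C either a
  centrally symmetric pair or the singleton of a long diagonal. The triangulation \<open>T\<close> contains
  the ``diagonal'' \<open>d\<close> when \<open>d \<subseteq> T\<close>.\<close>

definition flips ::
  "chord set set \<Rightarrow> chord set set \<Rightarrow> chord set \<Rightarrow> chord set \<Rightarrow> chord set \<Rightarrow> bool" where
  "flips \<T> \<D> d T T' \<longleftrightarrow> T \<in> \<T> \<and> T' \<in> \<T> \<and> d \<in> \<D> \<and> d \<subseteq> T \<and>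
     (\<exists>d'\<in>\<D>. d' \<noteq> d \<and> T' = (T - d) \<union> d')"

definition flip_adjacent ::
  "chord set set \<Rightarrow> chord set set \<Rightarrow> chord set \<Rightarrow> chord set \<Rightarrow> bool" where
  "flip_adjacent \<T> \<D> T T' \<longleftrightarrow> (\<exists>d. flips \<T> \<D> d T T')"

definition flip_path ::
  "chord set set \<Rightarrow> chord set set \<Rightarrow> chord set \<Rightarrow> chord set list \<Rightarrow> chord set \<Rightarrow> bool" where
  "flip_path \<T> \<D> T ts T' \<longleftrightarrow> ts \<noteq> [] \<and> set ts \<subseteq> \<T> \<and>
     successively (flip_adjacent \<T> \<D>) ts \<and> hd ts = T \<and> last ts = T'"

definition geodesic ::
  "chord set set \<Rightarrow> chord set set \<Rightarrow> chord set \<Rightarrow> chord set list \<Rightarrow> chord set \<Rightarrow> bool" where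
  "geodesic \<T> \<D> T ts T' \<longleftrightarrow> flip_path \<T> \<D> T ts T' \<and>
     (\<forall>us. flip_path \<T> \<D> T us T' \<longrightarrow> length ts \<le> length us)"

text \<open>A face is identified with the set of its vertices, that is, of the triangulations
  containing a given crossing-free set \<open>X\<close> of ``diagonals''.\<close>

definition is_face :: "chord set set \<Rightarrow> chord set set \<Rightarrow> chord set set \<Rightarrow> bool" where
  "is_face \<T> \<D> F \<longleftrightarrow> (\<exists>X\<subseteq>\<D>. crossing_free (\<Union>X) \<and> F = {T\<in>\<T>. \<forall>d\<in>X. d \<subseteq> T})"

definition minimal_face ::
  "chord set set \<Rightarrow> chord set set \<Rightarrow> chord set \<Rightarrow> chord set \<Rightarrow> chord set set" where
  "minimal_face \<T> \<D> T T' = \<Inter>{F. is_face \<T> \<D> F \<and> T \<in> F \<and> T' \<in> F}"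

definition non_leaving_face_property :: "chord set set \<Rightarrow> chord set set \<Rightarrow> bool" where
  "non_leaving_face_property \<T> \<D> \<longleftrightarrow>
     (\<forall>T\<in>\<T>. \<forall>T'\<in>\<T>. \<forall>ts. geodesic \<T> \<D> T ts T' \<longrightarrow> set ts \<subseteq> minimal_face \<T> \<D> T T')"

definition common_diagonals_never_flipped :: "chord set set \<Rightarrow> chord set set \<Rightarrow> bool" where
  "common_diagonals_never_flipped \<T> \<D> \<longleftrightarrow>
     (\<forall>T\<in>\<T>. \<forall>T'\<in>\<T>. \<forall>ts. geodesic \<T> \<D> T ts T' \<longrightarrow>
        (\<forall>d\<in>\<D>. d \<subseteq> T \<inter> T' \<longrightarrow>
           (\<forall>i. Suc i < length ts \<longrightarrow> \<not> flips \<T> \<D> d (ts ! i) (ts ! Suc i))) \<and>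
        (\<forall>S\<in>set ts. T \<inter> T' \<subseteq> S))"

definition triangulations :: "complex set \<Rightarrow> chord set set" where
  "triangulations P = {T. T \<subseteq> diagonals P \<and> crossing_free T \<and>
     (\<forall>X. T \<subseteq> X \<and> X \<subseteq> diagonals P \<and> crossing_free X \<longrightarrow> X = T)}"

definition diagonals_A :: "complex set \<Rightarrow> chord set set" where
  "diagonals_A P = {{s} | s. s \<in> diagonals P}"

definition triangulations_BC :: "complex \<Rightarrow> complex set \<Rightarrow> chord set set" where
  "triangulations_BC c P = {T \<in> triangulations P. centrally_symmetric_chords c T}"

text \<open>A long diagonal is its own image under the reflection, so its pair collapses to a
  singleton.\<close>

definition diagonals_BC :: "complex \<Rightarrow> complex set \<Rightarrow> chord set set" where
  "diagonals_BC c P = {{s, point_reflection c ` s} | s. s \<in> diagonals P}"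

definition regular_polygon :: "nat \<Rightarrow> complex \<Rightarrow> complex set \<Rightarrow> bool" where
  "regular_polygon N c P \<longleftrightarrow> N \<ge> 3 \<and>
     (\<exists>w. w \<noteq> 0 \<and> P = convex hull ((\<lambda>k. c + w * cis (2 * pi * real k / real N)) ` {..<N}))"

text \<open>The disk is required to lie in the interior of the polygon because for \<open>n = 2\<close> there are
  no non-long diagonals to bound its radius.\<close>

definition type_D_configuration :: "nat \<Rightarrow> complex \<Rightarrow> real \<Rightarrow> complex set \<Rightarrow> bool" where
  "type_D_configuration n c r P \<longleftrightarrow> n \<ge> 2 \<and> regular_polygon (2 * n) c P \<and>
     r > 0 \<and> cball c r \<subseteq> interior P \<and>
     (\<forall>s \<in> diagonals P - long_diagonals c P. s \<inter> cball c r = {})"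

text \<open>The segment from \<open>p\<close> to \<open>t\<close> is tangent to the disk at \<open>t\<close> when \<open>t\<close> lies on the bounding
  circle and the segment is orthogonal to the radius at \<open>t\<close>. Every vertex \<open>p\<close> lies outside
  the disk and so has exactly two such points \<open>t\<close>, giving the chords \<open>p\<^sup>L\<close> and \<open>p\<^sup>R\<close>.\<close>

definition tangent_chords :: "complex \<Rightarrow> real \<Rightarrow> complex set \<Rightarrow> chord set" where
  "tangent_chords c r P = {closed_segment p t | p t.
     p \<in> vertices P \<and> t \<in> sphere c r \<and> (p - t) \<bullet> (t - c) = 0}"

definition chords_D :: "complex \<Rightarrow> real \<Rightarrow> complex set \<Rightarrow> chord set" where
  "chords_D c r P = (diagonals P - long_diagonals c P) \<union> tangent_chords c r P"

definition triangulations_D :: "complex \<Rightarrow> real \<Rightarrow> complex set \<Rightarrow> chord set set" where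
  "triangulations_D c r P = {T. T \<subseteq> chords_D c r P \<and> crossing_free T \<and>
     centrally_symmetric_chords c T \<and>
     (\<forall>X. T \<subseteq> X \<and> X \<subseteq> chords_D c r P \<and> crossing_free X \<and> centrally_symmetric_chords c X
        \<longrightarrow> X = T)}"

definition diagonals_D :: "complex \<Rightarrow> real \<Rightarrow> complex set \<Rightarrow> chord set set" where
  "diagonals_D c r P = {{s, point_reflection c ` s} | s. s \<in> chords_D c r P}"

end

theory Submission
  imports Defs
begin

text \<open>Let \<open>d\<close> be a diagonal common to the two ends of a path of flips. The flip graph retracts
  onto the triangulations containing \<open>d\<close>: delete the chords crossing \<open>d\<close> and fill up with chords
  obtained from them by pulling the part beyond \<open>d\<close> to a fixed end of \<open>d\<close>. The retraction maps
  adjacent triangulations to adjacent or equal ones, and if a flip removes \<open>d\<close>, both of its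
  triangulations have the same image. So a path that loses \<open>d\<close> is mapped to a strictly shorter
  path with the same ends, and is not a geodesic.

  Types B/C and D are treated together, through arcs on the universal cover. A triangulation of
  an \<open>(n + 1)\<close>-gon is the same as a centrally symmetric triangulation of a \<open>2 * n\<close>-gon containing a
  given long diagonal. Such triangulations form a face, so geodesics between them stay in it by
  type B/C, and type A follows.\<close>

section \<open>Flip graphs and their retractions\<close>

text \<open>The image of a triangulation is not the union of the images of its chords: pulling a
  chord that crosses \<open>d\<close> yields several candidates, and a candidate has to go when
  another chord still crosses it afterwards. So the image is defined negatively, as all chords that
  neither cross \<open>d\<close> nor are blocked by a chord of the triangulation; blocking is
  crossing minus those crossings that pulling dissolves. Its properties follow from conditions on a
  few chords at a time and one on whole triangulations: a new chord that nothing blocks is a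
  candidate of some chord.

  Whether pulling dissolves a crossing depends on where the chords meet \<open>d\<close>. A
  symmetric pair can meet the pair \<open>d\<close> more than once, and only a lift to the cover
  separates these meetings. If \<open>d\<close> is a pair of diagonals, pieces on the side spanned
  by a lift of \<open>d\<close> are pulled to one end, pieces on the other side to the other end,
  and a piece between two copies of \<open>d\<close> becomes a long diagonal or tangent chords
  there. If \<open>d\<close> is a pair of tangent chords, its vertex and the disk play the role of
  the two ends.\<close>

definition tri :: "('a \<Rightarrow> 'a \<Rightarrow> bool) \<Rightarrow> 'a set \<Rightarrow> 'a set set" where
  "tri cr D = {T. T \<subseteq> D \<and> (\<forall>x\<in>T. \<forall>y\<in>T. \<not> cr x y) \<and> (\<forall>z\<in>D. (\<forall>x\<in>T. \<not> cr z x) \<longrightarrow> z \<in> T)}"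

definition exchange :: "'a set \<Rightarrow> 'a set \<Rightarrow> bool" where
  "exchange T T' \<longleftrightarrow> (\<exists>e\<in>T. \<exists>e'. e' \<notin> T \<and> T' = insert e' (T - {e}))"

definition walk :: "('a \<Rightarrow> 'a \<Rightarrow> bool) \<Rightarrow> 'a set \<Rightarrow> 'a set list \<Rightarrow> bool" where
  "walk cr D ts \<longleftrightarrow> ts \<noteq> [] \<and> set ts \<subseteq> tri cr D \<and> successively exchange ts"

definition shortest :: "('a \<Rightarrow> 'a \<Rightarrow> bool) \<Rightarrow> 'a set \<Rightarrow> 'a set list \<Rightarrow> bool" where
  "shortest cr D ts \<longleftrightarrow> walk cr D ts \<and>
     (\<forall>us. walk cr D us \<and> hd us = hd ts \<and> last us = last ts \<longrightarrow> length ts \<le> length us)"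

definition non_leaving :: "('a \<Rightarrow> 'a \<Rightarrow> bool) \<Rightarrow> 'a set \<Rightarrow> bool" where
  "non_leaving cr D \<longleftrightarrow> (\<forall>ts. shortest cr D ts \<longrightarrow> (\<forall>S\<in>set ts. hd ts \<inter> last ts \<subseteq> S))"

text \<open>Wherever \<open>f\<close> identifies two consecutive entries, one of them is dropped.
  The rest is again a walk, strictly shorter as soon as this happens once.\<close>

lemma map_walk:
  assumes "walk cr D ts"
    and tri: "\<And>T. T \<in> tri cr D \<Longrightarrow> f T \<in> tri cr D"
    and ex: "\<And>T T'. T \<in> tri cr D \<Longrightarrow> T' \<in> tri cr D \<Longrightarrow> exchange T T' \<Longrightarrow> f T = f T' \<or> exchange (f T) (f T')"
  shows "\<exists>us. walk cr D us \<and> hd us = f (hd ts) \<and> last us = f (last ts) \<and> length us \<le> length ts \<and>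
    ((\<exists>i. Suc i < length ts \<and> f (ts ! i) = f (ts ! Suc i)) \<longrightarrow> length us < length ts)"
  using assms(1)
proof (induction ts)
  case Nil then show ?case by (simp add: walk_def)
next
  case (Cons T ts)
  have T: "T \<in> tri cr D" using Cons.prems by (simp add: walk_def)
  show ?case
  proof (cases ts)
    case Nil
    then show ?thesis using T tri by (intro exI[of _ "[f T]"]) (auto simp: walk_def)
  next
    case (Cons T' ts')
    have w: "walk cr D ts" and e: "exchange T T'" and T': "T' \<in> tri cr D"
      using Cons.prems Cons by (auto simp: walk_def)
    obtain us where us: "walk cr D us" "hd us = f (hd ts)" "last us = f (last ts)" "length us \<le> length ts"
      "(\<exists>i. Suc i < length ts \<and> f (ts ! i) = f (ts ! Suc i)) \<Longrightarrow> length us < length ts"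
      using Cons.IH[OF w] by blast
    show ?thesis
    proof (cases "f T = f T'")
      case True
      then show ?thesis using us Cons by (intro exI[of _ us]) auto
    next
      case False
      then have fe: "exchange (f T) (f T')" using ex[OF T T' e] by blast
      have "walk cr D (f T # us)"
        using us(1,2) fe tri[OF T] Cons by (cases us) (auto simp: walk_def)
      moreover have "length (f T # us) < length (T # ts)"
        if "Suc i < length (T # ts)" "f ((T # ts) ! i) = f ((T # ts) ! Suc i)" for i
      proof (cases i)
        case 0 then show ?thesis using that False Cons by simp
      next
        case (Suc k)
        then show ?thesis using that us(5) by auto
      qed
      moreover have "us \<noteq> []" using us(1) by (simp add: walk_def)
      ultimately show ?thesis using us(3,4) Cons by (intro exI[of _ "f T # us"]) auto
    qed
  qed
qed

lemma first_loss:
  assumes "S \<in> set ts" "\<not> P S" "P (hd ts)"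
  shows "\<exists>i. Suc i < length ts \<and> P (ts ! i) \<and> \<not> P (ts ! Suc i)"
  using assms
proof (induction ts)
  case (Cons T ts)
  show ?case
  proof (cases "ts \<noteq> [] \<and> P (hd ts)")
    case True
    then have "S \<in> set ts" using Cons.prems by auto
    then obtain i where "Suc i < length ts \<and> P (ts ! i) \<and> \<not> P (ts ! Suc i)" using Cons True by blast
    then show ?thesis by (intro exI[of _ "Suc i"]) auto
  next
    case False
    then show ?thesis using Cons.prems by (intro exI[of _ 0]) (cases ts; auto)
  qed
qed simp

definition collapsing :: "('a \<Rightarrow> 'a \<Rightarrow> bool) \<Rightarrow> 'a set \<Rightarrow> 'a \<Rightarrow> ('a set \<Rightarrow> 'a set) \<Rightarrow> bool" where
  "collapsing cr D d f \<longleftrightarrow>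
     (\<forall>T\<in>tri cr D. f T \<in> tri cr D \<and> (d \<in> T \<longrightarrow> f T = T)) \<and>
     (\<forall>T\<in>tri cr D. \<forall>T'\<in>tri cr D. exchange T T' \<longrightarrow>
        (f T = f T' \<or> exchange (f T) (f T')) \<and> (d \<in> T \<longrightarrow> d \<notin> T' \<longrightarrow> f T' = T))"

lemma non_leavingI:
  assumes "\<And>d. d \<in> D \<Longrightarrow> \<exists>f. collapsing cr D d f"
  shows "non_leaving cr D"
  unfolding non_leaving_def
proof (intro allI impI ballI subsetI)
  fix ts S d
  assume sh: "shortest cr D ts" and S: "S \<in> set ts" and d: "d \<in> hd ts \<inter> last ts"
  have w: "walk cr D ts" using sh by (simp add: shortest_def)
  have "hd ts \<in> tri cr D" "last ts \<in> tri cr D" using w by (auto simp: walk_def)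
  then have "d \<in> D" using d by (auto simp: tri_def)
  then obtain f where cf: "collapsing cr D d f" using assms by blast
  have f: "T \<in> tri cr D \<Longrightarrow> f T \<in> tri cr D"
      "T \<in> tri cr D \<Longrightarrow> T' \<in> tri cr D \<Longrightarrow> exchange T T' \<Longrightarrow> f T = f T' \<or> exchange (f T) (f T')"
      "T \<in> tri cr D \<Longrightarrow> d \<in> T \<Longrightarrow> f T = T"
      "T \<in> tri cr D \<Longrightarrow> T' \<in> tri cr D \<Longrightarrow> exchange T T' \<Longrightarrow> d \<in> T \<Longrightarrow> d \<notin> T' \<Longrightarrow> f T' = T"
    for T T'
  proof -
    have 1: "\<forall>T\<in>tri cr D. f T \<in> tri cr D \<and> (d \<in> T \<longrightarrow> f T = T)"
      and 2: "\<forall>T\<in>tri cr D. \<forall>T'\<in>tri cr D. exchange T T' \<longrightarrow>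
        (f T = f T' \<or> exchange (f T) (f T')) \<and> (d \<in> T \<longrightarrow> d \<notin> T' \<longrightarrow> f T' = T)"
      using cf unfolding collapsing_def by simp_all
    show "T \<in> tri cr D \<Longrightarrow> f T \<in> tri cr D" by (rule bspec[OF 1, THEN conjunct1])
    show "T \<in> tri cr D \<Longrightarrow> T' \<in> tri cr D \<Longrightarrow> exchange T T' \<Longrightarrow> f T = f T' \<or> exchange (f T) (f T')"
      by (rule bspec[OF bspec[OF 2], THEN mp, THEN conjunct1])
    show "T \<in> tri cr D \<Longrightarrow> d \<in> T \<Longrightarrow> f T = T" by (rule bspec[OF 1, THEN conjunct2, THEN mp])
    show "T \<in> tri cr D \<Longrightarrow> T' \<in> tri cr D \<Longrightarrow> exchange T T' \<Longrightarrow> d \<in> T \<Longrightarrow> d \<notin> T' \<Longrightarrow> f T' = T"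
      by (rule bspec[OF bspec[OF 2], THEN mp, THEN conjunct2, THEN mp, THEN mp])
  qed
  show "d \<in> S"
  proof (rule ccontr)
    assume "d \<notin> S"
    then obtain i where i: "Suc i < length ts" "d \<in> ts ! i" "d \<notin> ts ! Suc i"
      using first_loss[of S ts "\<lambda>S. d \<in> S", OF S _ IntD1[OF d]] by blast
    have "ts ! i \<in> set ts" "ts ! Suc i \<in> set ts" using i(1) by simp_all
    then have ii: "ts ! i \<in> tri cr D" "ts ! Suc i \<in> tri cr D" "exchange (ts ! i) (ts ! Suc i)"
      using w i(1) successively_nth[of exchange ts i] by (auto simp: walk_def)
    have "f (ts ! i) = f (ts ! Suc i)" using f(3)[OF ii(1) i(2)] f(4)[OF ii i(2,3)] by simp
    moreover obtain us where us: "walk cr D us" "hd us = f (hd ts)" "last us = f (last ts)"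
      "(\<exists>i. Suc i < length ts \<and> f (ts ! i) = f (ts ! Suc i)) \<longrightarrow> length us < length ts"
      using map_walk[OF w, of f] f(1,2) by blast
    ultimately have "length us < length ts" using i(1) by blast
    moreover have "hd us = hd ts" "last us = last ts"
      using us d f(3) \<open>hd ts \<in> _\<close> \<open>last ts \<in> _\<close> by auto
    ultimately show False using sh us(1) by (auto simp: shortest_def)
  qed
qed

text \<open>\<open>unique_exchange\<close> asks of \<open>S'\<close> only that it contains
  \<open>S - {e}\<close>, not that it arises by a flip. This is why losing at most one chord is
  already enough to be adjacent or equal (\<open>exchangeI\<close>), with no counting of
  chords.\<close>

locale crossing_system =
  fixes cr :: "'a \<Rightarrow> 'a \<Rightarrow> bool" and D :: "'a set"
  assumes cr_sym: "cr x y \<Longrightarrow> cr y x"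
    and cr_irrefl: "x \<in> D \<Longrightarrow> \<not> cr x x"
    and unique_exchange: "\<lbrakk>S \<in> tri cr D; S' \<in> tri cr D; e \<in> S; S - {e} \<subseteq> S'; y \<in> S' - S; y' \<in> S' - S\<rbrakk> \<Longrightarrow> y = y'"
begin

lemma triD:
  assumes "T \<in> tri cr D"
  shows "x \<in> T \<Longrightarrow> x \<in> D" "x \<in> T \<Longrightarrow> y \<in> T \<Longrightarrow> \<not> cr x y"
    "x \<in> D \<Longrightarrow> x \<notin> T \<Longrightarrow> \<exists>y\<in>T. cr x y"
  using assms unfolding tri_def by blast+

lemma tri_subset_eq:
  assumes S: "S \<in> tri cr D" and S': "S' \<in> tri cr D" and sub: "S \<subseteq> S'"
  shows "S = S'"
proof -
  have "x \<in> S" if x: "x \<in> S'" for x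
  proof (rule ccontr)
    assume "x \<notin> S"
    then obtain y where "y \<in> S" "cr x y" using triD(3)[OF S triD(1)[OF S' x]] by blast
    then show False using triD(2)[OF S' x, of y] sub by auto
  qed
  then show ?thesis using sub by auto
qed

lemma exchangeI:
  assumes S: "S \<in> tri cr D" and S': "S' \<in> tri cr D" and sub: "S - S' \<subseteq> {e}"
  shows "S = S' \<or> exchange S S'"
proof (cases "S \<subseteq> S'")
  case True
  then show ?thesis using tri_subset_eq[OF S S'] by blast
next
  case False
  then have e: "e \<in> S" "e \<notin> S'" "S - {e} \<subseteq> S'" using sub by auto
  obtain y where y: "y \<in> S'" "cr e y" using triD(3)[OF S' triD(1)[OF S e(1)] e(2)] by blast
  then have yS: "y \<notin> S" using triD(2)[OF S e(1)] by blast
  have "y' = y" if "y' \<in> S'" "y' \<notin> S" for y'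
    using unique_exchange[OF S S' e(1) e(3), of y' y] that y yS by blast
  then have "S' = insert y (S - {e})" using e y(1) by auto
  then show ?thesis unfolding exchange_def using e(1) yS by blast
qed

lemma exchange_sym: "exchange S S' \<Longrightarrow> exchange S' S"
  unfolding exchange_def
proof (elim bexE exE conjE)
  fix e e' assume a: "e \<in> S" "e' \<notin> S" "S' = insert e' (S - {e})"
  show "\<exists>x\<in>S'. \<exists>y. y \<notin> S' \<and> S = insert y (S' - {x})"
    by (rule bexI[of _ e'], rule exI[of _ e]) (use a in auto)
qed

end

text \<open>\<open>F t x\<close> means that \<open>x\<close> is one of the chords into which the retraction may turn a chord \<open>t\<close>
  crossing \<open>d\<close>; \<open>bl t x\<close> means that the presence of \<open>t\<close> keeps \<open>x\<close> out of the retracted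
  triangulation.\<close>

locale projection = crossing_system cr D for cr :: "'a \<Rightarrow> 'a \<Rightarrow> bool" and D +
  fixes d :: 'a and F bl :: "'a \<Rightarrow> 'a \<Rightarrow> bool"
  assumes d: "d \<in> D"
    and F_cr: "F t x \<Longrightarrow> x \<in> D \<and> cr t d \<and> \<not> cr x d"
    and bl_cr: "bl t x \<Longrightarrow> cr t x"
    and blI: "\<lbrakk>t \<in> D; x \<in> D; cr t x; \<not> cr t d; \<not> cr x d\<rbrakk> \<Longrightarrow> bl t x"
    and bl_F: "\<lbrakk>F t x; t \<in> D; s \<in> D; bl s x\<rbrakk> \<Longrightarrow> cr s t"
    and bl_F_cr: "\<lbrakk>t \<in> D; z \<in> D; cr t d; bl t z; \<not> cr z d\<rbrakk> \<Longrightarrow> \<exists>x. F t x \<and> cr x z"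
    and F_surj: "\<lbrakk>T \<in> tri cr D; x \<in> D - T; \<not> cr x d; \<forall>t\<in>T. \<not> bl t x\<rbrakk> \<Longrightarrow> \<exists>t\<in>T. F t x"
    and F_F: "\<lbrakk>F t x; F t' y; t \<in> D; t' \<in> D; cr x y\<rbrakk> \<Longrightarrow> bl t y \<or> bl t' x"
    and F_unique: "\<lbrakk>F e x; F e y; e \<in> D; s \<in> D; bl s x; bl s y; cr s d; cr s e\<rbrakk> \<Longrightarrow> x = y"
begin

definition proj :: "'a set \<Rightarrow> 'a set" where
  "proj T = {x \<in> D. \<not> cr x d \<and> (\<forall>t\<in>T. \<not> bl t x)}"

lemma in_proj: "T \<in> tri cr D \<Longrightarrow> x \<in> T \<Longrightarrow> \<not> cr x d \<Longrightarrow> x \<in> proj T"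
  using triD(1,2)[of T] by (auto simp: proj_def dest!: bl_cr)

lemma d_in_proj:
  assumes T: "T \<in> tri cr D"
  shows "d \<in> proj T"
proof -
  have "\<not> bl t d" if t: "t \<in> T" for t
  proof
    assume b: "bl t d"
    obtain x where "F t x" "cr x d"
      using bl_F_cr[OF triD(1)[OF T t] d bl_cr[OF b] b cr_irrefl[OF d]] by blast
    then show False using F_cr by blast
  qed
  then show ?thesis using d cr_irrefl[OF d] by (simp add: proj_def)
qed

text \<open>Two crossing chords of the image cannot lie in \<open>T\<close>, where one would block
  the other. So both have sources in \<open>T\<close>, and by \<open>F_F\<close> one of these
  sources blocks a chord of the image. For maximality, suppose \<open>t\<close> blocks
  \<open>z\<close>: either \<open>t\<close> survives into the image, or one of its candidates
  crosses \<open>z\<close>, and by \<open>bl_F\<close> nothing in \<open>T\<close> blocks that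
  candidate.\<close>

lemma proj_tri:
  assumes T: "T \<in> tri cr D"
  shows "proj T \<in> tri cr D"
proof -
  have "\<not> cr x y" if x: "x \<in> proj T" and y: "y \<in> proj T" for x y
  proof
    assume xy: "cr x y"
    have *: "x \<notin> T" if "x \<in> proj T" "y \<in> proj T" "cr x y" for x y
      using that blI[of x y] by (auto simp: proj_def)
    have "x \<notin> T" "y \<notin> T" using * x y xy cr_sym by blast+
    then obtain t t' where "t \<in> T" "F t x" "t' \<in> T" "F t' y"
      using F_surj[OF T] x y unfolding proj_def by blast
    then show False using F_F[of t x t' y] xy x y triD(1)[OF T] by (auto simp: proj_def)
  qed
  moreover have "z \<in> proj T" if z: "z \<in> D" and nc: "\<forall>x\<in>proj T. \<not> cr z x" for z
  proof (rule ccontr)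
    assume n: "z \<notin> proj T"
    have zd: "\<not> cr z d" using nc d_in_proj[OF T] by blast
    then obtain t where t: "t \<in> T" "bl t z" using n z by (auto simp: proj_def)
    show False
    proof (cases "cr t d")
      case False
      then have "t \<in> proj T" using in_proj[OF T t(1)] by blast
      then show False using nc bl_cr[OF t(2)] cr_sym by blast
    next
      case True
      then obtain x where x: "F t x" "cr x z" using bl_F_cr t z zd triD(1)[OF T] by blast
      have "x \<in> proj T" unfolding proj_def
        using F_cr[OF x(1)] bl_F[OF x(1)] t(1) triD[OF T] by blast
      then show False using nc x(2) cr_sym by blast
    qed
  qed
  moreover have "proj T \<subseteq> D" by (auto simp: proj_def)
  ultimately show ?thesis unfolding tri_def by simp
qed

lemma proj_id:
  assumes T: "T \<in> tri cr D" and "d \<in> T"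
  shows "proj T = T"
proof
  show "T \<subseteq> proj T" using in_proj[OF T] triD(2)[OF T] assms(2) by blast
  then show "proj T \<subseteq> T" using tri_subset_eq[OF T proj_tri[OF T]] by simp
qed

text \<open>A lost chord is blocked by the incoming \<open>e'\<close> and by nothing in
  \<open>T\<close>. If it is new, it has a source in \<open>T\<close>, which \<open>e'\<close>
  crosses by \<open>bl_F\<close>; the only chord of \<open>T\<close> that \<open>e'\<close> can
  cross is the outgoing \<open>e\<close>.\<close>

lemma proj_diff:
  assumes T: "T \<in> tri cr D" and T': "T' \<in> tri cr D" and e: "e \<in> T" "e' \<notin> T" "T' = insert e' (T - {e})"
    and x: "x \<in> proj T - proj T'"
  shows "bl e' x \<and> (if cr e d then F e x else x = e)"
proof -
  have b: "bl e' x" using x e by (auto simp: proj_def)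
  have e'T': "e' \<in> T'" using e by blast
  show ?thesis
  proof (cases "x \<in> T")
    case True
    have "cr e' x" using b bl_cr by blast
    then have "x \<notin> T'" using triD(2)[OF T' e'T'] by blast
    then have "x = e" using True e by blast
    then show ?thesis using b x by (auto simp: proj_def)
  next
    case False
    then obtain t where t: "t \<in> T" "F t x" using F_surj[OF T] x unfolding proj_def by blast
    have "cr e' t" using bl_F[OF t(2)] b triD(1)[OF T t(1)] triD(1)[OF T' e'T'] by blast
    then have "t \<notin> T'" using triD(2)[OF T' e'T'] by blast
    then have "t = e" using t(1) e by blast
    then show ?thesis using b t F_cr by auto
  qed
qed

text \<open>By \<open>exchangeI\<close> it suffices that one of the two images loses at most one
  chord to the other. If one of the exchanged chords misses \<open>d\<close>, that chord is the only
  possible loss in its direction. If both cross \<open>d\<close>, every loss is a candidate of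
  \<open>e\<close> blocked by \<open>e'\<close>, and \<open>F_unique\<close> leaves room for
  one.\<close>

lemma proj_exchange:
  assumes T: "T \<in> tri cr D" and T': "T' \<in> tri cr D" and ex: "exchange T T'"
  shows "proj T = proj T' \<or> exchange (proj T) (proj T')"
proof -
  obtain e e' where e: "e \<in> T" "e' \<notin> T" "T' = insert e' (T - {e})"
    using ex unfolding exchange_def by blast
  have e': "e' \<in> T'" "e \<notin> T'" "T = insert e (T' - {e'})" using e by auto
  note P = proj_tri[OF T] and P' = proj_tri[OF T']
  consider "\<not> cr e d" | "\<not> cr e' d" | "cr e d" "cr e' d" by blast
  then show ?thesis
  proof cases
    case 1
    then have "proj T - proj T' \<subseteq> {e}" using proj_diff[OF T T' e] by auto
    then show ?thesis using exchangeI[OF P P'] by blast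
  next
    case 2
    then have "proj T' - proj T \<subseteq> {e'}" using proj_diff[OF T' T e'] by auto
    then show ?thesis using exchangeI[OF P' P] exchange_sym by metis
  next
    case 3
    have D: "e \<in> D" "e' \<in> D" using triD(1)[OF T e(1)] triD(1)[OF T' e'(1)] by auto
    have "cr e' e"
    proof (rule ccontr)
      assume "\<not> cr e' e"
      then obtain y where "y \<in> T" "y \<noteq> e" "cr e' y" using triD(3)[OF T D(2) e(2)] by blast
      then show False using triD(2)[OF T' e'(1), of y] e by blast
    qed
    then have "x = y" if "x \<in> proj T - proj T'" "y \<in> proj T - proj T'" for x y
      using proj_diff[OF T T' e that(1)] proj_diff[OF T T' e that(2)] 3 F_unique[of e x y e'] D by auto
    then obtain x where "proj T - proj T' \<subseteq> {x}" by blast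
    then show ?thesis using exchangeI[OF P P'] by blast
  qed
qed

text \<open>No chord of \<open>T\<close> crosses \<open>d\<close>, and all of them except
  \<open>d\<close> survive the flip, so the image of \<open>T'\<close> contains \<open>T\<close> and
  equals it by maximality.\<close>

lemma proj_collapse:
  assumes T: "T \<in> tri cr D" and T': "T' \<in> tri cr D" and ex: "exchange T T'" and d': "d \<in> T" "d \<notin> T'"
  shows "proj T' = T"
proof -
  have sub: "T - {d} \<subseteq> T'" using ex d' unfolding exchange_def by auto
  have "T \<subseteq> proj T'"
  proof
    fix t assume t: "t \<in> T"
    show "t \<in> proj T'"
    proof (cases "t = d")
      case True then show ?thesis using d_in_proj[OF T'] by simp
    next
      case False
      then show ?thesis using in_proj[OF T', of t] sub t triD(2)[OF T t d'(1)] by blast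
    qed
  qed
  then show ?thesis using tri_subset_eq[OF T proj_tri[OF T']] by simp
qed

lemma collapsing_proj: "collapsing cr D d proj"
  unfolding collapsing_def by (simp add: proj_tri proj_id proj_exchange proj_collapse)

end

section \<open>Arcs on the universal cover\<close>

text \<open>Arcs have length at most \<open>n\<close>, so a translate interacts with an arc only for
  the multiples 0, \<open>n\<close> and \<open>- n\<close>. The other multiples appear as bounds
  that linear arithmetic can refute uniformly.\<close>

lemma multiple_cases:
  fixes n m :: int
  assumes n: "2 \<le> n" and "n dvd m"
  obtains "m = 0" | "m = n" | "m = - n" | "m \<ge> 2 * n" | "m \<le> - (2 * n)"
proof -
  obtain k where k: "m = n * k" using assms(2) by blast
  have "k = 0 \<or> k = 1 \<or> k = -1 \<or> k \<ge> 2 \<or> k \<le> -2" by linarith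
  moreover have "m \<ge> 2 * n" if "k \<ge> 2" using mult_left_mono[of 2 k n] that n k by simp
  moreover have "m \<le> - (2 * n)" if "k \<le> -2" using mult_left_mono[of k "-2" n] that n k by simp
  ultimately show thesis using that k by auto
qed

text \<open>\<open>A\<close> and \<open>C\<close> are the lifts to the universal cover of the diagonals and of the tangent chords
  of a triangulation.\<close>

locale lifted =
  fixes n :: int and K :: bool and A :: "int \<Rightarrow> int \<Rightarrow> bool" and C :: "int \<Rightarrow> bool \<Rightarrow> bool"
  assumes n: "2 \<le> n"
    and A_len: "A i j \<Longrightarrow> 2 \<le> j - i \<and> j - i \<le> n \<and> (\<not> K \<longrightarrow> j - i < n)"
    and C_K: "C p a \<Longrightarrow> \<not> K"
    and A_shift: "A i j \<Longrightarrow> n dvd m \<Longrightarrow> A (i + m) (j + m)"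
    and C_shift: "C p a \<Longrightarrow> n dvd m \<Longrightarrow> C (p + m) a"
    and AA: "A i j \<Longrightarrow> A k l \<Longrightarrow> \<not> (i < k \<and> k < j \<and> j < l)"
    and AC: "A i j \<Longrightarrow> C p a \<Longrightarrow> \<not> (i < p \<and> p < j)"
    and CC: "C p a \<Longrightarrow> C q b \<Longrightarrow> n dvd p - q \<or> a = b"
    and A_max: "\<lbrakk>2 \<le> j - i; j - i \<le> n; \<not> K \<longrightarrow> j - i < n;
       \<And>k l. A k l \<Longrightarrow> \<not> (i < k \<and> k < j \<and> j < l) \<and> \<not> (k < i \<and> i < l \<and> l < j);
       \<And>p a. C p a \<Longrightarrow> \<not> (i < p \<and> p < j)\<rbrakk> \<Longrightarrow> A i j"
    and C_max: "\<lbrakk>\<not> K; \<And>k l. A k l \<Longrightarrow> \<not> (k < p \<and> p < l); \<And>q b. C q b \<Longrightarrow> n dvd p - q \<or> a = b\<rbrakk> \<Longrightarrow> C p a"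
begin

lemma A_shiftn: "A i j \<Longrightarrow> A (i + n) (j + n)" "A i j \<Longrightarrow> A (i - n) (j - n)"
  using A_shift[of i j n] A_shift[of i j "- n"] by simp_all

lemma C_shiftn: "C p a \<Longrightarrow> C (p + n) a" "C p a \<Longrightarrow> C (p - n) a"
  using C_shift[of p a n] C_shift[of p a "- n"] by simp_all

lemmas dvd_cases [consumes 1, case_names zero pos neg big_pos big_neg] = multiple_cases[OF n]

lemma small_dvd: "n dvd m \<Longrightarrow> - n < m \<Longrightarrow> m < n \<Longrightarrow> m = 0"
  using n by (auto elim: dvd_cases)

lemma representative: "\<exists>m. n dvd m \<and> c \<le> p + m \<and> p + m < c + n"
proof -
  have "p + - (n * ((p - c) div n)) = c + (p - c) mod n"
    by (simp add: minus_mult_div_eq_mod [symmetric])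
  moreover have "0 \<le> (p - c) mod n" "(p - c) mod n < n" using n by simp_all
  ultimately show ?thesis by (intro exI[of _ "- (n * ((p - c) div n))"]) auto
qed

lemma representative': "\<exists>m. n dvd m \<and> c - n < p + m \<and> p + m \<le> c"
  using representative[of "c - n + 1" p] by (smt (verit))

lemma longest:
  assumes "A i j"
  obtains k l where "A k l" "\<And>k' l'. A k' l' \<Longrightarrow> l' - k' \<le> l - k"
proof -
  obtain x where "(\<lambda>(k, l). A k l) x" "\<And>y. (\<lambda>(k, l). A k l) y \<Longrightarrow> (\<lambda>(k, l). nat (l - k)) y \<le> (\<lambda>(k, l). nat (l - k)) x"
    using ex_has_greatest_nat[of "\<lambda>(k, l). A k l" "(i, j)" "\<lambda>(k, l). nat (l - k)" "nat n + 1"]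
      assms A_len by fastforce
  then show thesis using that[of "fst x" "snd x"] A_len by (fastforce simp: split_beta nat_le_iff)
qed

text \<open>The left end of a longest arc serves: an arc strictly over it would have to reach at
  least to the right end of the longest arc in order not to cross it, and so be longer.\<close>

lemma uncovered: "\<exists>c. \<forall>k l. A k l \<longrightarrow> l - k < n \<longrightarrow> (\<exists>i j. A i j \<and> j - i = n) \<or> \<not> (k < c \<and> c < l)"
proof (cases "\<exists>i j. A i j")
  case True
  then obtain k l where kl: "A k l" and max: "\<And>k' l'. A k' l' \<Longrightarrow> l' - k' \<le> l - k" using longest by metis
  have "\<not> (k' < k \<and> k < l')" if "A k' l'" for k' l'
    using AA[OF that kl] max[OF that] by auto
  then show ?thesis by blast
qed blast

text \<open>Otherwise all arcs are shorter than \<open>n\<close> and leave some \<open>c\<close> and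
  its translates uncovered, so the arc of length \<open>n\<close> at \<open>c\<close> crosses
  nothing and maximality supplies it.\<close>

lemma central_K:
  assumes K
  shows "\<exists>c. A c (c + n)"
proof (rule ccontr)
  assume no: "\<not> ?thesis"
  have "\<not> (A i j \<and> j - i = n)" for i j using no by (metis add.commute diff_add_cancel)
  then obtain c where c: "\<And>k l. A k l \<Longrightarrow> \<not> (k < c \<and> c < l)"
    using uncovered A_len by (metis order_le_less)
  have "A c (c + n)"
  proof (rule A_max)
    fix k l assume kl: "A k l"
    show "\<not> (c < k \<and> k < c + n \<and> c + n < l) \<and> \<not> (k < c \<and> c < l \<and> l < c + n)"
      using c[OF kl] c[OF A_shiftn(2)[OF kl]] by auto
  qed (use n C_K assms in auto)
  then show False using no by blast
qed

text \<open>With no tangent chord present, one of either sign could be added at an uncovered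
  position.\<close>

lemma central_C:
  assumes "\<not> K"
  shows "\<exists>c a. C c a"
proof (rule ccontr)
  assume no: "\<not> ?thesis"
  obtain c where c: "\<And>k l. A k l \<Longrightarrow> \<not> (k < c \<and> c < l)"
    using uncovered A_len assms by (metis order_less_irrefl)
  then have "C c True" using no assms by (intro C_max) auto
  then show False using no by blast
qed

end

section \<open>Uniqueness of the exchanged chord, on the cover\<close>

locale exchange_pair =
  L: lifted n K A C + L': lifted n K A' C' for n K A C A' C'
begin

text \<open>\<open>m\<close> is the third corner of the triangle under the removed arc. A chord of
  \<open>S'\<close> that leaves the interval at \<open>m\<close> keeps other arcs under
  \<open>k\<close>, \<open>l\<close> from passing over \<open>m\<close>. So the arc from
  \<open>m\<close> to \<open>l\<close> is compatible with the old triangulation, belongs to it,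
  survives the exchange, and would be crossed by the chord at \<open>m'\<close>.\<close>

lemma arc_inner_unique:
  assumes kl: "A k l"
    and subA: "\<And>i j. A i j \<Longrightarrow> A' i j \<or> (\<exists>m. n dvd m \<and> i = k + m \<and> j = l + m)"
    and subC: "\<And>p a. C p a \<Longrightarrow> C' p a"
    and m: "k < m" "m < m'" "m' < l"
    and im: "(\<exists>o'<k. A' o' m) \<or> (\<exists>o'>l. A' m o') \<or> (\<exists>a. C' m a)"
    and im': "(\<exists>o'<k. A' o' m') \<or> (\<exists>o'>l. A' m' o') \<or> (\<exists>a. C' m' a)"
  shows False
proof -
  note len = L.A_len[OF kl]
  have nc: "\<not> A' a b" if "k \<le> a" "a < m" "m < b" "b \<le> l" for a b
    using im
  proof (elim disjE exE conjE)
    fix o' assume "o' < k" "A' o' m" then show ?thesis using L'.AA[of o' m a b] that by auto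
  next
    fix o' assume "l < o'" "A' m o'" then show ?thesis using L'.AA[of a b m o'] that by auto
  next
    fix c assume "C' m c" then show ?thesis using L'.AC[of a b m c] that by auto
  qed
  have "A m l"
  proof (rule L.A_max)
    fix a b assume ab: "A a b"
    have "A' a b \<or> \<not> (k \<le> a \<and> a < m \<and> m < b \<and> b < l)" using subA[OF ab] by auto
    then show "\<not> (m < a \<and> a < l \<and> l < b) \<and> \<not> (a < m \<and> m < b \<and> b < l)"
      using L.AA[OF kl ab] L.AA[OF ab kl] nc[of a b] m by linarith
  next
    fix p a assume "C p a" then show "\<not> (m < p \<and> p < l)" using L.AC[OF kl] m by auto
  qed (use len m in auto)
  moreover have "\<not> (\<exists>z. n dvd z \<and> m = k + z \<and> l = l + z)" using m by auto
  ultimately have "A' m l" using subA by blast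
  then show False using im'
  proof (elim disjE exE conjE)
    fix o' assume "o' < k" "A' o' m'" then show ?thesis using L'.AA[of o' m' m l] m \<open>A' m l\<close> by auto
  next
    fix o' assume "l < o'" "A' m' o'" then show ?thesis using L'.AA[of m l m' o'] m \<open>A' m l\<close> by auto
  next
    fix c assume "C' m' c" then show ?thesis using L'.AC[of m l m' c] m \<open>A' m l\<close> by auto
  qed
qed

end

locale arc_exchange = exchange_pair +
  fixes k l :: int
  assumes kl: "A k l"
    and subA: "\<And>i j. A i j \<Longrightarrow> A' i j \<or> (\<exists>m. n dvd m \<and> i = k + m \<and> j = l + m)"
    and subC: "\<And>p a. C p a \<Longrightarrow> C' p a"
begin

lemma subA_len:
  assumes "A i j" "j - i \<noteq> l - k"
  shows "A' i j"
proof (rule ccontr)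
  assume "\<not> A' i j"
  then obtain m where "i = k + m" "j = l + m" using subA[OF assms(1)] by blast
  then show False using assms(2) by simp
qed

lemma subA_cases:
  assumes "A i j"
  shows "A' i j \<or> i = k \<and> j = l \<or> i \<le> k - n \<and> j \<le> l - n \<or> k + n \<le> i \<and> l + n \<le> j"
proof (cases "A' i j")
  case False
  then obtain m where "n dvd m" "i = k + m" "j = l + m" using subA[OF assms] by blast
  then show ?thesis using L.n by (cases rule: L.dvd_cases[of m]) auto
qed simp

definition inner :: "int \<Rightarrow> bool" where
  "inner m \<longleftrightarrow> k < m \<and> m < l \<and> ((\<exists>q<k. A' q m) \<or> (\<exists>q>l. A' m q) \<or> (\<exists>a. C' m a))"

lemma inner_unique:
  assumes "inner m" "inner m'"
  shows "m = m'"
proof (rule ccontr)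
  assume "m \<noteq> m'"
  then consider "m < m'" | "m' < m" by linarith
  then show False
    using arc_inner_unique[OF kl subA subC, of m m'] arc_inner_unique[OF kl subA subC, of m' m] assms
    by cases (simp_all add: inner_def)
qed

end

locale short_arc_exchange = arc_exchange +
  assumes short: "l - k < n"
begin

text \<open>The old triangulation has a central chord, that is, a long arc or a tangent chord. It
  survives because the removed arc is shorter than \<open>n\<close>. Its lifts at \<open>c\<close>
  and \<open>c + n\<close> enclose the removed arc and confine every new arc crossing it to one
  period.\<close>

lemma window: "\<exists>c. c \<le> k \<and> l \<le> c + n \<and> (\<forall>i j. A' i j \<longrightarrow> i < k \<longrightarrow> k < j \<longrightarrow> j < l \<longrightarrow> c \<le> i \<and> j - i < n) \<and>
    (\<forall>i j. A' i j \<longrightarrow> k < i \<longrightarrow> i < l \<longrightarrow> l < j \<longrightarrow> j \<le> c + n \<and> j - i < n) \<and> (\<not> K \<longrightarrow> (\<exists>a. C c a))"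
proof (cases K)
  case True
  then obtain c0 where c0: "A c0 (c0 + n)" using L.central_K by blast
  obtain m where m: "n dvd m" "k - n < c0 + m" "c0 + m \<le> k"
    using L.representative' by blast
  define c where "c = c0 + m"
  have cA: "A c (c + n)" using L.A_shift[OF c0 m(1)] by (simp add: c_def algebra_simps)
  have c: "A' c (c + n)" using subA_len[OF cA] short by auto
  have ck: "k - n < c" "c \<le> k" using m by (auto simp: c_def)
  have "l \<le> c + n" using L.AA[OF cA kl] ck L.A_len[OF kl] by linarith
  moreover have "c \<le> i \<and> j - i < n" if "A' i j" "i < k" "k < j" "j < l" for i j
    using L'.AA[OF that(1) c] L'.AA[OF c that(1)] L'.AA[OF L'.A_shiftn(1)[OF that(1)] c]
      L'.AA[OF c L'.A_shiftn(1)[OF that(1)]] L'.A_len[OF that(1)] that ck calculation by (smt (verit))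
  moreover have "j \<le> c + n \<and> j - i < n" if "A' i j" "k < i" "i < l" "l < j" for i j
    using L'.AA[OF that(1) c] L'.AA[OF c that(1)] L'.AA[OF L'.A_shiftn(2)[OF that(1)] c]
      L'.AA[OF c L'.A_shiftn(2)[OF that(1)]] L'.A_len[OF that(1)] that ck \<open>l \<le> c + n\<close> by (smt (verit))
  ultimately show ?thesis using ck True by blast
next
  case False
  then obtain c0 a where c0: "C c0 a" using L.central_C by blast
  obtain m where m: "n dvd m" "k - n < c0 + m" "c0 + m \<le> k"
    using L.representative' by blast
  define c where "c = c0 + m"
  have cC: "C c a" using L.C_shift[OF c0 m(1)] by (simp add: c_def)
  have ck: "k - n < c" "c \<le> k" using m by (auto simp: c_def)
  have c: "C' c a" "C' (c + n) a" using subC cC L'.C_shiftn by blast+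
  have "l \<le> c + n" using L.AC[OF kl L.C_shiftn(1)[OF cC]] ck L.A_len[OF kl] by linarith
  moreover have "c \<le> i \<and> j - i < n" if "A' i j" "i < k" "k < j" "j < l" for i j
    using L'.AC[OF that(1) c(1)] L'.A_len[OF that(1)] that ck False by auto
  moreover have "j \<le> c + n \<and> j - i < n" if "A' i j" "k < i" "i < l" "l < j" for i j
    using L'.AC[OF that(1) c(2)] L'.A_len[OF that(1)] that ck \<open>l \<le> c + n\<close> False by auto
  ultimately show ?thesis using ck cC by blast
qed

text \<open>If \<open>q < q'\<close>, the arc from \<open>q\<close> to \<open>k\<close> is
  compatible with the old triangulation, since an old arc crossing it would also cross the removed
  arc or \<open>q\<close>, \<open>m\<close>. It survives the exchange and is crossed by the arc from
  \<open>q'\<close> to \<open>m\<close>.\<close>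

lemma left_left:
  assumes "A' q m" "A' q' m" "q < k" "q' < k" "k < m" "m < l"
  shows "q = q'"
proof -
  have False if q: "A' q m" "A' q' m" "q < q'" "q' < k" for q q'
  proof -
    obtain c where c: "c \<le> k" "l \<le> c + n" "c \<le> q" using window q assms(5,6) by (smt (verit))
    have "A q k"
    proof (rule L.A_max)
      fix a b assume ab: "A a b"
      show "\<not> (q < a \<and> a < k \<and> k < b) \<and> \<not> (a < q \<and> q < b \<and> b < k)"
        using L.AA[OF kl ab] L.AA[OF ab kl] subA_cases[OF ab] L.A_len[OF ab] L'.AA[OF q(1), of a b]
          L'.AA[OF _ q(1), of a b] assms(5,6) q c short by (smt (verit))
    next
      fix p a assume Cp: "C p a"
      show "\<not> (q < p \<and> p < k)" using L'.AC[OF q(1) subC[OF Cp]] assms(5) by auto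
    qed (use q assms c L.A_len[OF kl] L'.A_len[OF q(1)] in auto)
    then have "A' q k" using subA_cases[of q k] q c assms short by (smt (verit))
    then show False using L'.AA[of q k q' m] q assms by auto
  qed
  then show ?thesis using assms by (metis not_less_iff_gr_or_eq)
qed

lemma right_right:
  assumes "A' m q" "A' m q'" "l < q" "l < q'" "k < m" "m < l"
  shows "q = q'"
proof -
  have False if q: "A' m q" "A' m q'" "q' < q" "l < q'" for q q'
  proof -
    obtain c where c: "c \<le> k" "l \<le> c + n" "q \<le> c + n" using window q assms(5,6) by (smt (verit))
    have "A l q"
    proof (rule L.A_max)
      fix a b assume ab: "A a b"
      show "\<not> (l < a \<and> a < q \<and> q < b) \<and> \<not> (a < l \<and> l < b \<and> b < q)"
        using L.AA[OF kl ab] L.AA[OF ab kl] subA_cases[OF ab] L.A_len[OF ab] L'.AA[OF q(1), of a b]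
          L'.AA[OF _ q(1), of a b] assms(5,6) q c short by (smt (verit))
    next
      fix p a assume Cp: "C p a"
      show "\<not> (l < p \<and> p < q)" using L'.AC[OF q(1) subC[OF Cp]] assms(6) by auto
    qed (use q assms c L.A_len[OF kl] L'.A_len[OF q(1)] in auto)
    then have "A' l q" using subA_cases[of l q] q c assms short by (smt (verit))
    then show False using L'.AA[of m q' l q] q assms by auto
  qed
  then show ?thesis using assms by (metis not_less_iff_gr_or_eq)
qed

text \<open>The removed arc and the arc from \<open>q\<close> to \<open>m\<close> are the diagonals
  of the quadrilateral with corners \<open>q\<close>, \<open>k\<close>, \<open>m\<close>,
  \<open>l\<close>. The arc from \<open>q\<close> to \<open>l\<close> is its outer side and belongs
  to both triangulations.\<close>

lemma left_cover:
  assumes q: "A' q m" "q < k" "k < m" "m < l" and len: "l - q < n"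
  shows "A' q l"
proof -
  obtain c where c: "c \<le> k" "l \<le> c + n" "c \<le> q" using window q by (smt (verit))
  have "A q l"
  proof (rule L.A_max)
    fix a b assume ab: "A a b"
    show "\<not> (q < a \<and> a < l \<and> l < b) \<and> \<not> (a < q \<and> q < b \<and> b < l)"
      using L.AA[OF kl ab] L.AA[OF ab kl] subA_cases[OF ab] L.A_len[OF ab] L'.AA[OF q(1), of a b]
        L'.AA[OF _ q(1), of a b] q c len short by (smt (verit))
  next
    fix p a assume Cp: "C p a"
    show "\<not> (q < p \<and> p < l)" using L'.AC[OF q(1) subC[OF Cp]] L.AC[OF kl Cp] q(2-4)
      by (smt (verit))
  qed (use q len L.A_len[OF kl] in auto)
  then show ?thesis using subA_len[of q l] q by simp
qed

lemma right_cover: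
  assumes q: "A' m q" "l < q" "k < m" "m < l" and len: "q - k < n"
  shows "A' k q"
proof -
  obtain c where c: "c \<le> k" "l \<le> c + n" "q \<le> c + n" using window q by (smt (verit))
  have "A k q"
  proof (rule L.A_max)
    fix a b assume ab: "A a b"
    show "\<not> (k < a \<and> a < q \<and> q < b) \<and> \<not> (a < k \<and> k < b \<and> b < q)"
      using L.AA[OF kl ab] L.AA[OF ab kl] subA_cases[OF ab] L.A_len[OF ab] L'.AA[OF q(1), of a b]
        L'.AA[OF _ q(1), of a b] q c len short by (smt (verit))
  next
    fix p a assume Cp: "C p a"
    show "\<not> (k < p \<and> p < q)" using L'.AC[OF q(1) subC[OF Cp]] L.AC[OF kl Cp] q(2-4)
      by (smt (verit))
  qed (use q len L.A_len[OF kl] in auto)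
  then show ?thesis using subA_len[of k q] q by simp
qed

text \<open>The window bounds \<open>q\<close> and \<open>q'\<close>, so \<open>l - q < n\<close>
  and the outer side from \<open>q\<close> to \<open>l\<close> exists; it crosses the arc from
  \<open>m\<close> to \<open>q'\<close>.\<close>

lemma left_right:
  assumes q: "A' q m" "q < k" "k < m" "m < l" and q': "A' m q'" "l < q'"
  shows False
proof -
  obtain c where c: "c \<le> k" "l \<le> c + n" "c \<le> q" "q' \<le> c + n"
    using window q q' by (smt (verit))
  then have "A' q l" using left_cover[OF q] q' by simp
  then show False using L'.AA[of q l m q'] q q' by auto
qed

text \<open>If \<open>l - q < n\<close>, the outer side from \<open>q\<close> to \<open>l\<close>
  passes over \<open>m\<close> and crosses the tangent chord there. Otherwise \<open>q\<close> and
  \<open>l\<close> are exactly the ends of the window, and the old triangulation has tangent chords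
  of both signs at \<open>c\<close>; one of them has the sign opposite to that of the chord at
  \<open>m\<close>, whose position is inequivalent.\<close>

lemma central_left:
  assumes q: "A' q m" "q < k" "k < m" "m < l" and Cm: "C' m a"
  shows False
proof -
  obtain c g where c: "c \<le> k" "l \<le> c + n" "c \<le> q" "C c g"
    using window q L'.C_K[OF Cm] by (smt (verit))
  show False
  proof (cases "l - q < n")
    case True
    then show False using left_cover[OF q] L'.AC[OF _ Cm, of q l] q by auto
  next
    case False
    then have eq: "q = c" "l = c + n" using c by auto
    have cm: "\<not> n dvd c - m" using L.small_dvd[of "c - m"] q eq by auto
    then have ag: "a = g" using L'.CC[OF subC[OF c(4)] Cm] by auto
    have "C c (\<not> g)"
    proof (rule L.C_max)
      fix x y assume xy: "A x y"
      show "\<not> (x < c \<and> c < y)"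
      proof
        assume h: "x < c \<and> c < y"
        have "A' x y" using subA_cases[OF xy] h q eq by linarith
        then have "m \<le> y" using L'.AA[OF _ q(1), of x y] h eq by auto
        moreover have "x + n \<le> k" using L.AA[OF kl L.A_shiftn(1)[OF xy]] h eq by auto
        ultimately show False using L.A_len[OF xy] q by auto
      qed
    next
      fix p b assume pb: "C p b"
      show "n dvd c - p \<or> (\<not> g) = b"
      proof -
        obtain z where z: "n dvd z" "c \<le> p + z" "p + z < c + n" using L.representative by blast
        have C: "C (p + z) b" using L.C_shift[OF pb z(1)] .
        have "\<not> (k < p + z \<and> p + z < l)" "\<not> (q < p + z \<and> p + z < m)"
          using L.AC[OF kl C] L'.AC[OF q(1) subC[OF C]] by auto
        then have "p + z = c" using z q eq by auto
        then show ?thesis using z(1) by (metis add_diff_cancel_left')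
      qed
    qed (use L'.C_K[OF Cm] in auto)
    then show False using L'.CC[OF subC[of c "\<not> g"] Cm] cm ag by blast
  qed
qed

lemma central_right:
  assumes q: "A' m q" "l < q" "k < m" "m < l" and Cm: "C' m a"
  shows False
proof -
  obtain c0 g where c0: "c0 \<le> k" "l \<le> c0 + n" "q \<le> c0 + n" "C c0 g"
    using window q L'.C_K[OF Cm] by (smt (verit))
  define c where "c = c0 + n"
  have c: "c - n \<le> k" "l \<le> c" "q \<le> c" "C c g" using c0 L.C_shiftn by (auto simp: c_def)
  show False
  proof (cases "q - k < n")
    case True
    then show False using right_cover[OF q] L'.AC[OF _ Cm, of k q] q by auto
  next
    case False
    then have eq: "q = c" "k = c - n" using c by auto
    have cm: "\<not> n dvd c - m" using L.small_dvd[of "c - m"] q eq by auto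
    then have ag: "a = g" using L'.CC[OF subC[OF c(4)] Cm] by auto
    have "C c (\<not> g)"
    proof (rule L.C_max)
      fix x y assume xy: "A x y"
      show "\<not> (x < c \<and> c < y)"
      proof
        assume h: "x < c \<and> c < y"
        have "A' x y" using subA_cases[OF xy] h q eq by linarith
        then have "x \<le> m" using L'.AA[OF q(1), of x y] h eq by auto
        moreover have "l \<le> y - n" using L.AA[OF L.A_shiftn(2)[OF xy] kl] h eq by auto
        ultimately show False using L.A_len[OF xy] q by auto
      qed
    next
      fix p b assume pb: "C p b"
      show "n dvd c - p \<or> (\<not> g) = b"
      proof -
        obtain z where z: "n dvd z" "c - n < p + z" "p + z \<le> c" using L.representative' by blast
        have C: "C (p + z) b" using L.C_shift[OF pb z(1)] .
        have "\<not> (k < p + z \<and> p + z < l)" "\<not> (m < p + z \<and> p + z < q)"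
          using L.AC[OF kl C] L'.AC[OF q(1) subC[OF C]] by auto
        then have "p + z = c" using z q eq by auto
        then show ?thesis using z(1) by (metis add_diff_cancel_left')
      qed
    qed (use L'.C_K[OF Cm] in auto)
    then show False using L'.CC[OF subC[of c "\<not> g"] Cm] cm ag by blast
  qed
qed

lemma central_central:
  assumes "C' m a" "C' m b" "k < m" "m < l"
  shows "a = b"
proof -
  obtain c g where c: "c \<le> k" "l \<le> c + n" "C c g"
    using window L'.C_K[OF assms(1)] by (smt (verit))
  then have "\<not> n dvd c - m" using L.small_dvd[of "c - m"] assms by auto
  then show ?thesis using L'.CC[OF subC[OF c(3)] assms(1)] L'.CC[OF subC[OF c(3)] assms(2)] by auto
qed

end

locale long_arc_exchange = arc_exchange +
  assumes long: "l = k + n"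
begin

lemma K: K
  using L.A_len[OF kl] long by auto

text \<open>A shorter new arc would make the arc from \<open>j\<close> to \<open>l\<close>
  compatible with the old triangulation. That arc survives and is crossed by the translate of the
  new arc by \<open>n\<close>.\<close>

lemma new_long:
  assumes "A' i j" "i < k" "k < j"
  shows "j - i = n"
proof (rule ccontr)
  assume "j - i \<noteq> n"
  then have len: "j - i < n" using L'.A_len[OF assms(1)] by simp
  have "A j l"
  proof (rule L.A_max)
    fix a b assume ab: "A a b"
    have "A' a b \<or> a = k \<and> b = l \<or> a \<le> k - n \<and> b \<le> k \<or> l \<le> a" using subA_cases[OF ab] long by auto
    then show "\<not> (j < a \<and> a < l \<and> l < b) \<and> \<not> (a < j \<and> j < b \<and> b < l)"
      using L.AA[OF ab kl] L.AA[OF kl ab] L'.AA[OF assms(1), of a b] assms len long by (smt (verit))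
  next
    fix p a assume "C p a" then show "\<not> (j < p \<and> p < l)" using L.C_K K by blast
  qed (use len long assms K L.n in auto)
  then have "A' j l" using subA_len[of j l] long assms by simp
  then show False using L'.AA[OF _ L'.A_shiftn(1)[OF assms(1)], of j l] len long assms by auto
qed

end

locale central_exchange = exchange_pair +
  fixes p :: int and g :: bool
  assumes pg: "C p g"
    and subA: "A i j \<Longrightarrow> A' i j"
    and subC: "C q b \<Longrightarrow> C' q b \<or> n dvd q - p \<and> b = g"
begin

lemma notK: "\<not> K" using L.C_K[OF pg] .

text \<open>An old arc over an end of the new arc would have to span it entirely and would then
  cross the removed tangent chord at \<open>p\<close>. An old tangent chord that conflicts with sign
  \<open>g\<close> at the end has the other sign and sits at \<open>p\<close> modulo
  \<open>n\<close>; it survives and lies under the new arc.\<close>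

lemma new_arc_central:
  assumes ij: "A' i j" "i < p" "p < j" and q: "q = i \<or> q = j"
  shows "C' q g"
proof -
  have len: "j - i < n" using L'.A_len[OF ij(1)] notK by simp
  have "C q g"
  proof (rule L.C_max[OF notK])
    fix a b assume ab: "A a b"
    show "\<not> (a < q \<and> q < b)"
      using L'.AA[OF subA[OF ab] ij(1)] L'.AA[OF ij(1) subA[OF ab]] L.AC[OF ab pg] ij q by auto
  next
    fix r b assume r: "C r b"
    show "n dvd q - r \<or> g = b"
    proof (rule ccontr)
      assume neg: "\<not> ?thesis"
      then have rb: "n dvd r - p" "C' r b" using L.CC[OF r pg] subC[OF r] by auto
      have "n dvd p - r" using rb(1) by (metis dvd_minus_iff minus_diff_eq)
      then have "C' p b" using L'.C_shift[OF rb(2), of "p - r"] by simp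
      then show False using L'.AC[OF ij(1)] ij by blast
    qed
  qed
  moreover have "\<not> n dvd q - p" using L.small_dvd[of "q - p"] len ij q by auto
  ultimately show ?thesis using subC by blast
qed

text \<open>The ends of both arcs carry tangent chords, so neither arc passes strictly over an end
  of the other. As both pass over \<open>p\<close>, they coincide.\<close>

lemma arc_unique:
  assumes "A' i j" "i < p" "p < j" "A' i' j'" "i' < p" "p < j'"
  shows "i = i' \<and> j = j'"
proof -
  have C: "C' i g" "C' j g" using new_arc_central[OF assms(1-3)] by simp_all
  have C': "C' i' g" "C' j' g" using new_arc_central[OF assms(4-6)] by simp_all
  have "\<not> i' < i" "\<not> j < j'" using L'.AC[OF assms(4) C(1)] L'.AC[OF assms(4) C(2)] assms by linarith+
  moreover have "\<not> i < i'" "\<not> j' < j" using L'.AC[OF assms(1) C'(1)] L'.AC[OF assms(1) C'(2)] assms by linarith+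
  ultimately show ?thesis by linarith
qed

lemma arc_central:
  assumes ij: "A' i j" "i < p" "p < j" and q: "C' q (\<not> g)"
  shows False
proof -
  have "n dvd i - q" "n dvd j - q"
    using L'.CC[OF new_arc_central[OF ij, of i] q] L'.CC[OF new_arc_central[OF ij, of j] q] by auto
  then have "n dvd j - i" using dvd_diff[of n "j - q" "i - q"] by simp
  then show False using L.small_dvd[of "j - i"] L'.A_len[OF ij(1)] notK by auto
qed

text \<open>The arc from \<open>q\<close> to \<open>p + n\<close> is compatible with the old
  triangulation: an old tangent chord under it would have sign \<open>g\<close> and conflict with
  the new chord at \<open>q\<close>. So the arc survives, but it passes over
  \<open>q'\<close>.\<close>

lemma central_unique:
  assumes "C' q (\<not> g)" "C' q' (\<not> g)" "p < q" "q < q'" "q' < p + n"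
  shows False
proof -
  have "A q (p + n)"
  proof (rule L.A_max)
    fix a b assume ab: "A a b"
    show "\<not> (q < a \<and> a < p + n \<and> p + n < b) \<and> \<not> (a < q \<and> q < b \<and> b < p + n)"
      using L'.AC[OF subA[OF ab] assms(1)] L.AC[OF ab L.C_shiftn(1)[OF pg]] by auto
  next
    fix r b assume r: "C r b"
    show "\<not> (q < r \<and> r < p + n)"
    proof
      assume h: "q < r \<and> r < p + n"
      have "\<not> n dvd r - p" "\<not> n dvd r - q" using L.small_dvd[of "r - p"] L.small_dvd[of "r - q"] h assms by auto
      then have "b = g" "C' r b" using L.CC[OF r pg] subC[OF r] by auto
      then show False using L'.CC[OF _ assms(1), of r b] \<open>\<not> n dvd r - q\<close> by auto
    qed
  qed (use assms in auto)
  then show False using L'.AC[OF subA assms(2), of q "p + n"] assms by auto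
qed

end

text \<open>The vertices of a centrally symmetric \<open>2 * n\<close>-gon are indexed by the integers modulo
  \<open>2 * n\<close>, and the reflection in the center is the shift by \<open>n\<close>. So a centrally symmetric pair of
  diagonals is an orbit of arcs \<open>Arc i j\<close> with \<open>2 \<le> j - i \<le> n\<close> under the shifts by multiples of \<open>n\<close>,
  and a pair of chords tangent to the disk is an orbit of \<open>Cen p a\<close>, where \<open>a\<close> tells left from
  right. In the locale \<open>cover\<close> below, the flag \<open>K\<close> selects type B/C, where long diagonals
  (\<open>j - i = n\<close>) occur and tangent chords do not, over type D.\<close>

datatype arc = Arc int int | Cen int bool

fun shift :: "int \<Rightarrow> arc \<Rightarrow> arc" where
  "shift m (Arc i j) = Arc (i + m) (j + m)"
| "shift m (Cen p a) = Cen (p + m) a"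

lemma shift_shift [simp]: "shift m (shift m' x) = shift (m + m') x"
  by (cases x) auto

lemma shift_0 [simp]: "shift 0 x = x"
  by (cases x) auto

section \<open>Orbits of arcs and their crossings\<close>

locale cover =
  fixes n :: int and K :: bool
  assumes n: "2 \<le> n"
begin

lemmas dvd_cases [consumes 1, case_names zero pos neg big_pos big_neg] = multiple_cases[OF n]

fun valid :: "arc \<Rightarrow> bool" where
  "valid (Arc i j) \<longleftrightarrow> 2 \<le> j - i \<and> j - i \<le> n \<and> (\<not> K \<longrightarrow> j - i < n)"
| "valid (Cen p a) \<longleftrightarrow> \<not> K"

text \<open>Without this congruence rule the simplifier rewrites the locale parameter \<open>K\<close> inside
  \<^const>\<open>valid\<close>.\<close>

lemma valid_cong [cong]: "x = y \<Longrightarrow> valid x = valid y"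
  by simp

text \<open>The arc clauses compare single lifts. The last clause compares positions modulo
  \<open>n\<close>: two pairs of tangent chords cross exactly when their signs differ and their
  vertices differ up to the reflection.\<close>

fun crs :: "arc \<Rightarrow> arc \<Rightarrow> bool" where
  "crs (Arc i j) (Arc k l) \<longleftrightarrow> i < k \<and> k < j \<and> j < l \<or> k < i \<and> i < l \<and> l < j"
| "crs (Arc i j) (Cen p a) \<longleftrightarrow> i < p \<and> p < j"
| "crs (Cen p a) (Arc i j) \<longleftrightarrow> i < p \<and> p < j"
| "crs (Cen p a) (Cen q b) \<longleftrightarrow> \<not> n dvd p - q \<and> a \<noteq> b"

definition orb :: "arc \<Rightarrow> arc set" where
  "orb x = {shift m x | m. n dvd m}"

definition orbits :: "arc set set" where
  "orbits = orb ` {x. valid x}"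

definition cro :: "arc set \<Rightarrow> arc set \<Rightarrow> bool" where
  "cro X Y \<longleftrightarrow> (\<exists>x\<in>X. \<exists>y\<in>Y. crs x y)"

lemma crs_sym: "crs x y \<longleftrightarrow> crs y x"
  by (cases x; cases y) (auto simp: dvd_diff_commute)

lemma crs_shift [simp]: "crs (shift m x) (shift m y) \<longleftrightarrow> crs x y"
  by (cases x; cases y) auto

lemma valid_shift [simp]: "valid (shift m x) \<longleftrightarrow> valid x"
  by (cases x) auto

lemma in_orb [simp]: "x \<in> orb x"
  unfolding orb_def by (auto intro!: exI[of _ 0])

lemma shift_in_orb: "n dvd m \<Longrightarrow> shift m x \<in> orb x"
  unfolding orb_def by blast

lemma orb_shift [simp]:
  assumes "n dvd m"
  shows "orb (shift m x) = orb x"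
proof (intro set_eqI iffI)
  fix y
  show "y \<in> orb x" if y: "y \<in> orb (shift m x)"
  proof -
    from y obtain k where "y = shift (k + m) x" "n dvd k" by (auto simp: orb_def)
    then show ?thesis using assms unfolding orb_def by (metis (mono_tags) dvd_add mem_Collect_eq)
  qed
  show "y \<in> orb (shift m x)" if y: "y \<in> orb x"
  proof -
    from y obtain k where "y = shift (k - m) (shift m x)" "n dvd k" by (auto simp: orb_def)
    then show ?thesis using assms unfolding orb_def by (metis (mono_tags) dvd_diff mem_Collect_eq)
  qed
qed

lemma orb_eq: "y \<in> orb x \<Longrightarrow> orb y = orb x"
  using orb_shift by (auto simp: orb_def[of x])

lemma orbitsE:
  assumes "X \<in> orbits" "x \<in> X"
  shows "X = orb x" "valid x"
proof -
  obtain y where y: "X = orb y" "valid y" using assms(1) by (auto simp: orbits_def)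
  then show "X = orb x" using orb_eq assms(2) by simp
  show "valid x" using y assms(2) by (auto simp: orb_def)
qed

lemma cro_orb: "cro (orb x) (orb y) \<longleftrightarrow> (\<exists>m. n dvd m \<and> crs x (shift m y))"
proof
  assume "cro (orb x) (orb y)"
  then obtain a b where ab: "n dvd a" "n dvd b" "crs (shift a x) (shift b y)"
    unfolding cro_def orb_def by blast
  then have "crs (shift (- a) (shift a x)) (shift (- a) (shift b y))" by (simp only: crs_shift)
  then show "\<exists>m. n dvd m \<and> crs x (shift m y)" using ab(1,2) by (intro exI[of _ "b - a"]) simp
next
  assume "\<exists>m. n dvd m \<and> crs x (shift m y)"
  then show "cro (orb x) (orb y)" unfolding cro_def using in_orb shift_in_orb by blast
qed

lemma croI: "crs x y \<Longrightarrow> cro (orb x) (orb y)"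
  unfolding cro_def using in_orb by blast

lemma lifted_of_tri:
  assumes T: "T \<in> tri cro orbits"
  shows "lifted n K (\<lambda>i j. valid (Arc i j) \<and> orb (Arc i j) \<in> T) (\<lambda>p a. valid (Cen p a) \<and> orb (Cen p a) \<in> T)"
proof -
  have nc: "\<not> crs x y" if "orb x \<in> T" "orb y \<in> T" for x y
    using T that croI[of x y] by (auto simp: tri_def)
  have mx: "orb x \<in> T" if "valid x" and nc: "\<And>y. valid y \<Longrightarrow> orb y \<in> T \<Longrightarrow> \<not> crs x y" for x
  proof -
    have "\<not> cro (orb x) Y" if Y: "Y \<in> T" for Y
    proof
      assume "cro (orb x) Y"
      moreover obtain y where y: "Y = orb y" "valid y" using Y T by (auto simp: tri_def orbits_def)
      ultimately obtain m where "n dvd m" "crs x (shift m y)" using cro_orb by blast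
      then show False using nc[of "shift m y"] y Y by simp
    qed
    then show ?thesis using T that(1) by (auto simp: tri_def orbits_def)
  qed
  have sh: "orb (Arc (i + m) (j + m)) = orb (Arc i j)" "orb (Cen (p + m) a) = orb (Cen p a)"
    if "n dvd m" for i j p m a
    using orb_shift[OF that, of "Arc i j"] orb_shift[OF that, of "Cen p a"] by simp_all
  show ?thesis
  proof
    fix i j
    assume a: "2 \<le> j - i" "j - i \<le> n" "\<not> K \<longrightarrow> j - i < n"
      "\<And>k l. valid (Arc k l) \<and> orb (Arc k l) \<in> T \<Longrightarrow> \<not> (i < k \<and> k < j \<and> j < l) \<and> \<not> (k < i \<and> i < l \<and> l < j)"
      "\<And>p a. valid (Cen p a) \<and> orb (Cen p a) \<in> T \<Longrightarrow> \<not> (i < p \<and> p < j)"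
    have "\<not> crs (Arc i j) y" if "valid y" "orb y \<in> T" for y
      using a(4,5) that by (cases y) auto
    then show "valid (Arc i j) \<and> orb (Arc i j) \<in> T" using a(1-3) mx by simp
  next
    fix p a
    assume a: "\<not> K"
      "\<And>k l. valid (Arc k l) \<and> orb (Arc k l) \<in> T \<Longrightarrow> \<not> (k < p \<and> p < l)"
      "\<And>q b. valid (Cen q b) \<and> orb (Cen q b) \<in> T \<Longrightarrow> n dvd p - q \<or> a = b"
    have "\<not> crs (Cen p a) y" if "valid y" "orb y \<in> T" for y
      using a(2,3) that by (cases y) auto
    moreover have v: "valid (Cen p a)" unfolding valid.simps by (fact a(1))
    ultimately show "valid (Cen p a) \<and> orb (Cen p a) \<in> T" using mx[OF v] by blast
  qed (use n nc sh in \<open>auto dest: nc\<close>)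
qed

definition arcs_of :: "arc set set \<Rightarrow> int \<Rightarrow> int \<Rightarrow> bool" where
  "arcs_of T i j \<longleftrightarrow> valid (Arc i j) \<and> orb (Arc i j) \<in> T"

definition centrals_of :: "arc set set \<Rightarrow> int \<Rightarrow> bool \<Rightarrow> bool" where
  "centrals_of T p a \<longleftrightarrow> valid (Cen p a) \<and> orb (Cen p a) \<in> T"

text \<open>These serve the same purpose as \<open>valid_cong\<close>: they keep the locale
  parameter \<open>K\<close> inside the two constants from being rewritten.\<close>

lemma arcs_of_cong [cong]: "T = T' \<Longrightarrow> i = i' \<Longrightarrow> j = j' \<Longrightarrow> arcs_of T i j = arcs_of T' i' j'"
  and centrals_of_cong [cong]: "T = T' \<Longrightarrow> i = i' \<Longrightarrow> a = a' \<Longrightarrow> centrals_of T i a = centrals_of T' i' a'"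
  by simp_all

lemma lifted_arcs_of: "T \<in> tri cro orbits \<Longrightarrow> lifted n K (arcs_of T) (centrals_of T)"
  using lifted_of_tri unfolding arcs_of_def centrals_of_def .

text \<open>Both new chords are lifted so as to cross one fixed lift of the removed chord. Under a
  short arc they meet at the same inner vertex and the pairwise lemmas identify them. Replacing a
  long arc yields only long arcs, of which two inequivalent ones would cross. For a removed tangent
  chord the pairs of kinds are compared directly.\<close>

lemma unique_exchange_orbits:
  assumes S: "S \<in> tri cro orbits" and S': "S' \<in> tri cro orbits" and e: "e \<in> S" and sub: "S - {e} \<subseteq> S'"
    and y: "y \<in> S' - S" and y': "y' \<in> S' - S"
  shows "y = y'"
proof -
  interpret exchange_pair n K "arcs_of S" "centrals_of S" "arcs_of S'" "centrals_of S'"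
    by (intro exchange_pair.intro lifted_arcs_of S S')
  have "e \<in> orbits" using S e by (auto simp: tri_def)
  then obtain x where x: "e = orb x" "valid x" by (auto simp: orbits_def)
  have lift: "\<exists>z. y = orb z \<and> valid z \<and> crs x z" if y: "y \<in> S' - S" for y
  proof -
    have yo: "y \<in> orbits" using y S' by (auto simp: tri_def)
    then obtain t where t: "t \<in> S" "cro y t" using S y unfolding tri_def by blast
    \<comment> \<open>A new chord crosses something in the maximal \<open>S\<close> but nothing in
      \<open>S'\<close>, so what it crosses is the removed chord.\<close>
    then have "t \<notin> S'" using S' y by (auto simp: tri_def)
    then have "t = e" using t sub by blast
    obtain z where z: "y = orb z" "valid z" using yo by (auto simp: orbits_def)
    have "cro e y" using t(2) \<open>t = e\<close> crs_sym unfolding cro_def by blast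
    then obtain m where "n dvd m" "crs x (shift m z)" using cro_orb x(1) z(1) by blast
    then show ?thesis using z by (intro exI[of _ "shift m z"]) simp
  qed
  obtain z z' where z: "y = orb z" "valid z" "crs x z" and z': "y' = orb z'" "valid z'" "crs x z'"
    using lift y y' by blast
  have zA: "arcs_of S' i j" if "z = Arc i j \<or> z' = Arc i j" for i j
    using that z z' y y' by (auto simp: arcs_of_def)
  have zC: "centrals_of S' p a" if "z = Cen p a \<or> z' = Cen p a" for p a
    using that z z' y y' by (auto simp: centrals_of_def)
  have out: "\<exists>m. n dvd m \<and> w = shift m x" if "orb w \<in> S" "orb w \<notin> S'" for w
  proof -
    have "orb w = orb x" using that sub x by blast
    then have "w \<in> orb x" using in_orb by metis
    then show ?thesis by (auto simp: orb_def)
  qed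
  show ?thesis
  proof (cases x)
    case (Arc k l)
    have A: "arc_exchange n K (arcs_of S) (centrals_of S) (arcs_of S') (centrals_of S') k l"
    proof
      show "arcs_of S k l" using x e Arc by (auto simp: arcs_of_def)
      show "arcs_of S' i j \<or> (\<exists>m. n dvd m \<and> i = k + m \<and> j = l + m)" if "arcs_of S i j" for i j
        using out[of "Arc i j"] that Arc by (auto simp: arcs_of_def)
      show "centrals_of S' p a" if "centrals_of S p a" for p a
        using out[of "Cen p a"] that Arc by (auto simp: centrals_of_def)
    qed
    then interpret arc_exchange n K "arcs_of S" "centrals_of S" "arcs_of S'" "centrals_of S'" k l .
    show ?thesis
    proof (cases "l - k < n")
      case True
      then interpret short_arc_exchange n K "arcs_of S" "centrals_of S" "arcs_of S'" "centrals_of S'" k l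
        by unfold_locales
      \<comment> \<open>\<open>enters z m\<close> says that the chord \<open>z\<close> leaves the
        interval from \<open>k\<close> to \<open>l\<close> at its inner vertex
        \<open>m\<close>.\<close>
      define enters where "enters z m \<longleftrightarrow> k < m \<and> m < l \<and> ((\<exists>i<k. z = Arc i m \<and> arcs_of S' i m) \<or>
          (\<exists>j>l. z = Arc m j \<and> arcs_of S' m j) \<or> (\<exists>a. z = Cen m a \<and> centrals_of S' m a))" for z m
      have c: "\<exists>m. enters z m"
        if "crs x z" and A: "\<And>i j. z = Arc i j \<Longrightarrow> arcs_of S' i j" and C: "\<And>p a. z = Cen p a \<Longrightarrow> centrals_of S' p a" for z
      proof (cases z)
        case z: (Arc i j)
        have "enters z j \<or> enters z i" using that(1) A[OF z] z Arc by (auto simp: enters_def)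
        then show ?thesis by blast
      next
        case z: (Cen p a)
        have "enters z p" using that(1) C[OF z] z Arc by (auto simp: enters_def)
        then show ?thesis by blast
      qed
      obtain m where m: "enters z m" using c[OF z(3)] zA zC by auto
      obtain m' where m': "enters z' m'" using c[OF z'(3)] zA zC by auto
      have "inner m" "inner m'" using m m' unfolding inner_def enters_def by blast+
      then have mm: "m' = m" using inner_unique by blast
      have "z = z'"
        using m m' unfolding mm enters_def
        by (elim disjE exE conjE; hypsubst)
          (blast dest: left_left right_right central_central left_right central_left central_right)+
      then show ?thesis using z z' by simp
    next
      case False
      then have "l = k + n" using L.A_len[OF kl] by simp
      then interpret long_arc_exchange n K "arcs_of S" "centrals_of S" "arcs_of S'" "centrals_of S'" k l
        by unfold_locales
      have c: "\<exists>i. z = Arc i (i + n)" if "crs x z" "valid z" "\<And>i j. z = Arc i j \<Longrightarrow> arcs_of S' i j" for z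
      proof (cases z)
        case z: (Arc i j)
        have "j - i = n"
          using new_long[of i j] new_long[of "i - n" "j - n"] that(1,2) that(3)[OF z]
            L'.A_shiftn(2)[OF that(3)[OF z]] z Arc \<open>l = k + n\<close> by auto
        then show ?thesis using z by (intro exI[of _ i]) simp
      qed (use that K in simp)
      obtain i i' where i: "z = Arc i (i + n)" "z' = Arc i' (i' + n)" using c z z' zA by metis
      obtain m where m: "n dvd m" "i \<le> i' + m" "i' + m < i + n" using L.representative by blast
      have "arcs_of S' (i' + m) (i' + n + m)" using L'.A_shift[OF zA m(1)] i by blast
      \<comment> \<open>Long arcs starting at different points of one period cross.\<close>
      then have "i = i' + m" using L'.AA[of i "i + n" "i' + m" "i' + n + m"] zA i m by auto
      then have "z = shift m z'" using i by simp
      then show ?thesis using z z' orb_shift m(1) by metis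
    qed
  next
    case (Cen p g)
    interpret central_exchange n K "arcs_of S" "centrals_of S" "arcs_of S'" "centrals_of S'" p g
    proof
      show "centrals_of S p g" using x e Cen by (auto simp: centrals_of_def)
      show "arcs_of S' i j" if "arcs_of S i j" for i j
        using out[of "Arc i j"] that Cen by (auto simp: arcs_of_def)
      show "centrals_of S' q b \<or> n dvd q - p \<and> b = g" if "centrals_of S q b" for q b
        using out[of "Cen q b"] that Cen by (auto simp: centrals_of_def)
    qed
    show ?thesis
    proof (cases z)
      case z1: (Arc i j)
      show ?thesis
      proof (cases z')
        case z2: (Arc i' j')
        then show ?thesis using arc_unique[OF zA[of i j] _ _ zA[of i' j']] z z' z1 Cen by auto
      next
        case z2: (Cen q b)
        then show ?thesis using arc_central[OF zA[of i j], of q] zC[of q b] z z' z1 Cen by auto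
      qed
    next
      case z1: (Cen q b)
      show ?thesis
      proof (cases z')
        case z2: (Arc i' j')
        then show ?thesis using arc_central[OF zA[of i' j'], of q] zC[of q b] z z' z1 Cen by auto
      next
        case z2: (Cen q' b')
        have b: "b = (\<not> g)" "b' = (\<not> g)" "\<not> n dvd p - q" "\<not> n dvd p - q'" using z z' z1 z2 Cen by auto
        obtain m where m: "n dvd m" "p \<le> q + m" "q + m < p + n" using L.representative by blast
        obtain m' where m': "n dvd m'" "p \<le> q' + m'" "q' + m' < p + n" using L.representative by blast
        have C: "centrals_of S' (q + m) (\<not> g)" "centrals_of S' (q' + m') (\<not> g)"
          using L'.C_shift[OF zC[of q b] m(1)] L'.C_shift[OF zC[of q' b'] m'(1)] z1 z2 b by auto
        have "p \<noteq> q + m" "p \<noteq> q' + m'" using b(3,4) m(1) m'(1) by auto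
        then have "q + m = q' + m'"
          using central_unique[OF C(1,2)] central_unique[OF C(2,1)] m m' by (smt (verit))
        then have "shift m z = shift m' z'" using z1 z2 b by simp
        then show ?thesis using z z' orb_shift m(1) m'(1) by metis
      qed
    qed
  qed
qed

lemma cro_sym: "cro X Y \<Longrightarrow> cro Y X"
  using crs_sym unfolding cro_def by blast

lemma cro_irrefl:
  assumes "X \<in> orbits"
  shows "\<not> cro X X"
proof -
  obtain x where x: "X = orb x" "valid x" using assms by (auto simp: orbits_def)
  have "\<not> crs x (shift m x)" if "n dvd m" for m
  proof (cases x)
    case (Arc i j)
    show ?thesis using that x(2) Arc n by (cases rule: dvd_cases) auto
  qed auto
  then show ?thesis using cro_orb x by blast
qed

end

sublocale cover \<subseteq> crossing_system cro orbits
  by unfold_locales (fact cro_sym cro_irrefl unique_exchange_orbits)+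

section \<open>Retraction data given on lifts\<close>

context cover
begin

definition cross_orb :: "arc \<Rightarrow> arc \<Rightarrow> bool" where
  "cross_orb x y \<longleftrightarrow> (\<exists>m. n dvd m \<and> crs (shift m x) y)"

lemma cro_cross_orb: "cro (orb x) (orb y) \<longleftrightarrow> cross_orb x y"
proof -
  have "cro (orb x) (orb y) \<longleftrightarrow> cro (orb y) (orb x)" using cro_sym by blast
  then show ?thesis unfolding cross_orb_def cro_orb crs_sym[of _ y] by simp
qed

end

text \<open>These are the assumptions of \<open>projection\<close> for orbits, spelled out on lifts.
  Crossing and blocking are invariant under common translation, so one lift can be fixed in each
  condition; the freedom left for the others shows up as explicit multiples of
  \<open>n\<close>.\<close>

locale lift_projection = cover +
  fixes d :: arc and F bl :: "arc \<Rightarrow> arc \<Rightarrow> bool"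
  assumes valid_d: "valid d"
    and F_crs: "\<lbrakk>F t x; valid t; valid x\<rbrakk> \<Longrightarrow> crs t d"
    and F_ncrs: "\<lbrakk>F t x; valid t; valid x; n dvd m\<rbrakk> \<Longrightarrow> \<not> crs (shift m x) d"
    and bl_crs: "bl t x \<Longrightarrow> crs t x"
    and bl_shift: "n dvd m \<Longrightarrow> bl t x \<Longrightarrow> bl (shift m t) (shift m x)"
    and blI_lift: "\<lbrakk>valid t; valid x; crs t x; \<forall>m. n dvd m \<longrightarrow> \<not> crs (shift m t) d; \<forall>m. n dvd m \<longrightarrow> \<not> crs (shift m x) d\<rbrakk> \<Longrightarrow> bl t x"
    and bl_F_lift: "\<lbrakk>F t x; valid t; valid x; valid s; bl s x\<rbrakk> \<Longrightarrow> \<exists>m. n dvd m \<and> crs (shift m s) t"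
    and bl_F_crs: "\<lbrakk>valid t; valid z; crs t d; bl t z; \<forall>m. n dvd m \<longrightarrow> \<not> crs (shift m z) d\<rbrakk> \<Longrightarrow>
        \<exists>x m m'. n dvd m \<and> n dvd m' \<and> valid x \<and> F (shift m t) x \<and> crs (shift m' x) z"
    and F_surj_lift: "\<lbrakk>lifted n K A C; valid x; \<not> (case x of Arc i j \<Rightarrow> A i j | Cen p a \<Rightarrow> C p a);
        \<forall>m. n dvd m \<longrightarrow> \<not> crs (shift m x) d;
        \<forall>i j. A i j \<longrightarrow> \<not> bl (Arc i j) x; \<forall>p a. C p a \<longrightarrow> \<not> bl (Cen p a) x\<rbrakk> \<Longrightarrow>
        \<exists>m. n dvd m \<and> ((\<exists>i j. A i j \<and> F (Arc i j) (shift m x)) \<or> (\<exists>p a. C p a \<and> F (Cen p a) (shift m x)))"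
    and F_F_lift: "\<lbrakk>F t x; F t' y; valid t; valid t'; valid x; valid y; n dvd m; crs x (shift m y)\<rbrakk> \<Longrightarrow>
        bl t (shift m y) \<or> bl t' (shift (- m) x)"
    and F_unique_lift: "\<lbrakk>F e x; F (shift m e) y; n dvd m; valid e; valid s; valid x; valid y;
        bl s x; bl (shift m' s) y; n dvd m'; crs (shift m'' s) d; n dvd m''\<rbrakk> \<Longrightarrow> \<exists>k. n dvd k \<and> y = shift k x"
begin

definition FO :: "arc set \<Rightarrow> arc set \<Rightarrow> bool" where
  "FO T X \<longleftrightarrow> T \<in> orbits \<and> X \<in> orbits \<and> (\<exists>t\<in>T. \<exists>x\<in>X. F t x)"

definition blo :: "arc set \<Rightarrow> arc set \<Rightarrow> bool" where
  "blo T X \<longleftrightarrow> (\<exists>t\<in>T. \<exists>x\<in>X. bl t x)"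

lemma blo_orb: "blo (orb t) (orb x) \<longleftrightarrow> (\<exists>m. n dvd m \<and> bl (shift m t) x)"
proof
  assume "blo (orb t) (orb x)"
  then obtain a b where ab: "n dvd a" "n dvd b" "bl (shift a t) (shift b x)"
    unfolding blo_def orb_def by blast
  then have "bl (shift (- b) (shift a t)) (shift (- b) (shift b x))" by (intro bl_shift) simp_all
  then show "\<exists>m. n dvd m \<and> bl (shift m t) x" using ab(1,2) by (intro exI[of _ "a - b"]) simp
next
  assume "\<exists>m. n dvd m \<and> bl (shift m t) x"
  then show "blo (orb t) (orb x)" unfolding blo_def using in_orb shift_in_orb by blast
qed

lemma ncrs_orb: "\<not> cro (orb x) (orb d) \<longleftrightarrow> (\<forall>m. n dvd m \<longrightarrow> \<not> crs (shift m x) d)"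
  unfolding cro_cross_orb cross_orb_def by blast

lemma FO_E:
  assumes "FO T X"
  obtains t x where "T = orb t" "X = orb x" "valid t" "valid x" "F t x"
  using assms orbitsE unfolding FO_def by metis

lemma projection_orbits: "projection cro orbits (orb d) FO blo"
proof unfold_locales
  show "orb d \<in> orbits" using valid_d by (auto simp: orbits_def)
next
  fix T X assume "FO T X"
  then obtain t x where *: "T = orb t" "X = orb x" "valid t" "valid x" "F t x" by (rule FO_E)
  have "crs t d" using F_crs * by blast
  then have "cro T (orb d)" using croI * by blast
  moreover have "\<not> cro X (orb d)" unfolding * ncrs_orb using F_ncrs * by blast
  moreover have "X \<in> orbits" using * by (auto simp: orbits_def)
  ultimately show "X \<in> orbits \<and> cro T (orb d) \<and> \<not> cro X (orb d)" by blast
next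
  fix T X assume "blo T X"
  then show "cro T X" using bl_crs unfolding blo_def cro_def by blast
next
  fix T X assume *: "T \<in> orbits" "X \<in> orbits" "cro T X" "\<not> cro T (orb d)" "\<not> cro X (orb d)"
  obtain t x where tx: "T = orb t" "X = orb x" "valid t" "valid x" using *(1,2) by (auto simp: orbits_def)
  obtain m where m: "n dvd m" "crs (shift m t) x" using *(3) unfolding tx cro_cross_orb cross_orb_def by blast
  have "\<forall>k. n dvd k \<longrightarrow> \<not> crs (shift k (shift m t)) d"
    using *(4) m(1) dvd_add[of n _ m] unfolding tx ncrs_orb shift_shift by blast
  then have "bl (shift m t) x" using blI_lift[of "shift m t" x] m tx *(5) unfolding tx ncrs_orb by auto
  then show "blo T X" unfolding tx blo_orb using m by blast
next
  fix T X S assume *: "FO T X" "T \<in> orbits" "S \<in> orbits" "blo S X"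
  obtain t x where tx: "T = orb t" "X = orb x" "valid t" "valid x" "F t x" using *(1) by (rule FO_E)
  obtain s where s: "S = orb s" "valid s" using *(3) by (auto simp: orbits_def)
  obtain m where m: "n dvd m" "bl (shift m s) x" using *(4) unfolding tx s blo_orb by blast
  obtain m' where m': "n dvd m'" "crs (shift m' (shift m s)) t" using bl_F_lift[of t x "shift m s"] m tx s by auto
  then have "crs (shift (m' + m) s) t" "n dvd m' + m" using m by auto
  then show "cro S T" unfolding s tx cro_cross_orb cross_orb_def by blast
next
  fix T Z assume *: "T \<in> orbits" "Z \<in> orbits" "cro T (orb d)" "blo T Z" "\<not> cro Z (orb d)"
  obtain t z where tz: "T = orb t" "Z = orb z" "valid t" "valid z" using *(1,2) by (auto simp: orbits_def)
  obtain m where m: "n dvd m" "crs (shift m t) d" using *(3) unfolding tz cro_cross_orb cross_orb_def by blast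
  obtain m' where m': "n dvd m'" "bl (shift m' t) z" using *(4) unfolding tz blo_orb by blast
  \<comment> \<open>Both chords are moved to the lift in which \<open>t\<close> crosses
    \<open>d\<close>.\<close>
  have "bl (shift (m - m') (shift m' t)) (shift (m - m') z)" using m m' by (intro bl_shift) auto
  then have b: "bl (shift m t) (shift (m - m') z)" by simp
  have mm: "n dvd m - m'" using m m' by simp
  then have "\<forall>k. n dvd k \<longrightarrow> \<not> crs (shift k (shift (m - m') z)) d"
    using *(5) dvd_add[of n _ "m - m'"] unfolding tz ncrs_orb shift_shift by blast
  then obtain x k k' where x: "n dvd k" "n dvd k'" "valid x" "F (shift k (shift m t)) x"
      "crs (shift k' x) (shift (m - m') z)"
    using bl_F_crs[of "shift m t" "shift (m - m') z"] tz m(2) b by auto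
  have "shift k (shift m t) \<in> T" unfolding tz using shift_in_orb[of "k + m"] x m by auto
  moreover have "orb x \<in> orbits" using x(3) by (auto simp: orbits_def)
  ultimately have "FO T (orb x)" unfolding FO_def using x(4) *(1) in_orb by blast
  moreover have "cro (orb (shift k' x)) (orb (shift (m - m') z))" using x croI by blast
  then have "cro (orb x) Z" using x mm tz orb_shift by simp
  ultimately show "\<exists>X. FO T X \<and> cro X Z" by blast
next
  fix T X assume T: "T \<in> tri cro orbits" and X: "X \<in> orbits - T" "\<not> cro X (orb d)" "\<forall>t\<in>T. \<not> blo t X"
  obtain x where x: "X = orb x" "valid x" using X(1) by (auto simp: orbits_def)
  have nb: "\<not> bl t x" if "orb t \<in> T" for t using X(3) that in_orb unfolding blo_def x by blast
  have "\<exists>m. n dvd m \<and> ((\<exists>i j. arcs_of T i j \<and> F (Arc i j) (shift m x)) \<or> (\<exists>p a. centrals_of T p a \<and> F (Cen p a) (shift m x)))"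
  proof (rule F_surj_lift[OF lifted_arcs_of[OF T] x(2)])
    show "\<not> (case x of Arc i j \<Rightarrow> arcs_of T i j | Cen p a \<Rightarrow> centrals_of T p a)"
      using X(1) x by (cases x) (auto simp: arcs_of_def centrals_of_def)
    show "\<forall>m. n dvd m \<longrightarrow> \<not> crs (shift m x) d" using X(2) unfolding x ncrs_orb .
    show "\<forall>i j. arcs_of T i j \<longrightarrow> \<not> bl (Arc i j) x" "\<forall>p a. centrals_of T p a \<longrightarrow> \<not> bl (Cen p a) x"
      using nb by (auto simp: arcs_of_def centrals_of_def)
  qed
  then obtain m t where t: "n dvd m" "orb t \<in> T" "valid t" "F t (shift m x)"
    unfolding arcs_of_def centrals_of_def by blast
  have "orb t \<in> orbits" using t(3) by (auto simp: orbits_def)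
  moreover have "t \<in> orb t" "shift m x \<in> X" using in_orb shift_in_orb[OF t(1)] x by auto
  ultimately have "FO (orb t) X" unfolding FO_def using t(4) X(1) by blast
  then show "\<exists>t\<in>T. FO t X" using t by blast
next
  fix T X T' Y assume *: "FO T X" "FO T' Y" "T \<in> orbits" "T' \<in> orbits" "cro X Y"
  obtain t x where tx: "T = orb t" "X = orb x" "valid t" "valid x" "F t x" using *(1) by (rule FO_E)
  obtain t' y where ty: "T' = orb t'" "Y = orb y" "valid t'" "valid y" "F t' y" using *(2) by (rule FO_E)
  obtain m where m: "n dvd m" "crs x (shift m y)" using *(5) unfolding tx ty cro_orb by blast
  have "bl t (shift m y) \<or> bl t' (shift (- m) x)" using F_F_lift tx ty m by blast
  then show "blo T Y \<or> blo T' X"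
  proof
    assume "bl t (shift m y)"
    then show ?thesis unfolding blo_def tx ty using in_orb shift_in_orb m by blast
  next
    assume "bl t' (shift (- m) x)"
    moreover have "n dvd - m" using m by simp
    ultimately show ?thesis unfolding blo_def tx ty using in_orb shift_in_orb by blast
  qed
next
  fix E X Y S assume *: "FO E X" "FO E Y" "E \<in> orbits" "S \<in> orbits" "blo S X" "blo S Y" "cro S (orb d)" "cro S E"
  obtain e x where ex: "E = orb e" "X = orb x" "valid e" "valid x" "F e x" using *(1) by (rule FO_E)
  obtain e' y where ey: "E = orb e'" "Y = orb y" "valid e'" "valid y" "F e' y" using *(2) by (rule FO_E)
  obtain m where m: "n dvd m" "e' = shift m e" using ex(1) ey(1) in_orb unfolding orb_def by blast
  obtain s where s: "S = orb s" "valid s" using *(4) by (auto simp: orbits_def)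
  obtain m1 m2 m3 where mm: "n dvd m1" "bl (shift m1 s) x" "n dvd m2" "bl (shift m2 s) y" "n dvd m3" "crs (shift m3 s) d"
    using *(5,6,7) unfolding ex(2) ey(2) s blo_orb cro_cross_orb cross_orb_def by blast
  have "\<exists>k. n dvd k \<and> y = shift k x"
    by (rule F_unique_lift[OF ex(5) _ m(1) ex(3) _ ex(4) ey(4) mm(2), of "m2 - m1" "m3 - m1"])
      (use ey m mm s in auto)
  then show "X = Y" using ex ey orb_shift by metis
qed

lemma collapsing_exists: "\<exists>f. collapsing cro orbits (orb d) f"
  using projection.collapsing_proj[OF projection_orbits] by blast

end

section \<open>Retraction onto a pair of diagonals\<close>

locale arc_projection = cover +
  fixes u v :: int
  assumes uv: "valid (Arc u v)"
begin

text \<open>The result of pulling both ends of a piece between neighbouring copies of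
  \<open>Arc u v\<close> to \<open>v\<close>: a long diagonal, or in type D a loop around the disk,
  which is represented by the tangent chords of both signs at \<open>v\<close>.\<close>

fun apex :: "arc \<Rightarrow> bool" where
  "apex (Arc i j) \<longleftrightarrow> K \<and> i = v \<and> j = v + n"
| "apex (Cen p a) \<longleftrightarrow> \<not> K \<and> p = v"

text \<open>The chord is cut where it meets \<open>Arc u v\<close>. The piece over the interval from
  \<open>u\<close> to \<open>v\<close> is pulled to \<open>u\<close>, the other piece to
  \<open>v\<close>; if the latter also meets the neighbouring copy of \<open>Arc u v\<close>, it
  becomes the apex. \<open>Arc u v\<close> itself is listed so that it has a source in a
  triangulation that lacks it.\<close>

fun F :: "arc \<Rightarrow> arc \<Rightarrow> bool" where
  "F (Arc i j) x \<longleftrightarrow>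
     u < i \<and> i < v \<and> v < j \<and>
       (x = Arc u v \<or> x = Arc u i \<or> j \<le> u + n \<and> x = Arc v j \<or> u + n < j \<and> apex x) \<or>
     i < u \<and> u < j \<and> j < v \<and>
       (x = Arc u v \<or> x = Arc u j \<or> v - n < i \<and> x = Arc i v \<or> i \<le> v - n \<and> apex x)"
| "F (Cen p a) x \<longleftrightarrow> u < p \<and> p < v \<and> (x = Arc u v \<or> x = Arc u p \<or> x = Cen v a)"

text \<open>The shapes that \<open>F\<close> produces: arcs from \<open>u\<close> over the interval,
  arcs at \<open>v\<close> outside it, and central chords at any translate of
  \<open>v\<close>.\<close>

fun incident :: "arc \<Rightarrow> bool" where
  "incident (Arc i j) \<longleftrightarrow> i = u \<and> j \<le> v \<or> i = v \<and> j \<le> u + n \<or> j = v \<and> v - n < i \<and> i < u \<or> j = i + n \<and> n dvd i - v"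
| "incident (Cen p a) \<longleftrightarrow> n dvd p - v"

text \<open>A crossing is forgiven when, in some common translate, \<open>x\<close> is incident and
  \<open>t\<close> crosses \<open>Arc u v\<close>: there \<open>t\<close> is pulled to the very end
  at which \<open>x\<close> is attached.\<close>

definition bl :: "arc \<Rightarrow> arc \<Rightarrow> bool" where
  "bl t x \<longleftrightarrow> crs t x \<and> (\<forall>m. n dvd m \<longrightarrow> incident (shift m x) \<longrightarrow> \<not> crs (shift m t) (Arc u v))"

lemma apex_cong [cong]: "x = y \<Longrightarrow> apex x = apex y"
  and F_cong [cong]: "t = t' \<Longrightarrow> x = x' \<Longrightarrow> F t x = F t' x'"
  by simp_all

lemma uv_len: "2 \<le> v - u" "v - u \<le> n" "\<not> K \<Longrightarrow> v - u < n"
  using uv by auto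

lemma small_dvd: "n dvd m \<Longrightarrow> - n < m \<Longrightarrow> m < n \<Longrightarrow> m = 0"
  using n by (auto elim: dvd_cases)

lemma blD:
  assumes "bl t x"
  shows "crs t x" "incident x \<Longrightarrow> \<not> crs t (Arc u v)"
    "incident (shift n x) \<Longrightarrow> \<not> crs (shift n t) (Arc u v)"
    "incident (shift (- n) x) \<Longrightarrow> \<not> crs (shift (- n) t) (Arc u v)"
    "n dvd m \<Longrightarrow> incident (shift m x) \<Longrightarrow> \<not> crs (shift m t) (Arc u v)"
  using assms unfolding bl_def by (auto dest: spec[of _ 0])

lemma F_crs: "F t x \<Longrightarrow> crs t (Arc u v)"
  by (cases t) auto

lemma F_ncrs:
  assumes "F t x" "valid t" "valid x" "n dvd m"
  shows "\<not> crs (shift m x) (Arc u v)"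
  using assms(4)
proof (cases rule: dvd_cases)
  case zero then show ?thesis using assms(1-3) uv_len n by (cases t; cases x) auto
next
  case pos then show ?thesis using assms(1-3) uv_len n by (cases t; cases x) auto
next
  case neg then show ?thesis using assms(1-3) uv_len n by (cases t; cases x) auto
next
  case big_pos then show ?thesis using assms(1-3) uv_len n by (cases t; cases x) auto
next
  case big_neg then show ?thesis using assms(1-3) uv_len n by (cases t; cases x) auto
qed

lemma bl_shift:
  assumes "n dvd m" "bl t x"
  shows "bl (shift m t) (shift m x)"
  using assms unfolding bl_def by (simp add: dvd_add)

lemma incident_unique:
  assumes "incident (Arc i j)" "i < j" "j - i < n" "n dvd m" "incident (shift m (Arc i j))"
  shows "m = 0"
proof (rule small_dvd[OF assms(4)])
  show "- n < m" "m < n" using assms uv_len n by auto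
qed

lemma bl_F_arc_arc:
  assumes F: "F (Arc i j) x" and v: "valid (Arc i j)" "valid x" "valid (Arc a b)" and bl: "bl (Arc a b) x"
  shows "\<exists>m. n dvd m \<and> crs (shift m (Arc a b)) (Arc i j)"
proof (cases x)
  case (Arc k l)
  have c: "k < a \<and> a < l \<and> l < b \<or> a < k \<and> k < b \<and> b < l" using blD(1)[OF bl] Arc by auto
  have 0: "\<not> (u < a \<and> a < v \<and> v < b \<or> a < u \<and> u < b \<and> b < v)"
    if "k = u \<and> l \<le> v \<or> k = v \<and> l \<le> u + n \<or> l = v \<and> v - n < k \<and> k < u \<or> k = v \<and> l = v + n"
    using blD(2)[OF bl] that Arc by auto
  have 1: "\<not> (u < a - n \<and> a - n < v \<and> v < b - n \<or> a - n < u \<and> u < b - n \<and> b - n < v)" if "k = v \<and> l = v + n"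
    using blD(4)[OF bl] that Arc by auto
  have F': "u < i \<and> i < v \<and> v < j \<and>
       (k = u \<and> l = v \<or> k = u \<and> l = i \<or> j \<le> u + n \<and> k = v \<and> l = j \<or> u + n < j \<and> k = v \<and> l = v + n) \<or>
     i < u \<and> u < j \<and> j < v \<and>
       (k = u \<and> l = v \<or> k = u \<and> l = j \<or> v - n < i \<and> k = i \<and> l = v \<or> i \<le> v - n \<and> k = v \<and> l = v + n)"
    using F Arc by auto
  have len: "j - i \<le> n" "b - a \<le> n" using v by auto
  \<comment> \<open>When the arc from \<open>i\<close> to \<open>j\<close> crosses
    \<open>Arc u v\<close> from the left and \<open>x\<close> is the long arc at \<open>v\<close>,
    it runs one period below \<open>x\<close>; hence the translate by \<open>- n\<close>.\<close>
  have "crs (shift 0 (Arc a b)) (Arc i j) \<or> crs (shift (- n) (Arc a b)) (Arc i j)"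
    unfolding shift.simps crs.simps using c 0 1 F' len uv_len(1,2) by (smt (verit))
  then show ?thesis by (metis dvd_0_right dvd_minus_iff dvd_refl)
next
  case (Cen p g)
  then have "crs (shift 0 (Arc a b)) (Arc i j)" using F v blD(1,2)[OF bl] uv_len by auto
  then show ?thesis by (metis dvd_0_right)
qed

lemma bl_F_arc_central:
  assumes F: "F (Arc i j) x" and v: "valid (Arc i j)" "valid x" "valid (Cen q b)" and bl: "bl (Cen q b) x"
  shows "\<exists>m. n dvd m \<and> crs (shift m (Cen q b)) (Arc i j)"
proof (cases x)
  case (Arc k l)
  then have "crs (Cen q b) (Arc i j)" using F v blD(1,2)[OF bl] uv_len by auto
  then show ?thesis by (intro exI[of _ 0]) simp
next
  case (Cen p g)
  have p: "p = v" "\<not> n dvd q - v" using F blD(1)[OF bl] Cen by auto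
  obtain m where m: "n dvd m" "v \<le> q + m" "q + m < v + n"
  proof -
    have "q + - (n * ((q - v) div n)) = v + (q - v) mod n"
      by (simp add: minus_mult_div_eq_mod [symmetric])
    then show thesis using n that[of "- (n * ((q - v) div n))"] by simp
  qed
  have "q + m \<noteq> v" using p(2) m(1) by auto
  moreover have "\<not> (u < q + m - n \<and> q + m - n < v)" using blD(5)[OF bl, of "m - n"] m(1) Cen p by (simp add: algebra_simps)
  ultimately have "v < q + m" "q + m \<le> u + n" using m by auto
  moreover have "F (Arc i j) (Cen v g)" using F Cen p by simp
  ultimately consider "crs (Cen (q + m) b) (Arc i j)" | "crs (Cen (q + m - n) b) (Arc i j)" by auto
  then show ?thesis
  proof cases
    case 1 then show ?thesis using m(1) by (intro exI[of _ m]) simp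
  next
    case 2 then show ?thesis using m(1) by (intro exI[of _ "m - n"]) (simp add: algebra_simps)
  qed
qed

lemma bl_F_central:
  assumes F: "F (Cen p a) x" and v: "valid (Cen p a)" "valid x" "valid s" and bl: "bl s x"
  shows "crs s (Cen p a)"
proof (cases s)
  case (Arc i j)
  then show ?thesis using F v blD(1,2)[OF bl] uv_len by (cases x) auto
next
  case (Cen q b)
  have "\<not> n dvd q - p \<and> a \<noteq> b"
  proof (cases x)
    case Arc then show ?thesis using F v blD(1,2)[OF bl] uv_len Cen by auto
  next
    case x: (Cen r c)
    have p: "r = v" "c = a" "u < p" "p < v" using F x by auto
    have "\<not> n dvd q - p"
    proof
      assume "n dvd q - p"
      then have "n dvd p - q" by (simp add: dvd_diff_commute)
      then show False using blD(5)[OF bl, of "p - q"] x Cen p by simp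
    qed
    then show ?thesis using blD(1)[OF bl] x Cen p by simp
  qed
  then show ?thesis using Cen by auto
qed

lemma bl_F_lift:
  assumes F: "F t x" and v: "valid t" "valid x" "valid s" and bl: "bl s x"
  shows "\<exists>m. n dvd m \<and> crs (shift m s) t"
proof (cases t)
  case t: (Arc i j)
  show ?thesis
  proof (cases s)
    case (Arc a b)
    then show ?thesis using bl_F_arc_arc[of i j x a b] assms t by simp
  next
    case (Cen q b)
    then show ?thesis using bl_F_arc_central[of i j x q b] assms t by simp
  qed
next
  case (Cen p a)
  then have "crs (shift 0 s) t" using bl_F_central[of p a x s] assms by simp
  then show ?thesis by (intro exI[of _ 0]) simp
qed

lemma F_cases:
  assumes "F t x"
  obtains (self) "x = Arc u v"
  | (outer) i where "x = Arc u i" "u < i" "i < v"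
  | (right) i j where "x = Arc v j" "t = Arc i j" "u < i" "i < v" "v < j" "j \<le> u + n"
  | (left) i j where "x = Arc i v" "t = Arc i j" "v - n < i" "i < u" "u < j" "j < v"
  | (apex) "apex x"
  | (central) p a where "x = Cen v a" "t = Cen p a" "u < p" "p < v"
  using assms by (cases t) auto

text \<open>A chord that blocks a candidate at \<open>u\<close> stays over the interval from
  \<open>u\<close> to \<open>v\<close>, so none of its translates crosses \<open>Arc u v\<close>.
  Apex and central candidates are incident in all translates, so a chord with a translate crossing
  \<open>Arc u v\<close> is always forgiven. Only the outer pieces attached to a single copy of
  \<open>v\<close> remain.\<close>

lemma blocked_F:
  assumes F: "F t x" and v: "valid s" "valid t" "valid x" and bl: "bl s x" and d: "crs (shift k s) (Arc u v)" "n dvd k"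
  obtains (right) i j where "x = Arc v j" "t = Arc i j" "u < i" "i < v" "v < j" "j \<le> u + n"
  | (left) i j where "x = Arc i v" "t = Arc i j" "v - n < i" "i < u" "u < j" "j < v"
  using F
proof (cases rule: F_cases)
  case self then show ?thesis using blD(1,2)[OF bl] by simp
next
  case outer
  show ?thesis
  proof (cases s)
    case (Arc a b)
    then have "u < a" "b \<le> v" using blD(1,2)[OF bl] outer by auto
    with d(2,1) show ?thesis using Arc v(1) uv_len by (cases rule: dvd_cases) auto
  next
    case Cen then show ?thesis using blD(1,2)[OF bl] outer by auto
  qed
next
  case apex
  then have "incident (shift k x)" using d(2) by (cases x) auto
  then show ?thesis using blD(5)[OF bl d(2)] d(1) by blast
next
  case central
  then have "incident (shift k x)" using d(2) by auto
  then show ?thesis using blD(5)[OF bl d(2)] d(1) by blast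
qed (use that in blast)+

text \<open>By \<open>blocked_F\<close> both candidates are outer pieces attached to one copy of
  \<open>v\<close>. A chord has at most one such piece: by length, the right and the left form
  exclude each other even across translates.\<close>

lemma F_unique_lift:
  assumes "F e x" "F (shift m e) y" "n dvd m" "valid e" "valid s" "valid x" "valid y"
    "bl s x" "bl (shift m' s) y" "n dvd m'" "crs (shift m'' s) (Arc u v)" "n dvd m''"
  shows "\<exists>k. n dvd k \<and> y = shift k x"
proof -
  have d: "crs (shift (m'' - m') (shift m' s)) (Arc u v)" "n dvd m'' - m'" using assms(10-12) by auto
  have "y = x"
    using assms(1,5,4,6,8,11,12)
  proof (cases rule: blocked_F)
    case x: (right i j)
    have "valid (shift m' s)" "valid (shift m e)" using assms(4,5) by auto
    from assms(2) this assms(7,9) d show ?thesis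
    proof (cases rule: blocked_F)
      case (right i' j') then show ?thesis using small_dvd[OF assms(3)] x uv_len by auto
    next
      case (left i' j') from assms(3) show ?thesis using left x uv_len by (cases rule: dvd_cases) auto
    qed
  next
    case x: (left i j)
    have "valid (shift m' s)" "valid (shift m e)" using assms(4,5) by auto
    from assms(2) this assms(7,9) d show ?thesis
    proof (cases rule: blocked_F)
      case (left i' j') then show ?thesis using small_dvd[OF assms(3)] x uv_len by auto
    next
      case (right i' j') from assms(3) show ?thesis using right x uv_len by (cases rule: dvd_cases) auto
    qed
  qed
  then show ?thesis by (intro exI[of _ 0]) simp
qed

text \<open>The second arc is incident only after translation by \<open>- n\<close>, and there the
  first arc no longer reaches \<open>Arc u v\<close>, so the crossing is not forgiven.\<close>

lemma right_left_bl:
  assumes "u < i" "i < v" "v < j" "j \<le> u + n" "v - n < b" "b < u" "b + n < j"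
  shows "bl (Arc i j) (Arc (b + n) (v + n))"
  unfolding bl_def
proof (intro conjI allI impI)
  show "crs (Arc i j) (Arc (b + n) (v + n))" using assms by auto
  fix m assume m: "n dvd m" "incident (shift m (Arc (b + n) (v + n)))"
  have 1: "incident (Arc b v)" "b < v" "v - b < n" using assms by simp_all
  have 2: "incident (shift (n + m) (Arc b v))" using m(2) by (simp add: algebra_simps)
  have "n dvd n + m" using m(1) by simp
  from incident_unique[OF 1 this 2] have "n + m = 0" .
  then have "m = - n" by simp
  then show "\<not> crs (shift m (Arc i j)) (Arc u v)" using assms by auto
qed

lemma outer_ncrs:
  assumes i: "u < i" "i < v" and y: "F t y" "valid t" "valid y" and m: "n dvd m"
  shows "\<not> crs (Arc u i) (shift m y)"
proof
  assume c: "crs (Arc u i) (shift m y)"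
  note nd = F_ncrs[OF y m]
  show False
  proof (cases y)
    case (Cen p a) then show False using nd c i by auto
  next
    case (Arc a b)
    then have ab: "u < a + m" "b + m \<le> v" using nd c i by auto
    from m have "m = 0 \<or> m \<ge> n \<or> m \<le> - n" using n by (cases rule: dvd_cases) auto
    with y(1) Arc ab uv_len show False by (cases rule: F_cases) auto
  qed
qed

lemma right_right_ncrs:
  assumes "j \<le> v + n" "j' \<le> v + n" "n dvd m"
  shows "\<not> crs (Arc v j) (Arc (v + m) (j' + m))"
  using assms(3,1,2) n by (cases rule: dvd_cases) auto

lemma left_left_ncrs:
  assumes "v - n \<le> i" "v - n \<le> i'" "n dvd m"
  shows "\<not> crs (Arc i v) (Arc (i' + m) (v + m))"
  using assms(3,1,2) n by (cases rule: dvd_cases) auto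

lemma right_left_crs:
  assumes "v < j" "j \<le> v + n" "v - n < i" "i < v" "n dvd m" "crs (Arc v j) (Arc (i + m) (v + m))"
  shows "m = n \<and> i + n < j"
  using assms(5,1-4,6) n by (cases rule: dvd_cases) auto

lemma left_right_crs:
  assumes "v < j" "j \<le> v + n" "v - n < i" "i < v" "n dvd m" "crs (Arc i v) (Arc (v + m) (j + m))"
  shows "m = - n \<and> i + n < j"
  using assms(5,1-4,6) n by (cases rule: dvd_cases) auto

lemma central_ncrs:
  assumes "v - n \<le> i" "v - n \<le> i'" "j \<le> v + n" "n dvd m"
  shows "\<not> crs (Cen v a) (Arc (i + m) (v + m))" "\<not> crs (Cen v a) (Arc (v + m) (j + m))"
    "\<not> crs (Arc i v) (Cen (v + m) a)" "\<not> crs (Arc v j) (Cen (v + m) a)" "\<not> crs (Cen v a) (Cen (v + m) b)"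
proof -
  show "\<not> crs (Cen v a) (Cen (v + m) b)" using assms(4) by simp
qed (use assms(4,1-3) n in \<open>cases rule: dvd_cases; auto\<close>)+

text \<open>Candidates never cross copies of \<open>Arc u v\<close>, and those attached to the same
  copy of \<open>v\<close> do not cross each other. The one remaining conflict is between a piece
  leaving \<open>v\<close> to the right and a piece reaching the next copy of \<open>v\<close> from
  the left, when they overlap.\<close>

lemma image_crs:
  assumes "F t x" "F t' y" "valid t" "valid t'" "valid x" "valid y" "n dvd m" "crs x (shift m y)"
  obtains i j b where "x = Arc v j" "t = Arc i j" "u < i" "i < v" "v < j" "j \<le> u + n"
      "y = Arc b v" "v - n < b" "b < u" "b + n < j" "m = n"
  | i j b where "y = Arc v j" "t' = Arc i j" "u < i" "i < v" "v < j" "j \<le> u + n"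
      "x = Arc b v" "v - n < b" "b < u" "b + n < j" "m = - n"
proof -
  have mneg: "n dvd - m" using assms(7) by simp
  have "crs (shift (- m) x) (shift (- m) (shift m y))" using assms(8) by (simp only: crs_shift)
  then have c': "crs y (shift (- m) x)" using crs_sym by simp
  have apx: "(K \<and> z = Arc v (v + n)) \<or> (\<exists>a. z = Cen v a)" if "apex z" for z using that by (cases z) auto
  from assms(1) show thesis
  proof (cases rule: F_cases)
    case self
    then show thesis using F_ncrs[OF assms(2,4,6,7)] assms(8) crs_sym by blast
  next
    case outer
    then show thesis using outer_ncrs[OF _ _ assms(2,4,6,7)] assms(8) by blast
  next
    case (right i j)
    note r = right
    from assms(2) show thesis
    proof (cases rule: F_cases)
      case self
      then show thesis using F_ncrs[OF assms(1,3,5) mneg] c' crs_sym by blast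
    next
      case outer
      then show thesis using outer_ncrs[OF _ _ assms(1,3,5) mneg] c' by blast
    next
      case right
      then show thesis using right_right_ncrs[OF _ _ assms(7)] assms(8) r uv_len by auto
    next
      case (left b j')
      then have "m = n \<and> b + n < j"
        using right_left_crs[OF _ _ _ _ assms(7), of j b] assms(8) r uv_len by auto
      then show thesis using that(1) r left by blast
    next
      case apex
      then show thesis using apx[OF apex] right_right_ncrs[OF _ _ assms(7), of j "v + n"] assms(8) r uv_len
          central_ncrs(4)[OF _ _ _ assms(7), of v v j] n by auto
    next
      case central
      then show thesis using assms(8) r uv_len central_ncrs(4)[OF _ _ _ assms(7), of v v j] n by auto
    qed
  next
    case (left b j)
    note l = left
    from assms(2) show thesis
    proof (cases rule: F_cases)
      case self
      then show thesis using F_ncrs[OF assms(1,3,5) mneg] c' crs_sym by blast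
    next
      case outer
      then show thesis using outer_ncrs[OF _ _ assms(1,3,5) mneg] c' by blast
    next
      case left
      then show thesis using left_left_ncrs[OF _ _ assms(7)] assms(8) l uv_len by auto
    next
      case (right i' j')
      then have "m = - n \<and> b + n < j'"
        using left_right_crs[OF _ _ _ _ assms(7), of j' b] assms(8) l uv_len by auto
      then show thesis using that(2) l right by blast
    next
      case apex
      have "\<not> crs (Arc b v) (Arc (v + m) (v + n + m))"
        using left_left_ncrs[of b "v - n" "m + n"] l uv_len assms(7) by (simp add: algebra_simps)
      then show thesis using apx[OF apex] assms(8) l uv_len
          central_ncrs(3)[OF _ _ _ assms(7), of b v v] n by auto
    next
      case central
      then show thesis using assms(8) l uv_len central_ncrs(3)[OF _ _ _ assms(7), of b v v] n by auto
    qed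
  next
    case apex
    note ap = apx[OF apex]
    from assms(2) show thesis
    proof (cases rule: F_cases)
      case self
      then show thesis using F_ncrs[OF assms(1,3,5) mneg] c' crs_sym by blast
    next
      case outer
      then show thesis using outer_ncrs[OF _ _ assms(1,3,5) mneg] c' by blast
    next
      case right
      then show thesis using ap right_right_ncrs[OF _ _ assms(7), of "v + n"] assms(8) uv_len n
          central_ncrs(2)[OF _ _ _ assms(7), of v v] by auto
    next
      case (left b j)
      have "\<not> crs (Arc v (v + n)) (Arc (b + m) (v + m))"
      proof
        assume "crs (Arc v (v + n)) (Arc (b + m) (v + m))"
        then have "m = n \<and> b + n < v + n" using right_left_crs[of "v + n" b m] left assms(7) uv_len n by auto
        then show False using \<open>crs (Arc v (v + n)) (Arc (b + m) (v + m))\<close> by auto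
      qed
      then show thesis using ap assms(8) left uv_len n central_ncrs(1)[OF _ _ _ assms(7), of b v v] by auto
    next
      case a2: apex
      show thesis using ap apx[OF a2] assms(7,8) n right_right_ncrs[OF _ _ assms(7), of "v + n" "v + n"]
          central_ncrs(5)[OF _ _ _ assms(7), of v v v] central_ncrs(2)[OF _ _ _ assms(7), of v v "v + n"]
          central_ncrs(4)[OF _ _ _ assms(7), of v v "v + n"] by auto
    next
      case central
      then show thesis using ap assms(7,8) n
          central_ncrs(5)[OF _ _ _ assms(7), of v v v] central_ncrs(4)[OF _ _ _ assms(7), of v v "v + n"] by auto
    qed
  next
    case (central p a)
    note c = central
    from assms(2) show thesis
    proof (cases rule: F_cases)
      case self
      then show thesis using F_ncrs[OF assms(1,3,5) mneg] c' crs_sym by blast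
    next
      case outer
      then show thesis using outer_ncrs[OF _ _ assms(1,3,5) mneg] c' by blast
    next
      case right
      then show thesis using c assms(8) uv_len n central_ncrs(2)[OF _ _ _ assms(7), of v v] by auto
    next
      case (left b j)
      then show thesis using c assms(8) uv_len n central_ncrs(1)[OF _ _ _ assms(7), of b v v] by auto
    next
      case apex
      then show thesis using c apx[OF apex] assms(7,8) n
          central_ncrs(5)[OF _ _ _ assms(7), of v v v] central_ncrs(2)[OF _ _ _ assms(7), of v v "v + n"] by auto
    next
      case central
      then show thesis using c assms(7,8) central_ncrs(5)[OF _ _ _ assms(7), of v v v] n by auto
    qed
  qed
qed

lemma F_F_lift:
  assumes "F t x" "F t' y" "valid t" "valid t'" "valid x" "valid y" "n dvd m" "crs x (shift m y)"
  shows "bl t (shift m y) \<or> bl t' (shift (- m) x)"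
  using assms
proof (cases rule: image_crs)
  case (1 i j b)
  then show ?thesis using right_left_bl[of i j b] by auto
next
  case (2 i j b)
  then show ?thesis using right_left_bl[of i j b] by auto
qed

end

context arc_projection
begin

lemma incident_left:
  assumes "a \<le> u" "v - a \<le> n"
  shows "incident (Arc a v)"
proof (cases "a = v - n")
  case True then have "n dvd a - v" "v = a + n" by auto
  then show ?thesis unfolding incident.simps by blast
next
  case False then show ?thesis using assms by auto
qed

text \<open>As \<open>z\<close> misses all copies of \<open>Arc u v\<close>, it lies in one of the
  regions into which they cut the picture. It is not incident in a lift where \<open>t\<close>
  crosses \<open>Arc u v\<close>, so it is not attached to the end to which the piece of
  \<open>t\<close> in its region is pulled, and that piece crosses it.\<close>

lemma bl_F_crs_right:
  assumes t: "u < i" "i < v" "v < j" "valid (Arc i j)" and z: "valid z" and bl: "bl (Arc i j) z"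
    and nd: "\<forall>m. n dvd m \<longrightarrow> \<not> crs (shift m z) (Arc u v)"
  shows "\<exists>x m m'. n dvd m \<and> n dvd m' \<and> valid x \<and> F (shift m (Arc i j)) x \<and> crs (shift m' x) z"
proof -
  have wit: ?thesis if "F (shift m (Arc i j)) x" "valid x" "crs (shift m' x) z" "n dvd m" "n dvd m'" for x m m'
    using that by blast
  have nd0: "\<not> crs z (Arc u v)" and nd1: "\<not> crs (shift (- n) z) (Arc u v)"
    using nd[rule_format, of 0] nd[rule_format, of "- n"] by simp_all
  have ni: "\<not> incident z" using blD(2)[OF bl] t by auto
  have ni1: "\<not> incident (shift (- n) z)" if "u + n < j" using blD(4)[OF bl] t that uv_len by auto
  have len: "j - i \<le> n" "\<not> K \<Longrightarrow> j - i < n" "j < v + n" using t by auto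
  \<comment> \<open>The apex. Tangent chords of both signs at \<open>v\<close> cross the same arcs,
    so \<open>False\<close> is an arbitrary choice; when \<open>z\<close> is a tangent chord, the
    opposite sign is taken instead.\<close>
  define top where "top = (if K then Arc v (v + n) else Cen v False)"
  have top: "valid top" "u + n < j \<Longrightarrow> F (shift 0 (Arc i j)) top"
    using n t by (auto simp: top_def)
  show ?thesis
  proof (cases z)
    case (Arc a b)
    consider "a < i" "i < b" "b < j" | "i < a" "a < j" "j < b" using blD(1)[OF bl] Arc by auto
    then show ?thesis
    proof cases
      case 1
      show ?thesis
      proof (cases "u \<le> a \<and> b \<le> v")
        case True
        then have "u < a" using ni Arc by auto
        then show ?thesis using wit[of 0 "Arc u i" 0] 1 t Arc uv_len by auto
      next
        case False
        then have ab: "a \<le> u" "v \<le> b" using nd0 1 t Arc by auto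
        have "b \<noteq> v" using ni incident_left[of a] ab Arc z 1 t len by auto
        then have "v < b" using ab by simp
        show ?thesis
        proof (cases "j \<le> u + n")
          case True
          then show ?thesis using wit[of 0 "Arc v j" 0] 1 t Arc ab \<open>v < b\<close> uv_len n by auto
        next
          case False
          have "crs (shift 0 top) z" using ab \<open>v < b\<close> 1 len t(1,2) Arc by (auto simp: top_def)
          then show ?thesis using wit[of 0 top 0] top False by simp
        qed
      qed
    next
      case 2
      have "v \<le> a" using nd0 2 t Arc by auto
      show ?thesis
      proof (cases "j \<le> u + n")
        case True
        then have "a \<noteq> v" using nd1 ni Arc z 2 t len uv_len by auto
        then show ?thesis using wit[of 0 "Arc v j" 0] 2 t Arc \<open>v \<le> a\<close> True uv_len n by auto
      next
        case False
        note ni1 = ni1[simplified Arc]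
        show ?thesis
        proof (cases "u + n \<le> a \<and> b \<le> v + n")
          case True
          then have "u + n < a" using ni1 False by auto
          \<comment> \<open>This is the piece at the far end of the arc, over the next copy of the
            interval, seen in the lift by \<open>- n\<close>.\<close>
          moreover have "F (shift (- n) (Arc i j)) (Arc u (j - n))" using t False len uv_len by auto
          ultimately show ?thesis using wit[of "- n" "Arc u (j - n)" n] 2 t Arc True uv_len n len by auto
        next
          case F: False
          then have ab: "a \<le> u + n" "v + n \<le> b" using nd1 2 t Arc False len by auto
          have "b \<noteq> v + n" using ni1 incident_left[of "a - n"] False ab Arc z 2 t len \<open>v \<le> a\<close> uv_len by auto
          then have "v + n < b" using ab by simp
          then have "crs (shift 0 top) z \<or> crs (shift n top) z" using ab \<open>v \<le> a\<close> 2 len Arc ni uv_len n z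
            by (auto simp: top_def)
          then show ?thesis using wit[of 0 top 0] wit[of 0 top n] top False by fastforce
        qed
      qed
    qed
  next
    case (Cen p a)
    have p: "i < p" "p < j" using blD(1)[OF bl] Cen by auto
    have "p \<noteq> v" using ni Cen by auto
    then have "v < p" using nd0 p t Cen by auto
    show ?thesis
    proof (cases "j \<le> u + n")
      case True
      then show ?thesis using wit[of 0 "Arc v j" 0] p t Cen \<open>v < p\<close> uv_len n len z by auto
    next
      case False
      have "\<not> n dvd v - p" using small_dvd[of "v - p"] p \<open>v < p\<close> len by auto
      then have "crs (Cen v (\<not> a)) z" using Cen by simp
      then show ?thesis using wit[of 0 "Cen v (\<not> a)" 0] z Cen False t by simp
    qed
  qed
qed

text \<open>An arc starting below \<open>v - n\<close> crosses \<open>Arc u v\<close> from the right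
  after translation by \<open>n\<close>, which reduces to \<open>bl_F_crs_right\<close>. Among the
  others, \<open>i = v - n\<close> is the case with an apex.\<close>

lemma bl_F_crs_left:
  assumes t: "i < u" "u < j" "j < v" "valid (Arc i j)" and z: "valid z" and bl: "bl (Arc i j) z"
    and nd: "\<forall>m. n dvd m \<longrightarrow> \<not> crs (shift m z) (Arc u v)"
  shows "\<exists>x m m'. n dvd m \<and> n dvd m' \<and> valid x \<and> F (shift m (Arc i j)) x \<and> crs (shift m' x) z"
proof (cases "i < v - n")
  case True
  have "\<exists>x m m'. n dvd m \<and> n dvd m' \<and> valid x \<and> F (shift m (Arc (i + n) (j + n))) x \<and> crs (shift m' x) (shift n z)"
  proof (rule bl_F_crs_right)
    show "u < i + n" "i + n < v" "v < j + n" "valid (Arc (i + n) (j + n))"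
      using True t uv_len by auto
    show "valid (shift n z)" using z by simp
    show "bl (Arc (i + n) (j + n)) (shift n z)" using bl_shift[OF _ bl, of n] by simp
    show "\<forall>m. n dvd m \<longrightarrow> \<not> crs (shift m (shift n z)) (Arc u v)" using nd by simp
  qed
  then obtain x m m' where x: "n dvd m" "n dvd m'" "valid x" "F (shift m (Arc (i + n) (j + n))) x" "crs (shift m' x) (shift n z)"
    by blast
  have "F (shift (m + n) (Arc i j)) x" using x(4) by (simp add: algebra_simps)
  moreover have "crs (shift (- n) (shift m' x)) (shift (- n) (shift n z))" using x(5) by (simp only: crs_shift)
  then have "crs (shift (m' - n) x) z" by simp
  ultimately show ?thesis using x by (intro exI[of _ x] exI[of _ "m + n"] exI[of _ "m' - n"]) simp
next
  case big: False
  have wit: ?thesis if "F (shift m (Arc i j)) x" "valid x" "crs (shift m' x) z" "n dvd m" "n dvd m'" for x m m'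
    using that by blast
  have nd0: "\<not> crs z (Arc u v)" using nd[rule_format, of 0] by simp
  have ni: "\<not> incident z" using blD(2)[OF bl] t by auto
  have len: "j - i \<le> n" "\<not> K \<Longrightarrow> j - i < n" using t by auto
  define top where "top = (if K then Arc v (v + n) else Cen v False)"
  have top: "valid top" "i = v - n \<Longrightarrow> F (shift 0 (Arc i j)) top"
    using n t by (auto simp: top_def)
  show ?thesis
  proof (cases z)
    case (Arc a b)
    consider "i < a" "a < j" "j < b" | "a < i" "i < b" "b < j" using blD(1)[OF bl] Arc by auto
    then show ?thesis
    proof cases
      case 1
      show ?thesis
      proof (cases "u \<le> a \<and> b \<le> v")
        case True
        then have "u < a" using ni Arc by auto
        then show ?thesis using wit[of 0 "Arc u j" 0] 1 t Arc uv_len by auto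
      next
        case False
        then have ab: "a \<le> u" "v \<le> b" using nd0 1 t Arc by auto
        have "b \<noteq> v" using ni incident_left[of a] ab Arc z 1 t len big by auto
        then have "v < b" using ab by simp
        show ?thesis
        proof (cases "v - n < i")
          case True
          then show ?thesis using wit[of 0 "Arc i v" 0] 1 t Arc ab \<open>v < b\<close> uv_len n by auto
        next
          case False
          then have "crs (shift (if K then - n else 0) top) z"
            using ab \<open>v < b\<close> 1 len Arc big by (auto simp: top_def)
          then show ?thesis using wit[of 0 top "if K then - n else 0"] top False big by simp
        qed
      qed
    next
      case 2
      have "b \<le> u" using nd0 2 t Arc by auto
      show ?thesis
      proof (cases "v - n < i")
        case True
        then show ?thesis using wit[of 0 "Arc i v" 0] 2 t Arc \<open>b \<le> u\<close> uv_len n by auto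
      next
        case False
        then have "crs (shift (- n) top) z"
          using \<open>b \<le> u\<close> 2 len Arc big t by (auto simp: top_def)
        then show ?thesis using wit[of 0 top "- n"] top False big by simp
      qed
    qed
  next
    case (Cen p a)
    have p: "i < p" "p < j" using blD(1)[OF bl] Cen by auto
    have "p \<le> u" using nd0 p t Cen by auto
    show ?thesis
    proof (cases "v - n < i")
      case True
      then show ?thesis using wit[of 0 "Arc i v" 0] p t Cen \<open>p \<le> u\<close> uv_len n len z by auto
    next
      case False
      have "\<not> n dvd v - p" using small_dvd[of "v - p"] p \<open>p \<le> u\<close> t big by auto
      then have "crs (Cen v (\<not> a)) z" using Cen by simp
      then show ?thesis using wit[of 0 "Cen v (\<not> a)" 0] z Cen False t by simp
    qed
  qed
qed

lemma bl_F_crs_central: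
  assumes t: "u < p" "p < v" "valid (Cen p a)" and z: "valid z" and bl: "bl (Cen p a) z"
    and nd: "\<forall>m. n dvd m \<longrightarrow> \<not> crs (shift m z) (Arc u v)"
  shows "\<exists>x m m'. n dvd m \<and> n dvd m' \<and> valid x \<and> F (shift m (Cen p a)) x \<and> crs (shift m' x) z"
proof -
  have wit: ?thesis if "F (Cen p a) x" "valid x" "crs x z" for x
    using that by (intro exI[of _ x] exI[of _ 0]) simp
  have nd0: "\<not> crs z (Arc u v)" using nd[rule_format, of 0] by simp
  have ni: "\<not> incident z" using blD(2)[OF bl] t by auto
  show ?thesis
  proof (cases z)
    case (Arc i j)
    have ij: "i < p" "p < j" using blD(1)[OF bl] Arc by auto
    show ?thesis
    proof (cases "u \<le> i \<and> j \<le> v")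
      case True
      then have "u < i" using ni Arc by auto
      then show ?thesis using wit[of "Arc u p"] ij t Arc uv_len by auto
    next
      case False
      then have ab: "i \<le> u" "v \<le> j" using nd0 ij t Arc by auto
      have "j \<noteq> v" using ni ab Arc z t by auto
      then show ?thesis using wit[of "Cen v a"] ab t Arc by auto
    qed
  next
    case (Cen q b)
    have "\<not> n dvd v - q" using ni Cen by (simp add: dvd_diff_commute)
    then show ?thesis using wit[of "Cen v a"] blD(1)[OF bl] t Cen by auto
  qed
qed

lemma bl_F_crs:
  assumes "valid t" "valid z" "crs t (Arc u v)" "bl t z" "\<forall>m. n dvd m \<longrightarrow> \<not> crs (shift m z) (Arc u v)"
  shows "\<exists>x m m'. n dvd m \<and> n dvd m' \<and> valid x \<and> F (shift m t) x \<and> crs (shift m' x) z"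
proof (cases t)
  case (Arc i j)
  then consider "u < i" "i < v" "v < j" | "i < u" "u < j" "j < v" using assms(3) by auto
  then show ?thesis
    using bl_F_crs_right[of i j z] bl_F_crs_left[of i j z] assms Arc by cases auto
next
  case (Cen p a)
  then show ?thesis using bl_F_crs_central[of p a z] assms by auto
qed

end

lemma int_least:
  fixes p :: int
  assumes "P p" and "\<And>q. P q \<Longrightarrow> b \<le> q"
  shows "\<exists>m. P m \<and> (\<forall>q. P q \<longrightarrow> m \<le> q)"
proof -
  obtain q where q: "P q" "\<And>q'. P q' \<Longrightarrow> nat (q - b) \<le> nat (q' - b)"
    using ex_has_least_nat[of P p "\<lambda>q. nat (q - b)"] assms(1) by blast
  have "q \<le> q'" if "P q'" for q' using q(2)[OF that] assms(2)[OF that] by linarith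
  then show ?thesis using q(1) by blast
qed

lemma int_greatest:
  fixes p :: int
  assumes "P p" and "\<And>q. P q \<Longrightarrow> q \<le> b"
  shows "\<exists>m. P m \<and> (\<forall>q. P q \<longrightarrow> q \<le> m)"
proof -
  have "- b \<le> q" if "P (- q)" for q using assms(2)[OF that] by simp
  then obtain m where m: "P (- m)" "\<And>q. P (- q) \<Longrightarrow> m \<le> q"
    using int_least[of "\<lambda>q. P (- q)" "- p" "- b"] assms(1) by auto
  have "q \<le> - m" if "P q" for q using m(2)[of "- q"] that by simp
  then show ?thesis using m(1) by blast
qed

locale lifted_cover = cover n K + lifted n K A C
  for n :: int and K :: bool and A :: "int \<Rightarrow> int \<Rightarrow> bool" and C :: "int \<Rightarrow> bool \<Rightarrow> bool"
begin

definition mem :: "arc \<Rightarrow> bool" where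
  "mem x \<longleftrightarrow> (case x of Arc i j \<Rightarrow> A i j | Cen p a \<Rightarrow> C p a)"

lemma mem_simps [simp]: "mem (Arc i j) \<longleftrightarrow> A i j" "mem (Cen p a) \<longleftrightarrow> C p a"
  by (simp_all add: mem_def)

lemma mem_shift: "n dvd m \<Longrightarrow> mem (shift m x) \<longleftrightarrow> mem x"
proof -
  assume m: "n dvd m"
  have "mem (shift k y)" if "mem y" "n dvd k" for k y
    using that A_shift C_shift by (cases y) auto
  from this[of x m] this[of "shift m x" "- m"] show ?thesis using m by auto
qed

lemma mem_max:
  assumes "valid x" "\<not> mem x"
  shows "\<exists>t. mem t \<and> crs t x"
proof (rule ccontr)
  assume no: "\<not> ?thesis"
  show False
  proof (cases x)
    case (Arc i j)
    have "\<not> (i < k \<and> k < j \<and> j < l) \<and> \<not> (k < i \<and> i < l \<and> l < j)" if "A k l" for k l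
      using no[simplified, rule_format, of "Arc k l"] that Arc by auto
    moreover have "\<not> (i < p \<and> p < j)" if "C p a" for p a
      using no[simplified, rule_format, of "Cen p a"] that Arc by auto
    ultimately have "A i j" using assms(1) Arc by (intro A_max) auto
    then show False using assms(2) Arc by simp
  next
    case (Cen p a)
    have "\<not> (k < p \<and> p < l)" if "A k l" for k l
      using no[simplified, rule_format, of "Arc k l"] that Cen by auto
    moreover have "n dvd p - q \<or> a = b" if "C q b" for q b
      using no[simplified, rule_format, of "Cen q b"] that Cen by (auto simp: dvd_diff_commute)
    moreover have "\<not> K" using assms(1) unfolding Cen valid.simps .
    ultimately have "C p a" by (intro C_max) auto
    then show False using assms(2) Cen by simp
  qed
qed

end

section \<open>Sources of the new chords, for a pair of diagonals\<close>

locale lifted_arc_projection = arc_projection n K u v + L: lifted_cover n K A C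
  for n :: int and K :: bool and u v :: int and A :: "int \<Rightarrow> int \<Rightarrow> bool" and C :: "int \<Rightarrow> bool \<Rightarrow> bool"
begin

text \<open>The target is \<open>Arc v a\<close>. Among the arcs that pass over \<open>v\<close> and
  end before \<open>a\<close>, one starts farthest left, at \<open>p\<close>. The arc from
  \<open>p\<close> to \<open>a\<close> then crosses nothing, so it belongs to the triangulation and
  is a source.\<close>

lemma surj_right:
  assumes a: "v < a" "a \<le> u + n"
    and H1: "\<And>i j. A i j \<Longrightarrow> i < v \<Longrightarrow> v < j \<Longrightarrow> j < a \<Longrightarrow> u < i"
    and H2: "\<And>i j. A i j \<Longrightarrow> v < i \<Longrightarrow> i < a \<Longrightarrow> a < j \<Longrightarrow> False"
    and H3: "\<And>p g. C p g \<Longrightarrow> v < p \<Longrightarrow> p < a \<Longrightarrow> False"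
    and ex: "A i j" "i < v" "v < j" "j < a"
  shows "\<exists>p. A p a \<and> u < p \<and> p < v"
proof -
  let ?P = "\<lambda>p. p < v \<and> (\<exists>q. A p q \<and> v < q \<and> q < a)"
  have "?P i" using ex by blast
  moreover have "u \<le> p" if "?P p" for p using that H1 by force
  ultimately obtain p where "?P p" and min: "\<And>p'. ?P p' \<Longrightarrow> p \<le> p'"
    using int_least[of ?P i u] by blast
  then obtain q where q: "p < v" "A p q" "v < q" "q < a" by blast
  have p: "u < p" using H1 q by blast
  have "A p a"
  proof (rule L.A_max)
    fix k l assume kl: "A k l"
    have 1: "\<not> (k < p \<and> v < l \<and> l < a)" using min[of k] kl q by force
    have 2: "\<not> (p < k \<and> k < q \<and> q < l)" "\<not> (k < p \<and> p < l \<and> l < q)"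
      using L.AA[OF q(2) kl] L.AA[OF kl q(2)] by auto
    have 3: "\<not> (v < k \<and> k < a \<and> a < l)" using H2[OF kl] by auto
    show "\<not> (p < k \<and> k < a \<and> a < l) \<and> \<not> (k < p \<and> p < l \<and> l < a)"
      using 1 2 3 q by auto
  next
    fix r g assume r: "C r g"
    show "\<not> (p < r \<and> r < a)" using H3[OF r] L.AC[OF q(2) r] q by auto
  qed (use q p a in auto)
  then show ?thesis using p q by blast
qed

text \<open>The target is \<open>Arc b v\<close>. Let \<open>p\<close> be the first position after
  \<open>b\<close> at which some chord leaves the interval from \<open>b\<close> to
  \<open>v\<close>. Nothing then crosses the arc from \<open>b\<close> to \<open>p\<close>, and the
  hypotheses place \<open>p\<close> beyond \<open>u\<close>.\<close>

lemma surj_left: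
  assumes b: "v - n < b" "b < u"
    and H1: "\<And>i j. A i j \<Longrightarrow> i < b \<Longrightarrow> b < j \<Longrightarrow> j < v \<Longrightarrow> u < j"
    and H2: "\<And>i j. A i j \<Longrightarrow> b < i \<Longrightarrow> i < v \<Longrightarrow> v < j \<Longrightarrow> u < i"
    and H3: "\<And>p g. C p g \<Longrightarrow> b < p \<Longrightarrow> p < v \<Longrightarrow> u < p"
    and ex: "(\<exists>i j. A i j \<and> (i < b \<and> b < j \<and> j < v \<or> b < i \<and> i < v \<and> v < j)) \<or> (\<exists>p g. C p g \<and> b < p \<and> p < v)"
  shows "\<exists>p. A b p \<and> u < p \<and> p < v"
proof -
  let ?P = "\<lambda>p. b < p \<and> p < v \<and> ((\<exists>i<b. A i p) \<or> (\<exists>j>v. A p j) \<or> (\<exists>g. C p g))"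
  obtain p0 where p0: "?P p0" using ex by blast
  have "b \<le> p" if "?P p" for p using that by simp
  then obtain p where p: "?P p" and min: "\<And>p'. ?P p' \<Longrightarrow> p \<le> p'"
    using int_least[of ?P p0 b, OF p0] by blast
  have up: "u < p" using p H1 H2 H3 by blast
  have nc: "\<not> (k < p \<and> p < l)" if "A k l" "b \<le> k" "l \<le> v" for k l
    using p L.AA[OF _ that(1)] L.AA[OF that(1)] L.AC[OF that(1)] that by fastforce
  have "A b p"
  proof (rule L.A_max)
    fix k l assume kl: "A k l"
    have "\<not> (k < b \<and> b < l \<and> l < p)" using min[of l] kl p by force
    moreover have "\<not> (b < k \<and> k < p \<and> p < l)"
    proof
      assume h: "b < k \<and> k < p \<and> p < l"
      then have "v < l" using nc[OF kl] by linarith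
      then show False using min[of k] kl p h by force
    qed
    ultimately show "\<not> (b < k \<and> k < p \<and> p < l) \<and> \<not> (k < b \<and> b < l \<and> l < p)" by blast
  next
    fix r g assume r: "C r g"
    show "\<not> (b < r \<and> r < p)" using min[of r] r p by force
  qed (use p up b in auto)
  then show ?thesis using p up by blast
qed

text \<open>The target is \<open>Arc u a\<close>, and a source is a chord at \<open>a\<close> that
  leaves the interval from \<open>u\<close> to \<open>v\<close>. It is found by extremality: the
  nearest right end of an arc over \<open>a\<close> that starts after \<open>u\<close>; failing
  that, a tangent chord between \<open>u\<close> and \<open>a\<close>; failing that, the farthest
  left start of an arc over \<open>u\<close>.\<close>

lemma surj_outer:
  assumes a: "u < a" "a < v"
    and H: "\<And>i j. A i j \<Longrightarrow> u < i \<Longrightarrow> i < a \<Longrightarrow> a < j \<Longrightarrow> v < j"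
    and ex: "(\<exists>i j. A i j \<and> (u < i \<and> i < a \<and> a < j \<or> i < u \<and> u < j \<and> j < a)) \<or> (\<exists>p g. C p g \<and> u < p \<and> p < a)"
  shows "(\<exists>q>v. A a q) \<or> (\<exists>q<u. A q a) \<or> (\<exists>g. C a g)"
proof (cases "\<exists>i j. A i j \<and> u < i \<and> i < a \<and> a < j")
  case True
  let ?P = "\<lambda>j. a < j \<and> (\<exists>i. A i j \<and> u < i \<and> i < a)"
  obtain q0 where q0: "?P q0" using True by blast
  have "a \<le> q" if "?P q" for q using that by simp
  then obtain q where "?P q" and min: "\<And>q'. ?P q' \<Longrightarrow> q \<le> q'"
    using int_least[of ?P q0 a, OF q0] by blast
  then obtain p where q: "A p q" "u < p" "p < a" "a < q" by blast
  have vq: "v < q" using H q by blast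
  have "A a q"
  proof (rule L.A_max)
    fix k l assume kl: "A k l"
    have 1: "\<not> (u < k \<and> k < a \<and> a < l \<and> l < q)" using min[of l] kl by force
    show "\<not> (a < k \<and> k < q \<and> q < l) \<and> \<not> (k < a \<and> a < l \<and> l < q)"
      using 1 L.AA[OF q(1) kl] L.AA[OF kl q(1)] q by auto
  next
    fix r g assume r: "C r g" show "\<not> (a < r \<and> r < q)" using L.AC[OF q(1) r] q by auto
  qed (use q vq a L.A_len[OF q(1)] in auto)
  then show ?thesis using vq by blast
next
  case no_right: False
  show ?thesis
  proof (cases "\<exists>p g. C p g \<and> u < p \<and> p < a")
    case True
    then obtain p g where p: "C p g" "u < p" "p < a" by blast
    show ?thesis
    proof (cases "C p (\<not> g)")
      case False
      have "C a g"
      proof (rule L.C_max)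
        show "\<not> K" using L.C_K[OF p(1)] .
        fix k l assume kl: "A k l"
        show "\<not> (k < a \<and> a < l)" using L.AC[OF kl p(1)] no_right kl p by (smt (verit))
      next
        fix r h assume r: "C r h"
        show "n dvd a - r \<or> g = h"
        proof (rule ccontr)
          assume neg: "\<not> ?thesis"
          then have "n dvd p - r" using L.CC[OF p(1) r] by auto
          then have "C p h" using L.C_shift[OF r, of "p - r"] by simp
          moreover have "h = (\<not> g)" using neg by auto
          ultimately show False using False by simp
        qed
      qed
      then show ?thesis by blast
    next
      case True
      then have "C p h" for h using p(1) by (cases "h = g") auto
      then have both: "C (p + n) h" for h using L.C_shiftn(1) by blast
      have "\<not> K" using L.C_K[OF p(1)] .
      \<comment> \<open>With tangent chords of both signs at \<open>p\<close> there are none at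
        inequivalent positions, so the arc from \<open>a\<close> around to \<open>p + n\<close> is
        free.\<close>
      have "A a (p + n)"
      proof (rule L.A_max)
        fix k l assume kl: "A k l"
        show "\<not> (a < k \<and> k < p + n \<and> p + n < l) \<and> \<not> (k < a \<and> a < l \<and> l < p + n)"
          using L.AC[OF kl p(1)] L.AC[OF kl both] no_right kl p by (smt (verit))
      next
        fix r h assume r: "C r h"
        have "n dvd p + n - r" using L.CC[OF both[of "\<not> h"] r] by auto
        then show "\<not> (a < r \<and> r < p + n)" using small_dvd[of "p + n - r"] p by auto
      qed (use p a uv_len \<open>\<not> K\<close> in auto)
      moreover have "v < p + n" using p uv_len by auto
      ultimately show ?thesis by blast
    qed
  next
    case no_central: False
    let ?P = "\<lambda>i. i < u \<and> (\<exists>j. A i j \<and> u < j \<and> j < a)"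
    obtain q0 where q0: "?P q0" using ex no_central no_right by blast
    have "a - n \<le> i \<or> a - n - n \<le> i" if "?P i" for i using L.A_len a that uv_len by (smt (verit))
    then have "a - n - n \<le> i" if "?P i" for i using that n by force
    then obtain q where "?P q" and min: "\<And>q'. ?P q' \<Longrightarrow> q \<le> q'"
      using int_least[of ?P q0 "a - n - n", OF q0] by blast
    then obtain p where q: "q < u" "A q p" "u < p" "p < a" by blast
    show ?thesis
    proof (cases "q = a - n")
      case True
      \<comment> \<open>An arc from \<open>a - n\<close> to \<open>a\<close> would have length
        \<open>n\<close>; the translate of the arc from \<open>q\<close> to \<open>p\<close> already
        starts at \<open>a\<close> and takes its place.\<close>
      have "A a (p + n)" using L.A_shiftn(1)[OF q(2)] True by simp
      moreover have "v < p + n" using q uv_len by auto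
      ultimately show ?thesis by blast
    next
      case False
      have "\<not> q < a - n"
      proof
        assume "q < a - n"
        moreover have "p \<le> q + n" using L.A_len[OF q(2)] by auto
        ultimately show False
          using no_right L.A_shiftn(1)[OF q(2)] q a uv_len by (smt (verit))
      qed
      then have len: "a - q < n" using False by auto
      have "A q a"
      proof (rule L.A_max)
        fix k l assume kl: "A k l"
        have 1: "\<not> (k < q \<and> u < l \<and> l < a)" using min[of k] kl q by force
        show "\<not> (q < k \<and> k < a \<and> a < l) \<and> \<not> (k < q \<and> q < l \<and> l < a)"
          using 1 L.AA[OF q(2) kl] L.AA[OF kl q(2)] no_right kl q by (smt (verit))
      next
        fix r g assume r: "C r g"
        show "\<not> (q < r \<and> r < a)" using L.AC[OF q(2) r] no_central r q by (smt (verit))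
      qed (use q len in auto)
      then show ?thesis using q by blast
    qed
  qed
qed

text \<open>Suppose tangent chords of the opposite sign start between \<open>u\<close> and
  \<open>v\<close>. If they have only one position, sign \<open>a\<close> is free there as well;
  otherwise an arc joins the last position to the first one of the next period and crosses two
  copies of \<open>Arc u v\<close>. If there are none, opposite signs occur only at
  \<open>v\<close>, so some arc must pass over \<open>v\<close>, and the leftmost start of such arcs
  carries sign \<open>a\<close>.\<close>

lemma surj_central:
  assumes K: "\<not> K" and x: "\<not> C v a"
    and H1: "\<And>i j. A i j \<Longrightarrow> i < v \<Longrightarrow> v < j \<Longrightarrow> u < i"
    and H2: "\<And>p. C p (\<not> a) \<Longrightarrow> v \<le> p \<Longrightarrow> p < v + n \<Longrightarrow> p \<noteq> v \<Longrightarrow> u + n < p"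
  shows "(\<exists>p. C p a \<and> u < p \<and> p < v) \<or> (\<exists>i j. A i j \<and> i < u \<and> u < j \<and> j < v \<and> i \<le> v - n)
    \<or> (\<exists>i j. A i j \<and> u < i \<and> i < v \<and> u + n < j)"
proof (cases "\<exists>p. C p (\<not> a) \<and> u < p \<and> p < v")
  case True
  let ?P = "\<lambda>p. C p (\<not> a) \<and> u < p \<and> p \<le> v"
  obtain p0 where p0: "?P p0" "p0 < v" using True by auto
  obtain k where k: "?P k" and kmin: "\<And>p'. ?P p' \<Longrightarrow> k \<le> p'"
    using int_least[of ?P p0 u] p0(1) by (meson less_imp_le)
  obtain m where m: "?P m" and mmax: "\<And>p'. ?P p' \<Longrightarrow> p' \<le> m"
    using int_greatest[of ?P p0 v] p0(1) by blast
  have kv: "k < v" using kmin[OF p0(1)] p0(2) by auto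
  have only: "\<not> (m < p \<and> p < k + n)" if p: "C p (\<not> a)" for p
  proof
    assume h: "m < p \<and> p < k + n"
    then have "v < p" using mmax[of p] p m by force
    then have "u + n < p" using H2[OF p] h kv by auto
    then have "?P (p - n)" using L.C_shiftn(2)[OF p] h kv by auto
    then show False using kmin h by force
  qed
  show ?thesis
  proof (cases "k = m")
    case True
    have "C k a"
    proof (rule L.C_max[OF K])
      fix i j assume ij: "A i j" show "\<not> (i < k \<and> k < j)" using L.AC[OF ij] k by blast
    next
      fix q b assume q: "C q b"
      show "n dvd k - q \<or> a = b"
      proof (rule ccontr)
        assume neg: "\<not> ?thesis"
        then have b: "b = (\<not> a)" by auto
        obtain z where z: "n dvd z" "k \<le> q + z" "q + z < k + n" using L.representative by blast
        have "C (q + z) (\<not> a)" using L.C_shift[OF q z(1)] b by simp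
        then have "q + z = k" using only[of "q + z"] z True by auto
        then have "k - q = z" by simp
        then show False using neg z(1) by blast
      qed
    qed
    then show ?thesis using k kv by blast
  next
    case False
    then have km: "k < m" using kmin[OF m] by auto
    have "A m (k + n)"
    proof (rule L.A_max)
      fix i j assume ij: "A i j"
      have "C (k + n) (\<not> a)" using L.C_shiftn(1) k by blast
      then show "\<not> (m < i \<and> i < k + n \<and> k + n < j) \<and> \<not> (i < m \<and> m < j \<and> j < k + n)"
        using L.AC[OF ij] m by blast
    next
      fix q b assume q: "C q b"
      show "\<not> (m < q \<and> q < k + n)"
      proof
        assume h: "m < q \<and> q < k + n"
        then have "b \<noteq> (\<not> a)" using only q by blast
        then have "b = a" by auto
        moreover have "\<not> n dvd k - m" using small_dvd[of "k - m"] km k m uv_len by auto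
        moreover have "n dvd q - k" "n dvd q - m"
          using L.CC[OF q, of k "\<not> a"] L.CC[OF q, of m "\<not> a"] k m \<open>b = a\<close> by auto
        then have "n dvd (q - m) - (q - k)" by (rule dvd_diff[rotated])
        ultimately show False by simp
      qed
    qed (use k m km kv uv_len(3)[OF K] in auto)
    show ?thesis
    proof (cases "m = v")
      case True
      \<comment> \<open>The arc from \<open>v\<close> to \<open>k + n\<close> only touches
        \<open>Arc u v\<close>; its translate by \<open>- n\<close> crosses it.\<close>
      have "A (v - n) k" using L.A_shiftn(2)[OF \<open>A m (k + n)\<close>] True by simp
      then show ?thesis using k kv uv_len K by (intro disjI2 disjI1 exI[of _ "v - n"] exI[of _ k]) auto
    next
      case False
      then show ?thesis using \<open>A m (k + n)\<close> m k by (intro disjI2 exI[of _ m] exI[of _ "k + n"]) auto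
    qed
  qed
next
  case False
  have none: "n dvd p - v" if p: "C p (\<not> a)" for p
  proof -
    obtain z where z: "n dvd z" "v \<le> p + z" "p + z < v + n" using L.representative by blast
    have Cz: "C (p + z) (\<not> a)" using L.C_shift[OF p z(1)] .
    have "p + z = v"
    proof (rule ccontr)
      assume "p + z \<noteq> v"
      then have "u + n < p + z" using H2[OF Cz] z by blast
      moreover have "C (p + z - n) (\<not> a)" using L.C_shiftn(2)[OF Cz] .
      ultimately show False using False z by force
    qed
    then have "p - v = - z" by simp
    then show ?thesis using z(1) by simp
  qed
  have "\<exists>i j. A i j \<and> i < v \<and> v < j"
  proof (rule ccontr)
    assume "\<not> ?thesis"
    then have "C v a"
    proof (intro L.C_max[OF K])
      fix q b assume q: "C q b"
      show "n dvd v - q \<or> a = b"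
      proof (cases "a = b")
        case False
        then have "b = (\<not> a)" by auto
        then have "n dvd q - v" using none[of q] q by simp
        then show ?thesis by (simp add: dvd_diff_commute)
      qed simp
    qed blast
    then show False using x by blast
  qed
  then obtain i0 j0 where ij0: "A i0 j0" "i0 < v" "v < j0" by blast
  let ?P = "\<lambda>i. i < v \<and> (\<exists>j>v. A i j)"
  have "?P i0" using ij0 by blast
  moreover have "u \<le> i" if "?P i" for i using that H1 by force
  ultimately obtain p where "?P p" and min: "\<And>p'. ?P p' \<Longrightarrow> p \<le> p'"
    using int_least[of ?P i0 u] by blast
  then obtain q where q: "p < v" "v < q" "A p q" by blast
  have up: "u < p" using H1 q by blast
  have "C p a"
  proof (rule L.C_max[OF K])
    fix k l assume kl: "A k l"
    show "\<not> (k < p \<and> p < l)" using min[of k] kl q L.AA[OF kl q(3)] by (smt (verit))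
  next
    fix r b assume r: "C r b"
    show "n dvd p - r \<or> a = b"
    proof (rule ccontr)
      assume "\<not> ?thesis"
      then have b: "b = (\<not> a)" by auto
      then have "n dvd r - v" using none r by blast
      then have "n dvd v - r" by (simp add: dvd_diff_commute)
      then have "C v (\<not> a)" using L.C_shift[OF r, of "v - r"] b by simp
      then show False using L.AC[OF q(3)] q by blast
    qed
  qed
  then show ?thesis using up q by blast
qed

text \<open>A short arc is incident in a single lift. So not being blocked means that every chord of
  the triangulation crossing it also crosses \<open>Arc u v\<close> in the same lift, which is what
  the lemmas on the separate shapes ask for.\<close>

lemma surj_arc:
  assumes x: "incident (Arc a b)" "a < b" "b - a < n" "\<not> A a b" "valid (Arc a b)"
    and nb: "\<And>t. L.mem t \<Longrightarrow> \<not> bl t (Arc a b)"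
  shows "\<exists>t. L.mem t \<and> F t (Arc a b)"
proof -
  have al: "crs t (Arc u v)" if t: "L.mem t" "crs t (Arc a b)" for t
  proof -
    obtain m where m: "n dvd m" "incident (shift m (Arc a b))" "crs (shift m t) (Arc u v)"
      using nb[OF t(1)] t(2) unfolding bl_def by blast
    have "m = 0" using incident_unique[OF x(1-3) m(1,2)] .
    then show ?thesis using m(3) by simp
  qed
  have alA: "i < u \<and> u < j \<and> j < v \<or> u < i \<and> i < v \<and> v < j"
    if "A i j" "i < a \<and> a < j \<and> j < b \<or> a < i \<and> i < b \<and> b < j" for i j
    using al[of "Arc i j"] that by auto
  have alC: "u < p \<and> p < v" if "C p g" "a < p" "p < b" for p g
    using al[of "Cen p g"] that by auto
  obtain t where t: "L.mem t" "crs t (Arc a b)" using L.mem_max[of "Arc a b"] x(4,5) by auto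
  have ex: "(\<exists>i j. A i j \<and> (i < a \<and> a < j \<and> j < b \<or> a < i \<and> i < b \<and> b < j)) \<or> (\<exists>p g. C p g \<and> a < p \<and> p < b)"
    using t by (cases t) auto
  consider "a = u" "b = v" | "a = u" "b < v" | "a = v" "b \<le> u + n" | "b = v" "v - n < a" "a < u"
    using x(1-3) by force
  then show ?thesis
  proof cases
    case 1
    then have "crs t (Arc u v)" using t by simp
    then have "F t (Arc u v)" by (cases t) auto
    then show ?thesis using t 1 by blast
  next
    case 2
    have "(\<exists>q>v. A b q) \<or> (\<exists>q<u. A q b) \<or> (\<exists>g. C b g)"
    proof (rule surj_outer)
      show "v < j" if "A i j" "u < i" "i < b" "b < j" for i j using alA[OF that(1)] that 2 by auto
      show "(\<exists>i j. A i j \<and> (u < i \<and> i < b \<and> b < j \<or> i < u \<and> u < j \<and> j < b)) \<or> (\<exists>p g. C p g \<and> u < p \<and> p < b)"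
        using ex unfolding 2 by blast
    qed (use 2 x in auto)
    then show ?thesis
    proof (elim disjE exE conjE)
      fix q assume "v < q" "A b q" then show ?thesis using 2 x by (intro exI[of _ "Arc b q"]) simp
    next
      fix q assume "q < u" "A q b" then show ?thesis using 2 x by (intro exI[of _ "Arc q b"]) simp
    next
      fix g assume "C b g" then show ?thesis using 2 x by (intro exI[of _ "Cen b g"]) simp
    qed
  next
    case 3
    have uvn: "u < v" using uv_len by simp
    obtain i j where ij: "A i j" "i < v \<and> v < j \<and> j < b"
    proof -
      have "\<not> (\<exists>p g. C p g \<and> a < p \<and> p < b)" using alC 3 by force
      moreover have "\<not> (\<exists>i j. A i j \<and> (a < i \<and> i < b \<and> b < j))" using alA 3 uvn by force
      ultimately show thesis using ex 3 that by blast
    qed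
    have "\<exists>p. A p b \<and> u < p \<and> p < v"
    proof (rule surj_right)
      show "u < i" if "A i j" "i < v" "v < j" "j < b" for i j using alA[OF that(1)] that 3 by auto
      show False if "A i j" "v < i" "i < b" "b < j" for i j using alA[OF that(1)] that 3 uvn by auto
      show False if "C p g" "v < p" "p < b" for p g using alC[OF that(1)] that 3 by auto
    qed (use 3 x ij in auto)
    then obtain p where "A p b" "u < p" "p < v" by blast
    then show ?thesis using 3 x by (intro exI[of _ "Arc p b"]) simp
  next
    case 4
    have "\<exists>p. A a p \<and> u < p \<and> p < v"
    proof (rule surj_left)
      show "u < j" if "A i j" "i < a" "a < j" "j < v" for i j using alA[OF that(1)] that 4 by auto
      show "u < i" if "A i j" "a < i" "i < v" "v < j" for i j using alA[OF that(1)] that 4 by auto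
      show "u < p" if "C p g" "a < p" "p < v" for p g using alC[OF that(1)] that 4 by auto
      show "(\<exists>i j. A i j \<and> (i < a \<and> a < j \<and> j < v \<or> a < i \<and> i < v \<and> v < j)) \<or> (\<exists>p g. C p g \<and> a < p \<and> p < v)"
        using ex 4 by blast
    qed (use 4 x in auto)
    then obtain p where "A a p" "u < p" "p < v" by blast
    then show ?thesis using 4 x by (intro exI[of _ "Arc a p"]) simp
  qed
qed

text \<open>The triangulation has some long arc, and a lift of it crosses the long arc at
  \<open>v\<close>. As it does not block, some translate crosses \<open>Arc u v\<close>, from the
  right or, one period lower, from the left.\<close>

lemma surj_long:
  assumes nx: "\<not> A v (v + n)" and K: K and nb: "\<And>t. L.mem t \<Longrightarrow> \<not> bl t (Arc v (v + n))"
  shows "\<exists>t. L.mem t \<and> F t (Arc v (v + n))"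
proof -
  obtain c where c: "A c (c + n)" using L.central_K[OF K] by blast
  obtain z where z: "n dvd z" "v \<le> c + z" "c + z < v + n" using L.representative by blast
  define k where "k = c + z"
  have k: "A k (k + n)" using L.A_shift[OF c z(1)] by (simp add: k_def algebra_simps)
  then have "v < k" using nx z by (cases "k = v") (auto simp: k_def)
  then have "crs (Arc k (k + n)) (Arc v (v + n))" using z by (simp add: k_def)
  then obtain m where m: "n dvd m" "crs (shift m (Arc k (k + n))) (Arc u v)"
    using nb[of "Arc k (k + n)"] k unfolding bl_def by auto
  have A: "A (k + m) (k + n + m)" "A (k + m + n) (k + n + m + n)" using L.A_shift[OF k m(1)] L.A_shiftn(1)[OF L.A_shift[OF k m(1)]] by simp_all
  consider "u < k + m" "k + m < v" "v < k + n + m" | "k + m < u" "u < k + n + m" "k + n + m < v" using m(2) by auto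
  then show ?thesis
  proof cases
    case 1
    then have "F (Arc (k + m) (k + n + m)) (Arc v (v + n))" using K by auto
    then show ?thesis using A by (intro exI[of _ "Arc (k + m) (k + n + m)"]) simp
  next
    case 2
    then have "F (Arc (k + m + n) (k + n + m + n)) (Arc v (v + n))" using K uv_len by auto
    then show ?thesis using A by (intro exI[of _ "Arc (k + m + n) (k + n + m + n)"]) simp
  qed
qed

lemma surj_cen:
  assumes K: "\<not> K" and nx: "\<not> C v a" and nb: "\<And>t. L.mem t \<Longrightarrow> \<not> bl t (Cen v a)"
  shows "\<exists>t. L.mem t \<and> F t (Cen v a)"
proof -
  have al: "\<exists>m. n dvd m \<and> crs (shift m t) (Arc u v)" if "L.mem t" "crs t (Cen v a)" for t
    using nb[OF that(1)] that(2) unfolding bl_def by blast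
  have "(\<exists>p. C p a \<and> u < p \<and> p < v) \<or> (\<exists>i j. A i j \<and> i < u \<and> u < j \<and> j < v \<and> i \<le> v - n)
    \<or> (\<exists>i j. A i j \<and> u < i \<and> i < v \<and> u + n < j)"
  proof (rule surj_central[OF K nx])
    fix i j assume ij: "A i j" "i < v" "v < j"
    then obtain m where m: "n dvd m" "crs (Arc (i + m) (j + m)) (Arc u v)" using al[of "Arc i j"] by auto
    have "j - i < n" using L.A_len[OF ij(1)] K by simp
    with m show "u < i" using ij uv_len by (cases rule: dvd_cases) auto
  next
    fix p assume p: "C p (\<not> a)" "v \<le> p" "p < v + n" "p \<noteq> v"
    then have "\<not> n dvd p - v" using small_dvd[of "p - v"] by auto
    then obtain m where m: "n dvd m" "crs (Cen (p + m) (\<not> a)) (Arc u v)" using al[of "Cen p (\<not> a)"] p by auto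
    then show "u + n < p" using p uv_len n by (cases rule: dvd_cases) auto
  qed
  then show ?thesis
  proof (elim disjE exE conjE)
    fix p assume "C p a" "u < p" "p < v"
    then show ?thesis by (intro exI[of _ "Cen p a"]) simp
  next
    fix i j assume "A i j" "i < u" "u < j" "j < v" "i \<le> v - n"
    then show ?thesis using K by (intro exI[of _ "Arc i j"]) simp
  next
    fix i j assume ij: "A i j" "u < i" "i < v" "u + n < j"
    then have "v < j" using uv_len by auto
    then show ?thesis using K ij by (intro exI[of _ "Arc i j"]) simp
  qed
qed

lemma surj:
  assumes v: "valid x" and nx: "\<not> L.mem x" and nb: "\<And>t. L.mem t \<Longrightarrow> \<not> bl t x"
  shows "\<exists>m t. n dvd m \<and> L.mem t \<and> F t (shift m x)"
proof -
  obtain t0 where t0: "L.mem t0" "crs t0 x" using L.mem_max[OF v nx] by blast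
  \<comment> \<open>A chord outside the triangulation is crossed by it; since this crossing is
    forgiven, some lift of \<open>x\<close> is incident.\<close>
  then obtain m0 where m0: "n dvd m0" "incident (shift m0 x)" using nb[OF t0(1)] unfolding bl_def by blast
  have nbs: "\<not> bl t (shift m x)" if "L.mem t" "n dvd m" for t m
  proof
    assume "bl t (shift m x)"
    then have "bl (shift (- m) t) (shift (- m) (shift m x))" using that(2) by (intro bl_shift) simp_all
    then show False using nb[of "shift (- m) t"] that L.mem_shift[of "- m" t] by simp
  qed
  have nxs: "\<not> L.mem (shift m x)" if "n dvd m" for m using nx L.mem_shift[OF that] by blast
  have "\<exists>m. n dvd m \<and> (\<exists>t. L.mem t \<and> F t (shift m x))"
  proof (cases "shift m0 x")
    case (Arc a b)
    have vab: "valid (Arc a b)" using v Arc valid_shift by metis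
    show ?thesis
    proof (cases "b - a < n")
      case True
      have "\<exists>t. L.mem t \<and> F t (Arc a b)"
        by (rule surj_arc) (use True vab m0 nxs[OF m0(1)] nbs[OF _ m0(1)] Arc in auto)
      then show ?thesis using Arc m0(1) by (intro exI[of _ m0]) simp
    next
      case False
      then have K: K and ba: "b = a + n" using vab by auto
      show ?thesis
      proof (cases "n dvd a - v")
        case True
        then have m: "n dvd m0 + (v - a)" using m0(1) by (simp add: dvd_diff_commute)
        have x: "shift (m0 + (v - a)) x = Arc v (v + n)"
        proof -
          have "shift (v - a) (shift m0 x) = Arc v (v + n)" using Arc ba by simp
          then show ?thesis by (simp add: add.commute)
        qed
        have "\<exists>t. L.mem t \<and> F t (Arc v (v + n))"
          by (rule surj_long) (use K nxs[OF m] nbs[OF _ m] x in auto)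
        then show ?thesis using x m by (intro exI[of _ "m0 + (v - a)"]) simp
      next
        case F: False
        then have self: "a = u" "b = v" using m0(2) False Arc ba uv_len by auto
        then have "n dvd a - v" using ba by auto
        then show ?thesis using F by blast
      qed
    qed
  next
    case (Cen p a)
    have K: "\<not> K" using v Cen by (metis valid.simps(2) valid_shift)
    have pv: "n dvd v - p" using m0(2) Cen by (simp add: dvd_diff_commute)
    then have m: "n dvd m0 + (v - p)" using m0(1) by simp
    have x: "shift (m0 + (v - p)) x = Cen v a"
    proof -
      have "shift (v - p) (shift m0 x) = Cen v a" using Cen by simp
      then show ?thesis by (simp add: add.commute)
    qed
    have "\<exists>t. L.mem t \<and> F t (Cen v a)"
      by (rule surj_cen) (use K nxs[OF m] nbs[OF _ m] x in auto)
    then show ?thesis using x m by (intro exI[of _ "m0 + (v - p)"]) simp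
  qed
  then show ?thesis by blast
qed

end

lemma (in arc_projection) lift_projection: "lift_projection n K (Arc u v) F bl"
proof unfold_locales
  show "valid (Arc u v)" by (fact uv)
next
  fix A C x
  assume L: "lifted n K A C" and x: "valid x" "\<not> (case x of Arc i j \<Rightarrow> A i j | Cen p a \<Rightarrow> C p a)"
    "\<forall>i j. A i j \<longrightarrow> \<not> bl (Arc i j) x" "\<forall>p a. C p a \<longrightarrow> \<not> bl (Cen p a) x"
  interpret lifted_arc_projection n K u v A C
    by (intro lifted_arc_projection.intro lifted_cover.intro arc_projection_axioms cover_axioms L)
  have "\<not> bl t x" if "L.mem t" for t using x(3,4) that by (cases t) auto
  then obtain m t where "n dvd m" "L.mem t" "F t (shift m x)" using surj[OF x(1)] x(2) unfolding L.mem_def by blast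
  then show "\<exists>m. n dvd m \<and> ((\<exists>i j. A i j \<and> F (Arc i j) (shift m x)) \<or> (\<exists>p a. C p a \<and> F (Cen p a) (shift m x)))"
    by (cases t) (metis L.mem_simps)+
next
  show "\<And>t x. valid t \<Longrightarrow> valid x \<Longrightarrow> crs t x \<Longrightarrow> \<forall>m. n dvd m \<longrightarrow> \<not> crs (shift m t) (Arc u v) \<Longrightarrow>
    \<forall>m. n dvd m \<longrightarrow> \<not> crs (shift m x) (Arc u v) \<Longrightarrow> bl t x"
    unfolding bl_def by blast
qed (rule F_crs F_ncrs blD(1) bl_shift bl_F_lift bl_F_crs F_F_lift F_unique_lift; assumption)+

section \<open>Retraction onto a pair of tangent chords\<close>

locale central_projection = cover +
  fixes p :: int and g :: bool
  assumes K: "\<not> K"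
begin

text \<open>The two ends of \<open>d\<close> are the vertex \<open>p\<close> and the disk. An arc
  over \<open>p\<close> is cut there: its left part is pulled to \<open>p\<close>, its right part to
  the disk, where it becomes the tangent chord of sign \<open>g\<close> at \<open>j\<close>. A
  tangent chord of the opposite sign contributes, besides \<open>d\<close>, only its part pulled to
  \<open>p\<close>.\<close>

fun F :: "arc \<Rightarrow> arc \<Rightarrow> bool" where
  "F (Arc i j) x \<longleftrightarrow> i < p \<and> p < j \<and> (x = Cen p g \<or> x = Cen j g \<or> x = Arc i p)"
| "F (Cen q b) x \<longleftrightarrow> b \<noteq> g \<and> p - n < q \<and> q < p \<and> (x = Cen p g \<or> x = Arc q p)"

text \<open>The crossings that pulling dissolves. An arc stops meeting a tangent chord of sign
  \<open>g\<close> at \<open>j\<close> if a copy of \<open>p\<close> lies under it before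
  \<open>j\<close>, since its right part moves to the disk, or if \<open>j\<close> is itself a copy
  of \<open>p\<close>. An arc ending at a copy of \<open>p\<close> is freed from arcs over that copy
  and from tangent chords of the opposite sign. For two tangent chords the residues say which vertex
  comes first counting from \<open>p\<close>.\<close>

fun allowed :: "arc \<Rightarrow> arc \<Rightarrow> bool" where
  "allowed (Arc i k) (Cen j a) \<longleftrightarrow> a = g \<and> (n dvd j - p \<or> (\<exists>m. n dvd m \<and> i < p + m \<and> p + m < j))"
| "allowed (Cen c b) (Cen j a) \<longleftrightarrow> a = g \<and> b \<noteq> g \<and> (j - p) mod n < (c - p) mod n"
| "allowed (Arc i k) (Arc a b) \<longleftrightarrow> n dvd b - p \<and> i < b \<and> b < k"
| "allowed (Cen c b') (Arc a b) \<longleftrightarrow> n dvd b - p \<and> b' \<noteq> g"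

definition bl :: "arc \<Rightarrow> arc \<Rightarrow> bool" where
  "bl t x \<longleftrightarrow> crs t x \<and> \<not> allowed t x"

lemma small_dvd: "n dvd m \<Longrightarrow> - n < m \<Longrightarrow> m < n \<Longrightarrow> m = 0"
  using n by (auto elim: dvd_cases)

lemma rep: "\<exists>m. n dvd m \<and> c + m = p + (c - p) mod n"
proof -
  have "c + - (n * ((c - p) div n)) = p + (c - p) mod n"
    by (simp add: minus_mult_div_eq_mod [symmetric])
  then show ?thesis by (intro exI[of _ "- (n * ((c - p) div n))"]) simp
qed

lemma mod_bounds: "0 \<le> c mod n" "c mod n < n"
  using n by simp_all

lemma mod_pos: "\<not> n dvd c \<Longrightarrow> 0 < c mod n"
  using mod_bounds(1)[of c] by (auto simp: dvd_eq_mod_eq_0 order_less_le)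

lemma mod_shift: "n dvd m \<Longrightarrow> (c + m - p) mod n = (c - p) mod n"
  by (metis add_diff_eq diff_add_eq mod_add_self2 dvd_def mod_mult_self2)

lemma dvd_shift: "n dvd m \<Longrightarrow> n dvd j + m - p \<longleftrightarrow> n dvd j - p"
  using dvd_add_left_iff[of n m "j - p"] by (simp add: algebra_simps)

lemma allowed_central: "i < p \<Longrightarrow> p < j \<Longrightarrow> allowed (Arc i k) (Cen j g)"
  by (auto intro!: exI[of _ 0])

lemma arc_short: "valid (Arc i j) \<Longrightarrow> 2 \<le> j - i \<and> j - i < n"
  using K by simp

lemma F_crs: "F t x \<Longrightarrow> crs t (Cen p g)"
proof (cases t)
  case (Cen q b)
  assume "F t x"
  then have "p - n < q" "q < p" "b \<noteq> g" using Cen by auto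
  then show ?thesis using small_dvd[of "q - p"] Cen by auto
qed auto

lemma F_ncrs:
  assumes "F t x" "valid t" "valid x" "n dvd m"
  shows "\<not> crs (shift m x) (Cen p g)"
proof -
  have "\<not> (q + m < p \<and> p < p + m)" if "p - n < q" for q
    using assms(4) n that by (cases rule: dvd_cases) auto
  moreover have "p - n < i" if "t = Arc i j" "i < p" "p < j" for i j
    using arc_short[of i j] assms(2) that by auto
  ultimately show ?thesis using assms(1,4) by (cases t) auto
qed

lemma bl_shift:
  assumes m: "n dvd m" and b: "bl t x"
  shows "bl (shift m t) (shift m x)"
proof -
  have "allowed t x" if "allowed (shift m t) (shift m x)"
  proof (cases t)
    case t: (Arc i k)
    show ?thesis
    proof (cases x)
      case (Arc a b)
      then show ?thesis using that t dvd_shift[OF m, of b] by simp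
    next
      case (Cen j a)
      have "\<exists>z. n dvd z \<and> i < p + z \<and> p + z < j" if "n dvd z" "i + m < p + z" "p + z < j + m" for z
        using that m by (intro exI[of _ "z - m"]) auto
      then show ?thesis using that t Cen dvd_shift[OF m, of j] by auto
    qed
  next
    case t: (Cen c b)
    show ?thesis
    proof (cases x)
      case (Arc i j)
      then show ?thesis using that t dvd_shift[OF m, of j] by simp
    next
      case (Cen j a)
      then show ?thesis using that t mod_shift[OF m] by simp
    qed
  qed
  then show ?thesis using b unfolding bl_def by auto
qed

lemma blI:
  assumes c: "crs t x" and t: "\<forall>m. n dvd m \<longrightarrow> \<not> crs (shift m t) (Cen p g)"
    and x: "\<forall>m. n dvd m \<longrightarrow> \<not> crs (shift m x) (Cen p g)"
  shows "bl t x"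
proof -
  have "\<not> allowed t x"
  proof (cases t)
    case t1: (Arc i k)
    have no: "\<not> (i < q \<and> q < k)" if "n dvd q - p" for q
    proof -
      have "n dvd p - q" using that by (simp add: dvd_diff_commute)
      then have "\<not> crs (shift (p - q) t) (Cen p g)" using t by blast
      then show ?thesis using t1 by auto
    qed
    show ?thesis
    proof (cases x)
      case (Arc a b) then show ?thesis using no[of b] t1 by auto
    next
      case (Cen j a)
      have "\<not> (i < p + m \<and> p + m < j)" if "n dvd m" for m using no[of "p + m"] that c t1 Cen by auto
      then show ?thesis using no[of j] c t1 Cen by auto
    qed
  next
    case t1: (Cen c' b)
    have cb: "b = g \<or> n dvd c' - p" using t[rule_format, of 0] t1 by auto
    show ?thesis
    proof (cases x)
      case (Arc i j)
      have "\<not> crs (shift (p - c') x) (Cen p g)" if "n dvd c' - p"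
        using x that by (simp add: dvd_diff_commute)
      then show ?thesis using cb c t1 Arc by auto
    next
      case (Cen j a)
      then show ?thesis using cb t1 mod_bounds(1)[of "j - p"] by (auto simp: dvd_eq_mod_eq_0)
    qed
  qed
  then show ?thesis using c unfolding bl_def by simp
qed

lemma blD: "bl t x \<Longrightarrow> crs t x" "bl t x \<Longrightarrow> \<not> allowed t x"
  by (simp_all add: bl_def)

lemma bl_self: "\<not> bl t (Cen p g)"
  using mod_pos by (cases t) (auto simp: bl_def)

lemma bl_F_lift:
  assumes F: "F t x" and v: "valid t" "valid x" "valid s" and bl: "bl s x"
  shows "\<exists>m. n dvd m \<and> crs (shift m s) t"
proof (cases t)
  case t: (Arc i j)
  have ij: "i < p" "p < j" using F t by auto
  have len: "j - i < n" using arc_short v t by auto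
  consider "x = Cen j g" | "x = Arc i p" using F bl bl_self t by auto
  then show ?thesis
  proof cases
    case 1
    show ?thesis
    proof (cases s)
      case (Arc a b)
      have "\<not> (a < p \<and> p < j)" using blD(2)[OF bl] allowed_central[of a j b] 1 Arc by blast
      then have "crs (shift 0 s) t" using blD(1)[OF bl] 1 ij t Arc by auto
      then show ?thesis using dvd_0_right by blast
    next
      case (Cen c b)
      obtain m where m: "n dvd m" "c + m = p + (c - p) mod n" using rep by blast
      have c: "\<not> n dvd c - j" "b \<noteq> g" using blD(1)[OF bl] 1 Cen by auto
      then have "(c - p) mod n \<le> j - p" using blD(2)[OF bl] 1 Cen ij len by auto
      moreover have "c + m \<noteq> j" using c(1) m(1) by auto
      ultimately have "i < c + m" "c + m < j" using m mod_bounds[of "c - p"] ij by auto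
      then show ?thesis using m(1) Cen t by (intro exI[of _ m]) simp
    qed
  next
    case 2
    then have "crs (shift 0 s) t" using blD[OF bl] ij t by (cases s) auto
    then show ?thesis using dvd_0_right by blast
  qed
next
  case t: (Cen q b)
  then have "x = Arc q p" "b \<noteq> g" "q < p" "p - n < q" using F bl bl_self by auto
  moreover have "\<not> n dvd c - q" if "q < c" "c < p" for c
    using small_dvd[of "c - q"] that \<open>p - n < q\<close> by auto
  ultimately have "crs (shift 0 s) t" using blD[OF bl] t by (cases s) auto
  then show ?thesis using dvd_0_right by blast
qed

lemma bl_F_crs:
  assumes v: "valid t" "valid z" and td: "crs t (Cen p g)" and bl: "bl t z"
    and nd: "\<forall>m. n dvd m \<longrightarrow> \<not> crs (shift m z) (Cen p g)"
  shows "\<exists>x m m'. n dvd m \<and> n dvd m' \<and> valid x \<and> F (shift m t) x \<and> crs (shift m' x) z"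
proof -
  have wit: ?thesis if "F (shift m t) x" "valid x" "crs (shift m' x) z" "n dvd m" "n dvd m'" for x m m'
    using that by blast
  have vC: "valid (Cen a b)" for a b unfolding valid.simps by (fact K)
  have vA: "valid (Arc a b)" if "2 \<le> b - a" "b - a < n" for a b using that by simp
  show ?thesis
  proof (cases t)
    case t: (Arc i k)
    have ik: "i < p" "p < k" using td t by auto
    have len: "k - i < n" using arc_short v t by auto
    show ?thesis
    proof (cases z)
      case (Arc a b)
      have nd0: "\<not> (a < p \<and> p < b)" using nd[rule_format, of 0] Arc by auto
      consider "a < i" "i < b" "b < k" | "i < a" "a < k" "k < b" using blD(1)[OF bl] t Arc by auto
      then show ?thesis
      proof cases
        case 1
        have "b \<noteq> p" using blD(2)[OF bl] 1 t Arc by auto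
        then have "b < p" using nd0 1 ik by auto
        then show ?thesis using wit[of 0 "Arc i p" 0] vA[of i p] 1 t Arc ik len by auto
      next
        case 2
        then have "p \<le> a" using nd0 ik by auto
        then show ?thesis using wit[of 0 "Cen k g" 0] vC[of k g] 2 t Arc ik by auto
      qed
    next
      case (Cen c b)
      have c: "i < c" "c < k" using blD(1)[OF bl] t Cen by auto
      show ?thesis
      proof (cases "b = g")
        case False
        have "n dvd c - p" using nd[rule_format, of 0] False Cen by auto
        then have "c = p" using small_dvd[of "c - p"] c ik len by auto
        moreover have "\<not> n dvd k - p" using small_dvd[of "k - p"] ik len by auto
        ultimately show ?thesis using wit[of 0 "Cen k g" 0] vC[of k g] False t Cen ik by auto
      next
        case True
        have "\<not> (i < p \<and> p < c)" using blD(2)[OF bl] allowed_central[of i c k] True t Cen by blast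
        moreover have "c \<noteq> p" using blD(2)[OF bl] True t Cen by auto
        ultimately have cp: "\<not> p \<le> c" using ik by auto
        then show ?thesis using wit[of 0 "Arc i p" 0] vA[of i p] c t Cen ik len by auto
      qed
    qed
  next
    case t: (Cen q b)
    have qb: "\<not> n dvd q - p" "b \<noteq> g" using td t by auto
    obtain m0 where m0: "n dvd m0" "q + m0 = p + (q - p) mod n" using rep by blast
    \<comment> \<open>This moves the vertex into the period just below \<open>p\<close>, where
      \<open>F\<close> expects it.\<close>
    define m where "m = m0 - n"
    have m: "n dvd m" "q + m = p - n + (q - p) mod n" using m0 by (auto simp: m_def)
    have q: "p - n < q + m" "q + m < p" using m(2) mod_bounds[of "q - p"] mod_pos[OF qb(1)] by auto
    have Fx: "F (shift m t) (Arc (q + m) p)" using t q qb by auto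
    show ?thesis
    proof (cases z)
      case (Arc a c)
      have ac: "a < q" "q < c" using blD(1)[OF bl] t Arc by auto
      have "\<not> n dvd c - p" using blD(2)[OF bl] t Arc qb by auto
      then have "c \<noteq> p - m" using m(1) by auto
      moreover have "\<not> (a + m < p \<and> p < c + m)" using nd[rule_format, OF m(1)] Arc by auto
      ultimately have "c < p - m" using ac q by auto
      then show ?thesis using wit[OF Fx, of "- m"] vA[of "q + m" p] ac q m(1) Arc by auto
    next
      case (Cen c a)
      have c: "\<not> n dvd q - c" "a = g" using blD(1)[OF bl] t Cen qb by auto
      have le: "(q - p) mod n \<le> (c - p) mod n" using blD(2)[OF bl] t Cen qb c by auto
      obtain k0 where k0: "n dvd k0" "c + k0 = p + (c - p) mod n" using rep by blast
      define k where "k = k0 - n"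
      have k: "n dvd k" "c + k = p - n + (c - p) mod n" using k0 by (auto simp: k_def)
      have "q + m \<noteq> c + k"
      proof
        assume "q + m = c + k"
        then have "q - c = k - m" by simp
        then show False using c(1) k(1) m(1) by simp
      qed
      then have "q + m < c + k" "c + k < p" using le k m mod_bounds[of "c - p"] by auto
      then show ?thesis
        using wit[OF Fx, of "- k"] vA[of "q + m" p] q m(1) k(1) Cen by auto
    qed
  qed
qed

lemma crs_bl:
  assumes "i < p" "p < j" "j < i + n" "p - n < q" "q + n < j"
  shows "bl (Arc i j) (Arc (q + n) (p + n))"
  using assms unfolding bl_def by auto

text \<open>Candidates attached to \<open>p\<close> do not cross each other, and neither do tangent
  chords of sign \<open>g\<close>. A conflict pairs \<open>Cen j g\<close> with an arc ending at
  \<open>p + n\<close> that passes over \<open>j\<close>, and the arc that produced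
  \<open>Cen j g\<close> blocks it.\<close>

lemma F_F_lift:
  assumes "F t x" "F t' y" "valid t" "valid t'" "valid x" "valid y" "n dvd m" "crs x (shift m y)"
  shows "bl t (shift m y) \<or> bl t' (shift (- m) x)"
proof -
  have im: "x = Cen p g \<or> (\<exists>i j. t = Arc i j \<and> x = Cen j g \<and> i < p \<and> p < j \<and> j < i + n) \<or> (\<exists>q. x = Arc q p \<and> p - n < q \<and> q < p)"
    if "F t x" "valid t" for t x
  proof (cases t)
    case (Arc i j)
    then have "j < i + n" using arc_short[of i j] that(2) by auto
    then show ?thesis using that(1) Arc by auto
  next
    case (Cen q b) then show ?thesis using that(1) by auto
  qed
  have no_self: "\<not> crs (Cen p g) (shift k (Arc q p))" "\<not> crs (Arc q p) (shift k (Cen p g))"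
    "\<not> crs (Arc q p) (shift k (Arc q' p))"
    if "n dvd k" "p - n < q" "p - n < q'" for k q q'
    by (use that n in \<open>cases rule: dvd_cases; auto\<close>)+
  consider "x = Cen p g" | i j where "t = Arc i j" "x = Cen j g" "i < p" "p < j" "j < i + n"
    | q where "x = Arc q p" "p - n < q" "q < p" using im[OF assms(1,3)] by blast
  then show ?thesis
  proof cases
    case 1
    then show ?thesis using im[OF assms(2,4)] assms(7,8) no_self(1) by auto
  next
    case (2 i j)
    then obtain q where q: "y = Arc q p" "p - n < q" "q < p" using im[OF assms(2,4)] assms(8) by auto
    have "m = n" using assms(7,8) 2 q n by (cases rule: dvd_cases) auto
    then show ?thesis using crs_bl[of i j q] 2 q assms(8) by auto
  next
    case (3 q)
    then obtain i j where ij: "t' = Arc i j" "y = Cen j g" "i < p" "p < j" "j < i + n"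
      using im[OF assms(2,4)] assms(7,8) no_self(2,3) by blast
    have "m = - n" using assms(7,8) 3 ij n by (cases rule: dvd_cases) auto
    then show ?thesis using crs_bl[of i j q] 3 ij assms(8) by auto
  qed
qed

text \<open>Blocking \<open>Arc i p\<close> makes \<open>s\<close> an arc that starts before
  \<open>i\<close> and ends between \<open>i\<close> and \<open>p\<close>; crossing a copy of
  \<open>Cen p g\<close> then forces its start below \<open>p - n\<close>. Blocking
  \<open>Cen j g\<close> needs a translate starting between \<open>p\<close> and \<open>j\<close>,
  hence a move by at least \<open>2 * n\<close>, too far for arcs shorter than
  \<open>n\<close>.\<close>

lemma F_unique_aux:
  assumes ij: "i < p" "p < j" "valid (Arc i j)" and s: "valid s" "crs (shift k s) (Cen p g)" "n dvd k"
    and b1: "bl s (Arc i p)" and b2: "bl (shift m s) (Cen j g)" "n dvd m"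
  shows False
proof (cases s)
  case (Cen c b)
  then have "b \<noteq> g" using s by auto
  then show False using blD(2)[OF b1] Cen by auto
next
  case (Arc a b)
  have len: "j - i < n" "b - a < n" using arc_short[OF ij(3)] arc_short[of a b] s(1) Arc by blast+
  have ab: "a < i" "i < b" "b < p" using blD[OF b1] Arc ij by auto
  have "\<not> (a + m < p \<and> p < j)" using blD(2)[OF b2(1)] allowed_central[of "a + m" j "b + m"] Arc by auto
  then have am: "p \<le> a + m" "a + m < j" using blD(1)[OF b2(1)] Arc ij by auto
  have "a < p - n" using s(3,2) len ab ij n Arc by (cases rule: dvd_cases) auto
  with b2(2) show False using am ab len ij by (cases rule: dvd_cases) auto
qed

lemma F_unique_lift:
  assumes "F e x" "F (shift m e) y" "n dvd m" "valid e" "valid s" "valid x" "valid y"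
    "bl s x" "bl (shift m' s) y" "n dvd m'" "crs (shift m'' s) (Cen p g)" "n dvd m''"
  shows "\<exists>k. n dvd k \<and> y = shift k x"
proof -
  have "y = x"
  proof (cases e)
    case (Cen q b)
    have "x = Arc q p" "y = Arc (q + m) p" using assms(1,2,8,9) bl_self Cen by auto
    moreover have "m = 0" using small_dvd[OF assms(3)] assms(1,2) Cen by auto
    ultimately show ?thesis by simp
  next
    case (Arc i j)
    have ij: "i < p" "p < j" "valid (Arc i j)" using assms(1,4) Arc by auto
    have m: "m = 0" using small_dvd[OF assms(3)] assms(1,2) Arc arc_short[OF ij(3)] by auto
    have 1: "x = Cen j g \<or> x = Arc i p" "y = Cen j g \<or> y = Arc i p"
      using assms(1,2,8,9) bl_self Arc m by auto
    have "\<not> (x = Arc i p \<and> y = Cen j g)"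
      using F_unique_aux[OF ij assms(5,11,12)] assms(8,9,10) by blast
    moreover have "\<not> (x = Cen j g \<and> y = Arc i p)"
    proof
      assume h: "x = Cen j g \<and> y = Arc i p"
      have "crs (shift (m'' - m') (shift m' s)) (Cen p g)" "n dvd m'' - m'" "valid (shift m' s)"
        "bl (shift (- m') (shift m' s)) (Cen j g)" "n dvd - m'" "bl (shift m' s) (Arc i p)"
        using assms h by auto
      then show False using F_unique_aux[OF ij, of "shift m' s" "m'' - m'" "- m'"] by blast
    qed
    ultimately show ?thesis using 1 by blast
  qed
  then show ?thesis by (intro exI[of _ 0]) simp
qed

end

locale lifted_central_projection = central_projection n K p g + L: lifted_cover n K A C
  for n :: int and K :: bool and p :: int and g :: bool and A :: "int \<Rightarrow> int \<Rightarrow> bool" and C :: "int \<Rightarrow> bool \<Rightarrow> bool"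
begin

text \<open>If arcs pass over \<open>j\<close>, the latest start of such an arc can be joined to
  \<open>j\<close>. If not, the last tangent chord of the opposite sign before \<open>p + n\<close>
  is moved back by \<open>n\<close>, and its vertex is joined to \<open>j\<close>.\<close>

lemma surj_central:
  assumes j: "p < j" "j < p + n"
    and H1: "\<And>i k. A i k \<Longrightarrow> i < j \<Longrightarrow> j < k \<Longrightarrow> i < p"
    and H2: "\<And>c. C c (\<not> g) \<Longrightarrow> p \<le> c \<Longrightarrow> c < p + n \<Longrightarrow> j \<le> c"
    and ex: "(\<exists>i k. A i k \<and> i < j \<and> j < k) \<or> (\<exists>c. C c (\<not> g) \<and> j < c \<and> c < p + n)"
  shows "\<exists>i<p. A i j"
proof (cases "\<exists>i k. A i k \<and> i < j \<and> j < k")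
  case True
  let ?P = "\<lambda>i. i < j \<and> (\<exists>k>j. A i k)"
  obtain i0 where i0: "?P i0" using True by blast
  have "i \<le> p" if "?P i" for i using that H1 by force
  then obtain i where "?P i" and max: "\<And>i'. ?P i' \<Longrightarrow> i' \<le> i" using int_greatest[of ?P i0 p, OF i0] by blast
  then obtain k where ik: "i < j" "j < k" "A i k" by blast
  have ip: "i < p" using H1 ik by blast
  have "A i j"
  proof (rule L.A_max)
    fix a b assume ab: "A a b"
    show "\<not> (i < a \<and> a < j \<and> j < b) \<and> \<not> (a < i \<and> i < b \<and> b < j)"
      using max[of a] ab L.AA[OF ab ik(3)] ik by (smt (verit))
  next
    fix c b assume "C c b" then show "\<not> (i < c \<and> c < j)" using L.AC[OF ik(3)] ik by fastforce
  qed (use ip j ik L.A_len[OF ik(3)] in auto)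
  then show ?thesis using ip by blast
next
  case False
  let ?P = "\<lambda>c. C c (\<not> g) \<and> j < c \<and> c < p + n"
  obtain c0 where c0: "?P c0" using ex False by blast
  have "c \<le> p + n" if "?P c" for c using that by simp
  then obtain c where c: "?P c" and max: "\<And>c'. ?P c' \<Longrightarrow> c' \<le> c" using int_greatest[of ?P c0 "p + n", OF c0] by blast
  have cn: "C (c - n) (\<not> g)" using c L.C_shiftn(2) by blast
  have "A (c - n) j"
  proof (rule L.A_max)
    fix a b assume ab: "A a b"
    show "\<not> (c - n < a \<and> a < j \<and> j < b) \<and> \<not> (a < c - n \<and> c - n < b \<and> b < j)"
      using False ab L.AC[OF ab cn] by blast
  next
    fix r b assume r: "C r b"
    show "\<not> (c - n < r \<and> r < j)"
    proof
      assume h: "c - n < r \<and> r < j"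
      show False
      proof (cases "b = g")
        case True
        then have "n dvd r - (c - n)" using L.CC[OF r cn] by auto
        then show False using small_dvd[of "r - (c - n)"] h c j by auto
      next
        case F: False
        then have r': "C r (\<not> g)" using r by (cases b; cases g) auto
        show False
        proof (cases "r < p")
          case True
          then have "?P (r + n)" using L.C_shiftn(1)[OF r'] h c by auto
          then show False using max[of "r + n"] h by auto
        next
          case False
          then show False using H2[OF r'] h j by auto
        qed
      qed
    qed
  qed (use c j in auto)
  then show ?thesis using c by (intro exI[of _ "c - n"]) auto
qed

text \<open>If a tangent chord of the opposite sign sits between \<open>q\<close> and
  \<open>p\<close>, one also fits at \<open>q\<close>. Otherwise consider the farthest right end
  \<open>k\<close> of an arc from there over \<open>p\<close>: it can be joined to \<open>q\<close>,
  unless \<open>k = q + n\<close>.\<close>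

lemma surj_arc:
  assumes q: "p - n < q" "q < p"
    and H1: "\<And>i k. A i k \<Longrightarrow> i < q \<Longrightarrow> q < k \<Longrightarrow> k < p \<Longrightarrow> False"
    and H2: "\<And>c. C c g \<Longrightarrow> q < c \<Longrightarrow> c < p \<Longrightarrow> False"
    and ex: "(\<exists>i k. A i k \<and> q < i \<and> i < p \<and> p < k) \<or> (\<exists>c. C c (\<not> g) \<and> q < c \<and> c < p)"
  shows "(\<exists>k>p. A q k) \<or> C q (\<not> g)"
proof (cases "\<exists>c. C c (\<not> g) \<and> q < c \<and> c < p")
  case True
  then obtain c where c: "C c (\<not> g)" "q < c" "c < p" by blast
  have "C q (\<not> g)"
  proof (rule L.C_max[OF K])
    fix a b assume ab: "A a b"
    show "\<not> (a < q \<and> q < b)" using H1[OF ab] L.AC[OF ab c(1)] c by force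
  next
    fix r b assume r: "C r b"
    show "n dvd q - r \<or> (\<not> g) = b"
    proof (rule ccontr)
      assume "\<not> ?thesis"
      then have b: "b = g" by auto
      then have "n dvd c - r" using L.CC[OF c(1) r] by auto
      then have "C c g" using L.C_shift[OF r, of "c - r"] b by simp
      then show False using H2 c by blast
    qed
  qed
  then show ?thesis by blast
next
  case no_central: False
  let ?P = "\<lambda>k. p < k \<and> (\<exists>i. A i k \<and> q < i \<and> i < p)"
  obtain k0 where k0: "?P k0" using ex no_central by blast
  have "k \<le> p + n" if "?P k" for k using that L.A_len by force
  then obtain k where "?P k" and max: "\<And>k'. ?P k' \<Longrightarrow> k' \<le> k" using int_greatest[of ?P k0 "p + n", OF k0] by blast
  then obtain i where ik: "A i k" "q < i" "i < p" "p < k" by blast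
  have len: "k - i < n" using L.A_len[OF ik(1)] K by simp
  have ink: "A (i - n) (k - n)" using L.A_shiftn(2)[OF ik(1)] .
  have noC: "\<not> C c b" if "q < c" "c < p" for c b
  proof (cases "b = g")
    case True then show ?thesis using H2 that by blast
  next
    case False then have "b = (\<not> g)" by auto
    then show ?thesis using no_central that by blast
  qed
  consider "k < q + n" | "k = q + n" | "q + n < k" by linarith
  then show ?thesis
  proof cases
    case 1
    have "A q k"
    proof (rule L.A_max)
      fix a b assume ab: "A a b"
      have "\<not> (a < q \<and> q < b \<and> b < k)"
        using H1[OF ab] L.AA[OF ab ik(1)] ik by (smt (verit))
      moreover have "\<not> (q < a \<and> a < k \<and> k < b)"
        using max[of b] ab L.AA[OF ik(1) ab] ik by (smt (verit))
      ultimately show "\<not> (q < a \<and> a < k \<and> k < b) \<and> \<not> (a < q \<and> q < b \<and> b < k)" by blast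
    next
      fix c b assume c: "C c b"
      show "\<not> (q < c \<and> c < k)" using L.AC[OF ik(1) c] noC c ik by (smt (verit))
    qed (use 1 ik in auto)
    then show ?thesis using ik by blast
  next
    case 2
    \<comment> \<open>The arc from \<open>i\<close> to \<open>q + n\<close> and the absence of
      tangent chords between \<open>q\<close> and \<open>p\<close> leave \<open>q\<close> as the
      only position of tangent chords, so both signs fit there.\<close>
    have "C q (\<not> g)"
    proof (rule L.C_max[OF K])
      fix a b assume ab: "A a b"
      have "b - a < n" using L.A_len[OF ab] K by simp
      then show "\<not> (a < q \<and> q < b)" using H1[OF ab] L.AA[OF ink ab] 2 q ik by (smt (verit))
    next
      fix r b assume r: "C r b"
      obtain z where z: "n dvd z" "q \<le> r + z" "r + z < q + n" using L.representative by blast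
      have rz: "C (r + z) b" using L.C_shift[OF r z(1)] .
      have "r + z = q" using L.AC[OF ik(1) rz] noC[of "r + z" b] rz z 2 ik by (smt (verit))
      then have "q - r = z" by simp
      then show "n dvd q - r \<or> (\<not> g) = b" using z(1) by simp
    qed
    then show ?thesis by blast
  next
    case 3
    then show ?thesis using H1[OF ink] len ik q by auto
  qed
qed

lemma surj:
  assumes v: "valid x" and nx: "\<not> L.mem x" and nb: "\<And>t. L.mem t \<Longrightarrow> \<not> bl t x"
  shows "\<exists>m t. n dvd m \<and> L.mem t \<and> F t (shift m x)"
proof -
  obtain t0 where t0: "L.mem t0" "crs t0 x" using L.mem_max[OF v nx] by blast
  have nbs: "\<not> bl t (shift m x)" if "L.mem t" "n dvd m" for t m
  proof
    assume "bl t (shift m x)"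
    then have "bl (shift (- m) t) (shift (- m) (shift m x))" using that(2) by (intro bl_shift) simp_all
    then show False using nb[of "shift (- m) t"] that L.mem_shift[of "- m" t] by simp
  qed
  have al: "allowed t (shift m x)" if "L.mem t" "n dvd m" "crs t (shift m x)" for t m
    using nbs[OF that(1,2)] that(3) by (simp add: bl_def)
  have ex: "\<exists>t. L.mem t \<and> crs t (shift m x)" if "n dvd m" for m
    using t0 L.mem_shift[OF that] by (intro exI[of _ "shift m t0"]) simp
  show ?thesis
  proof (cases x)
    case (Cen j0 a)
    have a: "a = g" using al[OF t0(1) dvd_0_right] t0(2) Cen by (cases t0) auto
    obtain m where m: "n dvd m" "j0 + m = p + (j0 - p) mod n" using rep by blast
    define j where "j = j0 + m"
    have x: "shift m x = Cen j g" using Cen a by (simp add: j_def)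
    have j: "p \<le> j" "j < p + n" using m(2) mod_bounds[of "j0 - p"] by (auto simp: j_def)
    obtain t where t: "L.mem t" "crs t (Cen j g)" using ex[OF m(1)] x by auto
    show ?thesis
    proof (cases "j = p")
      case True
      show ?thesis
      proof (cases t)
        case (Arc i k)
        then show ?thesis using t x True m(1) by (intro exI[of _ m] exI[of _ t]) auto
      next
        case tc: (Cen c b)
        have cb: "\<not> n dvd c - p" "b \<noteq> g" using t(2) tc True by auto
        obtain z where z: "n dvd z" "c + z = p + (c - p) mod n" using rep by blast
        have "C (c + z - n) b" using L.C_shift[of c b z] L.C_shiftn(2) z(1) t tc by auto
        moreover have "F (Cen (c + z - n) b) (Cen p g)"
          using z(2) mod_bounds[of "c - p"] mod_pos[OF cb(1)] cb(2) by auto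
        ultimately show ?thesis using x True m(1)
          by (intro exI[of _ m] exI[of _ "Cen (c + z - n) b"]) auto
      qed
    next
      case False
      then have pj: "p < j" using j by simp
      have nd: "\<not> n dvd j - p" using small_dvd[of "j - p"] pj j by auto
      have "\<exists>i<p. A i j"
      proof (rule surj_central[OF pj j(2)])
        fix i k assume ik: "A i k" "i < j" "j < k"
        have "allowed (Arc i k) (Cen j g)" using al[of "Arc i k" m] ik x m(1) by auto
        then obtain z where z: "n dvd z" "i < p + z" "p + z < j" using nd by auto
        have "k - i < n" using L.A_len[OF ik(1)] K by simp
        with z(1) show "i < p" using z ik j pj by (cases rule: dvd_cases) auto
      next
        fix c assume c: "C c (\<not> g)" "p \<le> c" "c < p + n"
        show "j \<le> c"
        proof (cases "n dvd c - j")
          case True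
          then show ?thesis using small_dvd[of "c - j"] c j by auto
        next
          case False
          then have "allowed (Cen c (\<not> g)) (Cen j g)" using al[of "Cen c (\<not> g)" m] c x m(1) by auto
          then show ?thesis using c j by simp
        qed
      next
        show "(\<exists>i k. A i k \<and> i < j \<and> j < k) \<or> (\<exists>c. C c (\<not> g) \<and> j < c \<and> c < p + n)"
        proof (cases t)
          case (Arc i k) then show ?thesis using t by auto
        next
          case tc: (Cen c b)
          have cb: "\<not> n dvd c - j" "b = (\<not> g)" using t(2) tc by auto
          have "allowed (Cen c b) (Cen j g)" using al[of "Cen c b" m] t tc x m(1) by auto
          then have lt: "j - p < (c - p) mod n" using j by simp
          obtain z where z: "n dvd z" "c + z = p + (c - p) mod n" using rep by blast
          have "C (c + z) (\<not> g)" using L.C_shift[of c b z] z(1) t tc cb by auto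
          then show ?thesis using z lt mod_bounds[of "c - p"] by (intro disjI2 exI[of _ "c + z"]) auto
        qed
      qed
      then obtain i where "i < p" "A i j" by blast
      then show ?thesis using x m(1) pj by (intro exI[of _ m] exI[of _ "Arc i j"]) auto
    qed
  next
    case (Arc a b)
    have pb: "n dvd p - b" using al[OF t0(1) dvd_0_right] t0(2) Arc by (cases t0) (auto simp: dvd_diff_commute)
    define m where "m = p - b"
    define q where "q = a + m"
    have m: "n dvd m" using pb by (simp add: m_def)
    have x: "shift m x = Arc q p" using Arc by (simp add: q_def m_def)
    have q: "p - n < q" "q < p" using arc_short[of a b] v Arc by (auto simp: q_def m_def)
    have "(\<exists>k>p. A q k) \<or> C q (\<not> g)"
    proof (rule surj_arc[OF q])
      show False if "A i k" "i < q" "q < k" "k < p" for i k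
        using al[of "Arc i k" m] that x m by auto
      show False if "C c g" "q < c" "c < p" for c
        using al[of "Cen c g" m] that x m by auto
      obtain t where t: "L.mem t" "crs t (Arc q p)" using ex[OF m] x by auto
      have alt: "allowed t (Arc q p)" using al[OF t(1) m] t(2) x by simp
      show "(\<exists>i k. A i k \<and> q < i \<and> i < p \<and> p < k) \<or> (\<exists>c. C c (\<not> g) \<and> q < c \<and> c < p)"
      proof (cases t)
        case (Arc i k)
        then have "q < i \<and> i < p \<and> p < k" using t alt by auto
        then show ?thesis using t Arc by auto
      next
        case (Cen c b')
        then have "b' = (\<not> g)" "q < c" "c < p" using t alt by auto
        then show ?thesis using t Cen by auto
      qed
    qed
    then show ?thesis
    proof (elim disjE exE conjE)
      fix k assume "p < k" "A q k"
      then show ?thesis using x m q by (intro exI[of _ m] exI[of _ "Arc q k"]) auto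
    next
      assume "C q (\<not> g)"
      then show ?thesis using x m q by (intro exI[of _ m] exI[of _ "Cen q (\<not> g)"]) auto
    qed
  qed
qed

end

lemma (in central_projection) lift_projection: "lift_projection n K (Cen p g) F bl"
proof unfold_locales
  show "valid (Cen p g)" unfolding valid.simps by (fact K)
next
  fix A C x
  assume L: "lifted n K A C" and x: "valid x" "\<not> (case x of Arc i j \<Rightarrow> A i j | Cen p a \<Rightarrow> C p a)"
    "\<forall>i j. A i j \<longrightarrow> \<not> bl (Arc i j) x" "\<forall>p a. C p a \<longrightarrow> \<not> bl (Cen p a) x"
  interpret lifted_central_projection n K p g A C
    by (intro lifted_central_projection.intro lifted_cover.intro central_projection_axioms cover_axioms L)
  have "\<not> bl t x" if "L.mem t" for t using x(3,4) that by (cases t) auto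
  then obtain m t where "n dvd m" "L.mem t" "F t (shift m x)" using surj[OF x(1)] x(2) unfolding L.mem_def by blast
  then show "\<exists>m. n dvd m \<and> ((\<exists>i j. A i j \<and> F (Arc i j) (shift m x)) \<or> (\<exists>p a. C p a \<and> F (Cen p a) (shift m x)))"
    by (cases t) (metis L.mem_simps)+
qed (rule F_crs F_ncrs blD(1) bl_shift blI bl_F_lift bl_F_crs F_F_lift F_unique_lift; assumption)+

theorem (in cover) non_leaving_cover: "non_leaving cro orbits"
proof (rule non_leavingI)
  fix d assume "d \<in> orbits"
  then obtain x where x: "d = orb x" "valid x" by (auto simp: orbits_def)
  show "\<exists>f. collapsing cro orbits d f"
  proof (cases x)
    case (Arc u v)
    then interpret arc_projection n K u v using x by unfold_locales simp
    show ?thesis using lift_projection.collapsing_exists[OF lift_projection] x Arc by simp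
  next
    case (Cen p g)
    have "\<not> K" using x Cen by simp
    then interpret central_projection n K p g by unfold_locales
    show ?thesis using lift_projection.collapsing_exists[OF lift_projection] x Cen by simp
  qed
qed

section \<open>Convex polygons\<close>

text \<open>Twice the signed area of the triangle, positive for counterclockwise corners.\<close>

definition orient :: "complex \<Rightarrow> complex \<Rightarrow> complex \<Rightarrow> real" where
  "orient a b c = Im (cnj (b - a) * (c - a))"

lemma orient_altdef: "orient a b c = (Re b - Re a) * (Im c - Im a) - (Im b - Im a) * (Re c - Re a)"
  by (simp add: orient_def algebra_simps)

lemma orient_rotate: "orient a b c = orient b c a"
  by (simp add: orient_altdef algebra_simps)

lemma orient_swap: "orient a c b = - orient a b c"
  by (simp add: orient_altdef algebra_simps)

lemma orient_simps [simp]: "orient a a c = 0" "orient a b a = 0" "orient a b b = 0"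
  by (simp_all add: orient_altdef)

lemma orient_affine: "orient a b ((1 - s) *\<^sub>R p + s *\<^sub>R q) = (1 - s) * orient a b p + s * orient a b q"
  by (simp add: orient_altdef algebra_simps)

lemma orient_eq_0:
  assumes "orient a b z = 0" "a \<noteq> b"
  shows "\<exists>t. z = (1 - t) *\<^sub>R a + t *\<^sub>R b"
proof -
  define w where "w = (z - a) / (b - a)"
  have "cnj (b - a) * (z - a) = w * (cnj (b - a) * (b - a))" using assms(2) by (simp add: w_def)
  also have "cnj (b - a) * (b - a) = of_real ((cmod (b - a))\<^sup>2)"
    using complex_norm_square[of "b - a"] by (simp add: mult.commute)
  finally have "Im w * (cmod (b - a))\<^sup>2 = 0" using assms(1) by (simp add: orient_def)
  moreover have "(cmod (b - a))\<^sup>2 \<noteq> 0" using assms(2) by simp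
  ultimately have "Im w = 0" by (metis mult_eq_0_iff)
  then have "w = of_real (Re w)" by (simp add: complex_eq_iff)
  then obtain t where "w = of_real t" by blast
  moreover have "z = a + w * (b - a)" using assms(2) by (simp add: w_def)
  ultimately have "z = (1 - t) *\<^sub>R a + t *\<^sub>R b" by (simp add: scaleR_conv_of_real algebra_simps)
  then show ?thesis by blast
qed

lemma in_open_segment_iff: "x \<in> open_segment a b \<longleftrightarrow> a \<noteq> b \<and> (\<exists>u. 0 < u \<and> u < 1 \<and> x = (1 - u) *\<^sub>R a + u *\<^sub>R b)"
  by (simp add: in_segment)

lemma orient_open_segment:
  assumes "z \<in> open_segment p q"
  obtains s where "0 < s" "s < 1" "\<And>a b. orient a b z = (1 - s) * orient a b p + s * orient a b q"
  using assms orient_affine unfolding in_open_segment_iff by metis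

text \<open>At a common point, a proper weighted mean of two values of the same sign, not both zero,
  would vanish. The factor \<open>e\<close> selects the side.\<close>

lemma disjoint_same_side:
  assumes "0 \<le> e * orient a b p" "0 \<le> e * orient a b q" "orient a b p \<noteq> 0 \<or> orient a b q \<noteq> 0" "e \<noteq> 0"
  shows "open_segment a b \<inter> open_segment p q = {}"
proof (rule ccontr)
  assume "\<not> ?thesis"
  then obtain z where z: "z \<in> open_segment a b" "z \<in> open_segment p q" by blast
  obtain s where s: "0 < s" "s < 1" "\<And>a b. orient a b z = (1 - s) * orient a b p + s * orient a b q"
    using orient_open_segment[OF z(2)] by metis
  obtain s' where "\<And>c d. orient c d z = (1 - s') * orient c d a + s' * orient c d b"
    using orient_open_segment[OF z(1)] by metis
  then have "orient a b z = 0" by simp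
  then have "(1 - s) * (e * orient a b p) + s * (e * orient a b q) = 0" using s(3)[of a b]
    by (metis distrib_left mult.left_commute mult_zero_right)
  moreover have "0 \<le> (1 - s) * (e * orient a b p)" "0 \<le> s * (e * orient a b q)" using s assms by simp_all
  ultimately have "(1 - s) * (e * orient a b p) = 0" "s * (e * orient a b q) = 0" by linarith+
  then show False using s(1,2) assms(3,4) by simp
qed

lemma opposite_sides_zero:
  assumes "orient a b p < 0" "0 < orient a b q"
  obtains z where "z \<in> open_segment p q" "orient a b z = 0"
proof -
  define s where "s = orient a b p / (orient a b p - orient a b q)"
  have s: "0 < s" "s < 1" using assms by (simp_all add: s_def divide_simps)
  have "(1 - s) * orient a b p + s * orient a b q = 0" using assms by (simp add: s_def field_simps)
  moreover have "p \<noteq> q" using assms by auto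
  ultimately show thesis using that[of "(1 - s) *\<^sub>R p + s *\<^sub>R q"] s orient_affine in_open_segment_iff by metis
qed

lemma extreme_not_between: "a extreme_point_of S \<Longrightarrow> x \<in> S \<Longrightarrow> y \<in> S \<Longrightarrow> a \<notin> open_segment x y"
  by (simp add: extreme_point_of_def)

text \<open>A point of \<open>S\<close> on the line but beyond \<open>a\<close> or \<open>b\<close>
  would put that extreme point strictly between two points of \<open>S\<close>.\<close>

lemma line_in_segment:
  assumes z: "orient a b z = 0" "z \<in> S" and ab: "a extreme_point_of S" "b extreme_point_of S" "a \<noteq> b"
  shows "z \<in> closed_segment a b"
proof -
  obtain t where t: "z = (1 - t) *\<^sub>R a + t *\<^sub>R b" using orient_eq_0[OF z(1) ab(3)] by blast
  have S: "a \<in> S" "b \<in> S" using ab by (auto simp: extreme_point_of_def)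
  have "0 \<le> t"
  proof (rule ccontr)
    assume "\<not> 0 \<le> t"
    then have t0: "t < 0" by simp
    \<comment> \<open>Solves \<open>(1 - u) * z + u * b = a\<close> for a point \<open>z\<close> on
      the far side of \<open>a\<close>.\<close>
    define u where "u = - t / (1 - t)"
    have u: "0 < u" "u < 1" using t0 by (simp_all add: u_def field_simps)
    have "(1 - t) * (1 - u) = 1" "t * (1 - u) + u = 0" using t0 by (simp_all add: u_def field_simps)
    then have "(1 - u) *\<^sub>R z + u *\<^sub>R b = a"
      unfolding t by (simp add: scaleR_add_right algebra_simps flip: scaleR_add_left)
    moreover have "z \<noteq> b"
    proof
      assume "z = b"
      then have "(1 - t) *\<^sub>R (a - b) = 0" using t by (simp add: algebra_simps)
      then show False using t0 ab(3) by simp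
    qed
    ultimately have "a \<in> open_segment z b" unfolding in_open_segment_iff using u by metis
    then show False using extreme_not_between[OF ab(1) z(2) S(2)] by blast
  qed
  moreover have "t \<le> 1"
  proof (rule ccontr)
    assume "\<not> t \<le> 1"
    then have t1: "t > 1" by simp
    define u where "u = 1 / t"
    have u: "0 < u" "u < 1" using t1 by (simp_all add: u_def)
    have "u * t = 1" using t1 by (simp add: u_def)
    then have "(1 - u) *\<^sub>R a + u *\<^sub>R z = b"
      unfolding t by (simp add: scaleR_add_right algebra_simps)
    moreover have "z \<noteq> a"
    proof
      assume "z = a"
      then have "t *\<^sub>R (b - a) = 0" using t by (simp add: algebra_simps)
      then show False using t1 ab(3) by simp
    qed
    ultimately have "b \<in> open_segment a z" unfolding in_open_segment_iff using u by metis
    then show False using extreme_not_between[OF ab(2) S(1) z(2)] by blast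
  qed
  ultimately show ?thesis unfolding t by (auto simp: in_segment)
qed

text \<open>Extremality of \<open>a\<close> and \<open>b\<close> stands in for the second separation
  condition: the point of \<open>p\<close>, \<open>q\<close> on the line lies in \<open>S\<close>,
  hence between \<open>a\<close> and \<open>b\<close>.\<close>

lemma opposite_sides_meet:
  assumes ab: "a extreme_point_of S" "b extreme_point_of S" and S: "convex S" "p \<in> S" "q \<in> S"
    and o: "orient a b p < 0" "0 < orient a b q"
  shows "open_segment a b \<inter> open_segment p q \<noteq> {}"
proof -
  have ne: "a \<noteq> b" using o by auto
  obtain z where z: "z \<in> open_segment p q" "orient a b z = 0" using opposite_sides_zero[OF o] by blast
  have "z \<in> S" using z(1) S closed_segment_subset[OF S(2,3,1)] open_closed_segment by blast
  then have "z \<in> closed_segment a b" using line_in_segment[OF z(2) _ ab ne] by blast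
  moreover have "z \<noteq> a" "z \<noteq> b" using z(1) extreme_not_between ab S by metis+
  ultimately have "z \<in> open_segment a b" by (simp add: open_segment_def)
  then show ?thesis using z(1) by blast
qed

lemma opposite_signs_weight:
  fixes x y t :: real
  assumes xy: "x * y < 0" and e: "(1 - t) * x + t * y = 0"
  shows "0 < t \<and> t < 1"
proof -
  have ne: "0 < x * x" "0 < y * y" using xy by (auto simp: zero_less_mult_iff mult_less_0_iff)
  have 1: "(1 - t) * (x * x) = - t * (x * y)" and 2: "(1 - t) * (x * y) = - t * (y * y)"
    using arg_cong[OF e, of "\<lambda>z. z * x"] arg_cong[OF e, of "\<lambda>z. z * y"] by (simp_all add: algebra_simps)
  have "0 < t"
  proof (rule ccontr)
    assume "\<not> 0 < t"
    then have "0 < (1 - t) * (x * x)" "- t * (x * y) \<le> 0" using ne xy by (simp_all add: mult_nonpos_nonpos)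
    then show False using 1 by simp
  qed
  moreover have "t < 1"
  proof (rule ccontr)
    assume "\<not> t < 1"
    then have "0 \<le> (1 - t) * (x * y)" "- t * (y * y) < 0" using ne xy
      by (simp_all add: mult_nonpos_nonpos)
    then show False using 2 by simp
  qed
  ultimately show ?thesis ..
qed

text \<open>The version for segments whose ends need not be extreme, such as points of tangency:
  each segment has to be separated by the line of the other.\<close>

lemma mutual_sides_meet:
  assumes "orient a b p < 0" "0 < orient a b q" "orient p q a * orient p q b < 0"
  shows "open_segment a b \<inter> open_segment p q \<noteq> {}"
proof -
  have ne: "a \<noteq> b" using assms by auto
  obtain z where z: "z \<in> open_segment p q" "orient a b z = 0" using opposite_sides_zero[OF assms(1,2)] by blast
  obtain t where t: "z = (1 - t) *\<^sub>R a + t *\<^sub>R b" using orient_eq_0[OF z(2) ne] by blast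
  obtain s where "\<And>c d. orient c d z = (1 - s) * orient c d p + s * orient c d q"
    using orient_open_segment[OF z(1)] by metis
  then have "orient p q z = 0" by simp
  then have e: "(1 - t) * orient p q a + t * orient p q b = 0" using t orient_affine by metis
  have "0 < t \<and> t < 1" using opposite_signs_weight[OF assms(3) e] .
  then have "z \<in> open_segment a b" unfolding in_open_segment_iff using t ne by blast
  then show ?thesis using z(1) by blast
qed

lemma crossing_segment:
  "crossing (closed_segment a b) (closed_segment p q) \<longleftrightarrow>
     {a, b} \<noteq> {p, q} \<and> rel_interior (closed_segment a b) \<inter> rel_interior (closed_segment p q) \<noteq> {}"
  unfolding crossing_def closed_segment_eq by blast

lemma rel_interior_segment: "a \<noteq> b \<Longrightarrow> rel_interior (closed_segment a b) = open_segment a b" for a b :: complex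
  by (simp add: rel_interior_closed_segment)

lemma periodic_multiple:
  fixes f :: "int \<Rightarrow> 'a"
  assumes per: "\<And>k. f (k + N) = f k" and "N dvd m"
  shows "f (k + m) = f k"
proof -
  have *: "f (k + N * int z) = f k" for k z
  proof (induction z)
    case (Suc z)
    have "f (k + N * int (Suc z)) = f ((k + N * int z) + N)" by (simp add: algebra_simps)
    then show ?case using Suc per by simp
  qed simp
  obtain z where z: "m = N * z" using assms(2) by blast
  show ?thesis
  proof (cases "0 \<le> z")
    case True then show ?thesis using *[of k "nat z"] z by simp
  next
    case False
    then show ?thesis using *[of "k + m" "nat (- z)"] z by simp
  qed
qed

section \<open>Convex polygons as periodic counterclockwise sequences of vertices\<close>

locale cyclic_polygon =
  fixes N :: int and P :: "int \<Rightarrow> complex" and Q :: "complex set"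
  assumes N: "3 \<le> N"
    and periodic: "P (k + N) = P k"
    and ccw: "\<lbrakk>i < j; j < k; k < i + N\<rbrakk> \<Longrightarrow> 0 < orient (P i) (P j) (P k)"
    and Q: "convex Q"
    and vertices: "vertices Q = range P"
    and hull: "Q = convex hull (range P)"
begin

lemma P_add_multiple: "N dvd m \<Longrightarrow> P (k + m) = P k"
  by (rule periodic_multiple[of P N, OF periodic])

lemma representative: "\<exists>m. N dvd m \<and> c \<le> k + m \<and> k + m < c + N"
proof -
  have "k + - (N * ((k - c) div N)) = c + (k - c) mod N"
    by (simp add: minus_mult_div_eq_mod [symmetric])
  then show ?thesis using N by (intro exI[of _ "- (N * ((k - c) div N))"]) auto
qed

lemma extreme: "P k extreme_point_of Q"
  using vertices unfolding vertices_def by blast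

lemma P_in: "P k \<in> Q"
  using extreme by (auto simp: extreme_point_of_def)

lemma P_neq: "i < j \<Longrightarrow> j < i + N \<Longrightarrow> P i \<noteq> P j"
proof
  assume h: "i < j" "j < i + N" "P i = P j"
  show False
  proof (cases "j + 1 < i + N")
    case True
    then show False using ccw[of i j "j + 1"] h by simp
  next
    case False
    then show False using ccw[of i "i + 1" j] h N by simp
  qed
qed

lemma P_eq_iff: "P i = P j \<longleftrightarrow> N dvd i - j"
proof
  assume e: "P i = P j"
  obtain m where m: "N dvd m" "j \<le> i + m" "i + m < j + N" using representative by blast
  have "P (i + m) = P j" using e P_add_multiple[OF m(1)] by simp
  then have "i + m = j" using P_neq[of j "i + m"] m by (metis order_le_less)
  then have "i - j = - m" by simp
  then show "N dvd i - j" using m(1) by simp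
next
  assume "N dvd i - j"
  then show "P i = P j" using P_add_multiple[of "i - j" j] by simp
qed

lemma orient_right: "i < k \<Longrightarrow> k < j \<Longrightarrow> j < i + N \<Longrightarrow> orient (P i) (P j) (P k) < 0"
  using ccw[of i k j] orient_swap[of "P i" "P j" "P k"] by simp

lemma orient_nonneg:
  assumes "i < j" "j \<le> k" "k \<le> i + N"
  shows "0 \<le> orient (P i) (P j) (P k)"
proof -
  consider "k = j" | "k = i + N" | "j < k" "k < i + N" using assms by linarith
  then show ?thesis using assms ccw[of i j k] periodic[of i] by cases auto
qed

lemma orient_nonpos:
  assumes "i < j" "i \<le> k" "k \<le> j" "j < i + N"
  shows "orient (P i) (P j) (P k) \<le> 0"
proof -
  consider "k = j" | "k = i" | "i < k" "k < j" using assms by linarith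
  then show ?thesis using assms orient_right[of i k j] by cases auto
qed

definition seg :: "int \<Rightarrow> int \<Rightarrow> chord" where
  "seg i j = closed_segment (P i) (P j)"

lemma seg_sym: "seg i j = seg j i"
  by (simp add: seg_def closed_segment_commute)

lemma seg_shift: "N dvd m \<Longrightarrow> seg (i + m) (j + m) = seg i j"
  by (simp add: seg_def P_add_multiple)

lemma crossing_segI:
  assumes "i < k" "k < j" "j < l" "l < i + N"
  shows "crossing (seg i j) (seg k l)"
proof -
  have "open_segment (P i) (P j) \<inter> open_segment (P k) (P l) \<noteq> {}"
    by (rule opposite_sides_meet[OF extreme extreme Q P_in P_in orient_right ccw]) (use assms in auto)
  moreover have "P i \<noteq> P j" "P k \<noteq> P l" "P i \<noteq> P k" "P i \<noteq> P l" using P_neq assms by auto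
  ultimately show ?thesis unfolding seg_def crossing_segment
    by (auto simp: rel_interior_segment doubleton_eq_iff)
qed

text \<open>Two degenerate cases go beyond \<open>disjoint_same_side\<close>: a segment that is a
  single vertex, which is not between other points, and a segment on the line, which is then the
  same segment.\<close>

lemma no_crossing_same_side:
  assumes "i < j" "j < i + N" "\<And>k. k \<in> {k1, k2} \<Longrightarrow> 0 \<le> e * orient (P i) (P j) (P k)" "e \<noteq> 0"
  shows "\<not> crossing (seg i j) (seg k1 k2)"
proof
  assume c: "crossing (seg i j) (seg k1 k2)"
  have ne: "P i \<noteq> P j" using P_neq assms by auto
  have on: "z = P i \<or> z = P j" if "orient (P i) (P j) z = 0" "z extreme_point_of Q" for z
  proof -
    have "z \<in> closed_segment (P i) (P j)"
      using line_in_segment[OF that(1) _ extreme extreme ne] that(2) by (auto simp: extreme_point_of_def)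
    then show ?thesis using extreme_not_between[OF that(2) P_in P_in, of i j] by (auto simp: open_segment_def)
  qed
  show False
  proof (cases "P k1 = P k2")
    case True
    then have "P k1 \<in> open_segment (P i) (P j)"
      using c ne unfolding seg_def crossing_segment by (auto simp: rel_interior_segment)
    then show False using extreme_not_between[OF extreme P_in P_in] by blast
  next
    case False
    show False
    proof (cases "orient (P i) (P j) (P k1) = 0 \<and> orient (P i) (P j) (P k2) = 0")
      case True
      then have "{P i, P j} = {P k1, P k2}"
        using on[of "P k1"] on[of "P k2"] extreme False by auto
      then show False using c unfolding seg_def crossing_segment by blast
    next
      case F: False
      have "open_segment (P i) (P j) \<inter> open_segment (P k1) (P k2) = {}"
        by (rule disjoint_same_side[of e]) (use assms F in auto)
      then show False using c ne False unfolding seg_def crossing_segment by (simp add: rel_interior_segment)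
    qed
  qed
qed

text \<open>The second segment is moved so that \<open>k\<close> falls into the period starting at
  \<open>i\<close>. Unless the ends interlace, both of its ends, possibly after moving
  \<open>l\<close> back by \<open>N\<close>, lie on one closed side of the first segment.\<close>

lemma crossing_segD:
  assumes ij: "i < j" "j < i + N" and kl: "k < l" "l < k + N" and c: "crossing (seg i j) (seg k l)"
  shows "\<exists>m. N dvd m \<and> (i < k + m \<and> k + m < j \<and> j < l + m \<or> k + m < i \<and> i < l + m \<and> l + m < j)"
proof -
  obtain m where m: "N dvd m" "i \<le> k + m" "k + m < i + N" using representative by blast
  have c': "crossing (seg i j) (seg (k + m) (l + m))" using c seg_shift[OF m(1)] by simp
  have c'': "crossing (seg i j) (seg (k + m) (l + m - N))" using c' P_add_multiple[of "- N" "l + m"] by (simp add: seg_def)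
  define k' l' where "k' = k + m" and "l' = l + m"
  have kl': "i \<le> k'" "k' < i + N" "k' < l'" "l' < k' + N" using m kl by (auto simp: k'_def l'_def)
  have pos: "\<not> crossing (seg i j) (seg a b)" if "j \<le> a" "a \<le> i + N" "j \<le> b" "b \<le> i + N" for a b
    by (rule no_crossing_same_side[where e = 1]) (use that ij orient_nonneg in auto)
  have neg: "\<not> crossing (seg i j) (seg a b)" if "i \<le> a" "a \<le> j" "i \<le> b" "b \<le> j" for a b
    by (rule no_crossing_same_side[where e = "- 1"]) (use that ij orient_nonpos in auto)
  have end1: "\<not> crossing (seg i j) (seg i b)" if "i < b" "b < i + N" for b
    using pos[of "i + N" b] neg[of i b] that ij periodic[of i] by (cases "b \<le> j") (auto simp: seg_def)
  \<comment> \<open>The first two positions interlace; in the others the segments do not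
    cross.\<close>
  consider "i < k'" "k' < j" "j < l'" "l' < i + N" | "j < k'" "i + N < l'" "l' < j + N"
    | "i < k'" "k' \<le> j" "l' \<le> j" | "k' = i" | "i < k'" "k' \<le> j" "l' = i + N" | "i < k'" "k' \<le> j" "i + N < l'"
    | "k' = j" "l' < i + N" | "j < k'" "l' \<le> i + N" | "j < k'" "j + N \<le> l'"
    using kl' by (smt (verit))
  then show ?thesis
  proof cases
    case 1 then show ?thesis using m(1) by (intro exI[of _ m]) (auto simp: k'_def l'_def)
  next
    case 2
    have "N dvd m - N" using m(1) by simp
    then show ?thesis using 2 kl' by (intro exI[of _ "m - N"]) (auto simp: k'_def l'_def)
  next
    case 3 then show ?thesis using neg[of k' l'] c' kl' by (auto simp: k'_def l'_def)
  next
    case 4 then show ?thesis using end1[of l'] c' kl' by (auto simp: k'_def l'_def)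
  next
    case 5
    then have "crossing (seg i j) (seg k' i)" using c'' by (auto simp: k'_def l'_def)
    then show ?thesis using end1[of k'] 5 kl' ij by (simp add: seg_sym)
  next
    case 6 then show ?thesis using neg[of k' "l' - N"] c'' kl' by (auto simp: k'_def l'_def)
  next
    case 7 then show ?thesis using pos[of k' l'] c' kl' by (auto simp: k'_def l'_def)
  next
    case 8 then show ?thesis using pos[of k' l'] c' kl' ij by (auto simp: k'_def l'_def)
  next
    case 9 then show ?thesis using pos[of k' "l' - N"] c'' kl' by (auto simp: k'_def l'_def)
  qed
qed

lemma Q_side:
  assumes "\<And>k. 0 \<le> orient a b (P k)" "z \<in> Q"
  shows "0 \<le> orient a b z"
proof -
  have "convex {z. 0 \<le> orient a b z}"
    by (rule convexI) (metis (mono_tags, lifting) add_nonneg_nonneg mem_Collect_eq mult_nonneg_nonneg orient_affine add_diff_cancel_right')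
  then have "Q \<subseteq> {z. 0 \<le> orient a b z}" unfolding hull using assms(1) by (intro hull_minimal) auto
  then show ?thesis using assms(2) by blast
qed

lemma edge_adjacent: "seg i (i + 1) edge_of Q"
proof -
  have ne: "P i \<noteq> P (i + 1)" using P_neq N by auto
  have nn: "0 \<le> orient (P i) (P (i + 1)) (P k)" for k
  proof -
    obtain m where m: "N dvd m" "i + 1 \<le> k + m" "k + m < i + 1 + N" using representative by blast
    then show ?thesis using orient_nonneg[of i "i + 1" "k + m"] P_add_multiple[OF m(1), of k] by simp
  qed
  have "Q \<inter> {z. orient (P i) (P (i + 1)) z = 0} = seg i (i + 1)"
  proof
    show "Q \<inter> {z. orient (P i) (P (i + 1)) z = 0} \<subseteq> seg i (i + 1)"
      using line_in_segment[OF _ _ extreme extreme ne] unfolding seg_def by blast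
    show "seg i (i + 1) \<subseteq> Q \<inter> {z. orient (P i) (P (i + 1)) z = 0}"
      using closed_segment_subset[OF P_in P_in Q] orient_affine unfolding seg_def
      by (auto simp: in_segment)
  qed
  moreover have "(Q \<inter> {z. orient (P i) (P (i + 1)) z = 0}) face_of Q"
  proof -
    \<comment> \<open>The outer normal of the edge: its direction turned clockwise.\<close>
    define w where "w = - \<i> * (P (i + 1) - P i)"
    have w: "orient (P i) (P (i + 1)) z = - (w \<bullet> z) + w \<bullet> P i" for z
      by (simp add: w_def orient_altdef inner_complex_def algebra_simps)
    have "(Q \<inter> {z. w \<bullet> z = w \<bullet> P i}) face_of Q"
      by (rule face_of_Int_supporting_hyperplane_le[OF Q]) (use Q_side[OF nn] w in force)
    moreover have "{z. orient (P i) (P (i + 1)) z = 0} = {z. w \<bullet> z = w \<bullet> P i}" using w by auto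
    ultimately show ?thesis by simp
  qed
  ultimately have "seg i (i + 1) face_of Q" by simp
  moreover have "aff_dim (seg i (i + 1)) = 1"
    using ne by (simp add: seg_def segment_convex_hull aff_dim_convex_hull aff_dim_2)
  ultimately show ?thesis by (simp add: edge_of_def)
qed

text \<open>The segment from \<open>P (i + 1)\<close> to \<open>P (j + 1)\<close> meets the interior
  of this one. If this one were a face it would contain \<open>P (i + 1)\<close>, which is off its
  line.\<close>

lemma not_edge:
  assumes "2 \<le> j - i" "j - i \<le> N - 2"
  shows "\<not> seg i j edge_of Q"
proof
  assume "seg i j edge_of Q"
  then have f: "seg i j face_of Q" by (simp add: edge_of_def)
  have o: "orient (P i) (P j) (P (i + 1)) < 0" "0 < orient (P i) (P j) (P (j + 1))"
    using orient_right[of i "i + 1" j] ccw[of i j "j + 1"] assms by auto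
  then obtain z where z: "z \<in> open_segment (P i) (P j)" "z \<in> open_segment (P (i + 1)) (P (j + 1))"
    using opposite_sides_meet[OF extreme extreme Q P_in P_in o] by blast
  have "P (i + 1) \<in> seg i j"
    using f z P_in open_closed_segment[OF z(1)] unfolding seg_def face_of_def by blast
  then have "orient (P i) (P j) (P (i + 1)) = 0"
    using orient_affine unfolding seg_def in_segment by (metis orient_simps(2,3) add.right_neutral mult_zero_right)
  then show False using o by simp
qed

lemma diagonals_eq: "diagonals Q = {seg i j | i j. 2 \<le> j - i \<and> j - i \<le> N - 2}"
proof (intro equalityI subsetI)
  fix s assume "s \<in> diagonals Q"
  then obtain i j0 where ij: "s = seg i j0" "P i \<noteq> P j0" "\<not> seg i j0 edge_of Q"
    unfolding diagonals_def vertices seg_def by blast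
  obtain m where m: "N dvd m" "i \<le> j0 + m" "j0 + m < i + N" using representative by blast
  define j where "j = j0 + m"
  have s: "s = seg i j" using ij(1) P_add_multiple[OF m(1), of j0] by (simp add: seg_def j_def)
  have "P i \<noteq> P j" using ij(2) P_add_multiple[OF m(1), of j0] by (simp add: j_def)
  then have "j \<noteq> i" by auto
  moreover have "j \<noteq> i + 1" using ij s edge_adjacent by metis
  moreover have "j \<noteq> i + N - 1"
  proof
    assume "j = i + N - 1"
    then have "seg i j = seg j (j + 1)" using periodic[of i] by (simp add: seg_def closed_segment_commute algebra_simps)
    then show False using ij s edge_adjacent by metis
  qed
  ultimately show "s \<in> {seg i j | i j. 2 \<le> j - i \<and> j - i \<le> N - 2}"
    using s m by (intro CollectI exI[of _ i] exI[of _ j]) (auto simp: j_def)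
next
  fix s assume "s \<in> {seg i j | i j. 2 \<le> j - i \<and> j - i \<le> N - 2}"
  then obtain i j where ij: "s = seg i j" "2 \<le> j - i" "j - i \<le> N - 2" by blast
  have "P i \<noteq> P j" using P_neq[of i j] ij by auto
  then show "s \<in> diagonals Q" using not_edge[OF ij(2,3)] ij(1) unfolding diagonals_def vertices seg_def by blast
qed

lemma seg_eq_iff: "seg i j = seg k l \<longleftrightarrow> N dvd i - k \<and> N dvd j - l \<or> N dvd i - l \<and> N dvd j - k"
  unfolding seg_def closed_segment_eq doubleton_eq_iff P_eq_iff ..

end

section \<open>Enumerating the vertices of a convex polygon\<close>

lemma orient_key:
  fixes u w :: complex
  defines "f \<equiv> \<lambda>z. Re (cnj w * (z - u))" and "h \<equiv> \<lambda>z. Im (cnj w * (z - u))"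
  shows "(cmod w)\<^sup>2 * orient u a b = f a * h b - h a * f b"
  unfolding f_def h_def orient_altdef cmod_power2 by (simp add: algebra_simps power2_eq_square)

lemma convex_polygon_vertices:
  assumes "convex_polygon Q"
  shows "finite (vertices Q)" "convex Q" "Q = convex hull (vertices Q)" "3 \<le> card (vertices Q)"
proof -
  have p: "polytope Q" "aff_dim Q = 2" using assms by (auto simp: convex_polygon_def)
  show fin: "finite (vertices Q)" unfolding vertices_def
    using finite_polyhedron_extreme_points[OF polytope_imp_polyhedron[OF p(1)]] .
  show cv: "convex Q" using polytope_imp_convex[OF p(1)] .
  show hull: "Q = convex hull (vertices Q)"
    unfolding vertices_def using Krein_Milman_Minkowski[OF polytope_imp_compact[OF p(1)] cv] .
  have "aff_dim (vertices Q) = 2" using p(2) hull aff_dim_convex_hull by metis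
  then show "3 \<le> card (vertices Q)" using aff_dim_le_card[OF fin] by simp
qed

lemma strict_key_enumeration:
  fixes key :: "'a \<Rightarrow> real"
  assumes "finite W" "inj_on key W"
  shows "\<exists>e. bij_betw e {..<card W} W \<and> (\<forall>i j. i < j \<longrightarrow> j < card W \<longrightarrow> key (e i) < key (e j))"
proof -
  define L where "L = sorted_list_of_set (key ` W)"
  define e where "e i = the_inv_into W key (L ! i)" for i
  have len: "length L = card W" using assms by (simp add: L_def card_image)
  have setL: "set L = key ` W" using assms by (simp add: L_def)
  have key: "e i \<in> W" "key (e i) = L ! i" if "i < card W" for i
  proof -
    have "L ! i \<in> key ` W" using that len setL nth_mem by metis
    then show "e i \<in> W" "key (e i) = L ! i"
      using assms(2) unfolding e_def by (simp_all add: the_inv_into_into f_the_inv_into_f)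
  qed
  have "sorted_wrt (<) L" unfolding L_def by (rule strict_sorted_list_of_set)
  then have mono: "key (e i) < key (e j)" if "i < j" "j < card W" for i j
    using that key[of i] key[of j] len by (simp add: sorted_wrt_iff_nth_less)
  have "inj_on e {..<card W}"
    by (rule inj_onI) (metis lessThan_iff mono not_less_iff_gr_or_eq)
  moreover have "e ` {..<card W} \<subseteq> W" using key by auto
  ultimately have "bij_betw e {..<card W} W"
    using assms(1) by (simp add: bij_betw_def card_image card_subset_eq)
  then show ?thesis using mono by blast
qed

text \<open>Let \<open>u\<close> be a vertex farthest from the origin and \<open>w\<close> the
  direction from it to the origin. All other vertices satisfy \<open>f > 0\<close>, so their slopes
  \<open>h / f\<close> as seen from \<open>u\<close> order them counterclockwise. Distinct vertices
  have distinct slopes because they are extreme.\<close>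

lemma convex_polygon_cyclic:
  assumes "convex_polygon Q"
  shows "\<exists>N P. cyclic_polygon N P Q"
proof -
  note V = convex_polygon_vertices[OF assms]
  let ?V = "vertices Q"
  have ext: "z extreme_point_of Q" if "z \<in> ?V" for z using that by (simp add: vertices_def)
  have inQ: "z \<in> Q" if "z \<in> ?V" for z using ext[OF that] by (simp add: extreme_point_of_def)
  have "?V \<noteq> {}" using V(4) by auto
  then have "Max (norm ` ?V) \<in> norm ` ?V" using V(1) by simp
  then obtain u where u0: "u \<in> ?V" "norm u = Max (norm ` ?V)" by auto
  have "norm z \<le> norm u" if "z \<in> ?V" for z using u0(2) that V(1) by simp
  note u = u0(1) this
  define w where "w = - u"
  define f where "f z = Re (cnj w * (z - u))" for z
  define h where "h z = Im (cnj w * (z - u))" for z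
  have w: "w \<noteq> 0"
  proof
    assume "w = 0"
    then have "?V \<subseteq> {0}" using u by (auto simp: w_def)
    then have "card ?V \<le> 1" using card_mono[of "{0}" ?V] by simp
    then show False using V(4) by simp
  qed
  have fpos: "0 < f z" if z: "z \<in> ?V - {u}" for z
  proof -
    have "f z = (norm u)\<^sup>2 - z \<bullet> u"
      unfolding cmod_power2 by (simp add: f_def w_def inner_complex_def power2_eq_square algebra_simps)
    moreover have "(norm (u - z))\<^sup>2 = (norm u)\<^sup>2 + (norm z)\<^sup>2 - 2 * (z \<bullet> u)"
      by (simp add: power2_norm_eq_inner inner_diff_left inner_diff_right inner_commute)
    moreover have "0 < (norm (u - z))\<^sup>2" using z by auto
    moreover have "(norm z)\<^sup>2 \<le> (norm u)\<^sup>2" using u(2)[of z] z by (simp add: power_mono)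
    ultimately show ?thesis by linarith
  qed
  define key where "key z = h z / f z" for z
  \<comment> \<open>Up to positive factors, the orientation of a triangle with corner
    \<open>u\<close> is a difference of slopes.\<close>
  have ok: "orient u a b * (cmod w)\<^sup>2 = f a * f b * (key b - key a)" if "a \<in> ?V - {u}" "b \<in> ?V - {u}" for a b
  proof -
    have "(cmod w)\<^sup>2 * orient u a b = f a * h b - h a * f b"
      unfolding f_def h_def by (rule orient_key)
    moreover have "f a * f b * (h b / f b - h a / f a) = f a * h b - h a * f b"
      using fpos[OF that(1)] fpos[OF that(2)] by (simp add: field_simps)
    ultimately show ?thesis unfolding key_def by (simp only: mult.commute)
  qed
  have opos: "0 < orient u a b" if "a \<in> ?V - {u}" "b \<in> ?V - {u}" "key a < key b" for a b
  proof -
    have "0 < f a * f b * (key b - key a)" using fpos that by simp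
    then have "0 < orient u a b * (cmod w)\<^sup>2" using ok[OF that(1,2)] by simp
    then show ?thesis by (simp add: zero_less_mult_iff)
  qed
  have "inj_on key (?V - {u})"
  proof (rule inj_onI)
    fix a b assume ab: "a \<in> ?V - {u}" "b \<in> ?V - {u}" "key a = key b"
    then have "orient u a b = 0" using ok[OF ab(1,2)] w by simp
    then have "b \<in> closed_segment u a" using line_in_segment[OF _ inQ ext ext] u ab by blast
    moreover have "b \<notin> open_segment u a" using extreme_not_between[OF ext inQ inQ] u ab by blast
    ultimately show "a = b" using ab by (auto simp: open_segment_def)
  qed
  moreover have "finite (?V - {u})" using V(1) by simp
  ultimately obtain e where e: "bij_betw e {..<card (?V - {u})} (?V - {u})"
    "\<And>i j. i < j \<Longrightarrow> j < card (?V - {u}) \<Longrightarrow> key (e i) < key (e j)" using strict_key_enumeration by metis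
  have card: "card (?V - {u}) = card ?V - 1" using u V(1) by simp
  define p where "p i = (if i = 0 then u else e (i - 1))" for i :: nat
  define N where "N = int (card ?V)"
  define P where "P k = p (nat (k mod N))" for k
  have N: "3 \<le> N" using V(4) by (simp add: N_def)
  have eV: "e i \<in> ?V - {u}" if "i < card ?V - 1" for i
    using e(1) that card by (auto simp: bij_betw_def)
  have pV: "p i \<in> ?V" if "i < card ?V" for i using eV[of "i - 1"] u that by (auto simp: p_def)
  have ccw0: "0 < orient (p i) (p j) (p k)" if "i < j" "j < k" "k < card ?V" for i j k
  proof -
    have jk: "p j = e (j - 1)" "p k = e (k - 1)" "p j \<in> ?V - {u}" "p k \<in> ?V - {u}" "key (p j) < key (p k)"
      using that eV[of "j - 1"] eV[of "k - 1"] e(2)[of "j - 1" "k - 1"] card by (auto simp: p_def)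
    show ?thesis
    proof (cases "i = 0")
      case True
      then show ?thesis using opos jk by (simp add: p_def)
    next
      case False
      have i: "p i \<in> ?V - {u}" "key (p i) < key (p j)"
        using that False jk(1) eV[of "i - 1"] e(2)[of "i - 1" "j - 1"] card by (auto simp: p_def)
      have "orient u (p j) (p i) < 0" using opos[OF i(1) jk(3) i(2)] orient_swap[of u "p j" "p i"] by simp
      \<comment> \<open>The segment from \<open>u\<close> to \<open>p j\<close> separates
        \<open>p i\<close> from \<open>p k\<close>, so it meets their segment; hence
        \<open>p j\<close> lies beyond that segment as seen from \<open>u\<close>.\<close>
      then obtain z where z: "z \<in> open_segment u (p j)" "z \<in> open_segment (p i) (p k)"
        using opposite_sides_meet[OF ext ext V(2) inQ inQ _ opos[OF jk(3,4,5)], of "p i"] u i jk by blast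
      obtain s where s: "0 < s" "s < 1" "\<And>a b. orient a b z = (1 - s) * orient a b u + s * orient a b (p j)"
        using orient_open_segment[OF z(1)] by metis
      obtain s' where "\<And>a b. orient a b z = (1 - s') * orient a b (p i) + s' * orient a b (p k)"
        using orient_open_segment[OF z(2)] by metis
      then have "orient (p i) (p k) z = 0" by simp
      moreover have "0 < orient (p i) (p k) u"
        using opos[OF i(1) jk(4)] i(2) jk(5) orient_rotate[of u "p i" "p k"] by simp
      then have "0 < (1 - s) * orient (p i) (p k) u" using s by simp
      ultimately have "s * orient (p i) (p k) (p j) < 0" using s(3)[of "p i" "p k"] by linarith
      then have "orient (p i) (p k) (p j) < 0" using s by (simp add: mult_less_0_iff)
      then show ?thesis using orient_swap[of "p i" "p k" "p j"] by simp
    qed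
  qed
  have ccw1: "0 < orient (P i) (P j) (P k)" if "0 \<le> i" "i < j" "j < k" "k < N" for i j k
    using that ccw0[of "nat i" "nat j" "nat k"] by (simp add: P_def N_def)
  have per: "P (k + N) = P k" for k by (simp add: P_def)
  have "cyclic_polygon N P Q"
  proof
    fix i j k assume ijk: "i < j" "j < k" "k < i + N"
    define m where "m = N * (i div N)"
    have i': "i - m = i mod N" by (simp add: m_def minus_mult_div_eq_mod)
    have b: "0 \<le> i - m" "i - m < N" unfolding i' using N by simp_all
    have Pm: "P (z - m) = P z" for z
    proof -
      have "(z - m) mod N = z mod N" by (simp add: m_def mod_diff_right_eq [symmetric])
      then show ?thesis by (simp add: P_def)
    qed
    have PN: "P (z - N) = P z" for z using per[of "z - N"] by simp
    \<comment> \<open>The triple starts in the base period; indices that overflow it are moved back,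
      which rotates the triple cyclically.\<close>
    consider "k - m < N" | "j - m < N" "N \<le> k - m" | "N \<le> j - m" by linarith
    then have "0 < orient (P (i - m)) (P (j - m)) (P (k - m))"
    proof cases
      case 1 then show ?thesis using ccw1[of "i - m" "j - m" "k - m"] ijk b by simp
    next
      case 2
      then have "0 < orient (P (k - m - N)) (P (i - m)) (P (j - m))"
        using ccw1[of "k - m - N" "i - m" "j - m"] ijk b by simp
      then show ?thesis unfolding PN using orient_rotate by metis
    next
      case 3
      then have "0 < orient (P (j - m - N)) (P (k - m - N)) (P (i - m))"
        using ccw1[of "j - m - N" "k - m - N" "i - m"] ijk b by simp
      then show ?thesis unfolding PN using orient_rotate by metis
    qed
    then show "0 < orient (P i) (P j) (P k)" unfolding Pm .
  next
    have "range P = ?V"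
    proof
      show "range P \<subseteq> ?V"
      proof
        fix z assume "z \<in> range P"
        then obtain k where "z = P k" by blast
        moreover have "nat (k mod N) < card ?V" using N pos_mod_bound[of N k] by (simp add: N_def nat_less_iff)
        ultimately show "z \<in> ?V" using pV by (simp add: P_def)
      qed
      show "?V \<subseteq> range P"
      proof
        fix z assume z: "z \<in> ?V"
        show "z \<in> range P"
        proof (cases "z = u")
          case True
          then have "z = P 0" by (simp add: P_def p_def)
          then show ?thesis by blast
        next
          case False
          then obtain i where i: "i < card ?V - 1" "z = e i"
            using e(1) z card by (auto simp: bij_betw_def image_iff)
          then have "z = P (int (Suc i))" by (simp add: P_def p_def N_def nat_add_distrib)
          then show ?thesis by blast
        qed
      qed
    qed
    then show "vertices Q = range P" "Q = convex hull (range P)" using V(3) by simp_all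
  qed (use N per V(2) in auto)
  then show ?thesis by blast
qed

section \<open>The central reflection acting on the vertices\<close>

lemma orient_reflection: "orient (point_reflection c x) (point_reflection c y) (point_reflection c z) = orient x y z"
  by (simp add: orient_altdef point_reflection_def algebra_simps)

lemma reflection_invol [simp]: "point_reflection c (point_reflection c z) = z"
  by (simp add: point_reflection_def)

lemma reflection_affine: "point_reflection c ((1 - t) *\<^sub>R a + t *\<^sub>R b) = (1 - t) *\<^sub>R point_reflection c a + t *\<^sub>R point_reflection c b"
  by (simp add: point_reflection_def scaleR_conv_of_real algebra_simps)

lemma reflection_inj: "point_reflection c x = point_reflection c y \<longleftrightarrow> x = y"
  by (metis reflection_invol)

lemma reflection_closed_segment: "point_reflection c ` closed_segment a b = closed_segment (point_reflection c a) (point_reflection c b)"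
proof (intro equalityI subsetI)
  fix z assume "z \<in> point_reflection c ` closed_segment a b"
  then obtain t where "0 \<le> t" "t \<le> 1" "z = point_reflection c ((1 - t) *\<^sub>R a + t *\<^sub>R b)" by (auto simp: in_segment)
  then show "z \<in> closed_segment (point_reflection c a) (point_reflection c b)"
    unfolding reflection_affine by (auto simp: in_segment)
next
  fix z assume "z \<in> closed_segment (point_reflection c a) (point_reflection c b)"
  then obtain t where t: "0 \<le> t" "t \<le> 1" "z = (1 - t) *\<^sub>R point_reflection c a + t *\<^sub>R point_reflection c b"
    by (auto simp: in_segment)
  then have "z = point_reflection c ((1 - t) *\<^sub>R a + t *\<^sub>R b)" by (simp add: reflection_affine)
  moreover have "(1 - t) *\<^sub>R a + t *\<^sub>R b \<in> closed_segment a b" using t by (auto simp: in_segment)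
  ultimately show "z \<in> point_reflection c ` closed_segment a b" by blast
qed

lemma reflection_open_segment: "point_reflection c ` open_segment a b = open_segment (point_reflection c a) (point_reflection c b)"
proof -
  have "inj (point_reflection c)" by (auto intro: injI simp: reflection_inj)
  then show ?thesis unfolding open_segment_def by (simp add: image_set_diff reflection_closed_segment)
qed

text \<open>The reflection preserves orientation, hence the cyclic order of the vertices, so it
  shifts the indices by some \<open>m\<close>. It is an involution that fixes no vertex, which gives
  \<open>N = 2 * m\<close>.\<close>

lemma centrally_symmetric_cyclic:
  assumes cp: "cyclic_polygon N P Q" and cs: "centrally_symmetric c Q"
  shows "\<exists>n\<ge>2. N = 2 * n \<and> (\<forall>k. P (k + n) = point_reflection c (P k))"
proof -
  interpret cyclic_polygon N P Q by (fact cp)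
  let ?r = "point_reflection c"
  have rQ: "?r z \<in> Q" if "z \<in> Q" for z using cs that unfolding centrally_symmetric_def by blast
  have rext: "?r z extreme_point_of Q" if z: "z extreme_point_of Q" for z
    unfolding extreme_point_of_def
  proof (intro conjI ballI)
    show "?r z \<in> Q" using z rQ by (simp add: extreme_point_of_def)
    fix x y assume xy: "x \<in> Q" "y \<in> Q"
    show "?r z \<notin> open_segment x y"
    proof
      assume "?r z \<in> open_segment x y"
      then have "?r (?r z) \<in> open_segment (?r x) (?r y)" using reflection_open_segment by blast
      then show False using extreme_not_between[OF z rQ[OF xy(1)] rQ[OF xy(2)]] by simp
    qed
  qed
  have "\<exists>m. ?r (P k) = P m \<and> a \<le> m \<and> m < a + N" for k a
  proof -
    have "?r (P k) \<in> range P" using rext[OF extreme] vertices unfolding vertices_def by blast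
    then obtain m0 where "?r (P k) = P m0" by blast
    then show ?thesis using representative[of a m0] P_add_multiple by metis
  qed
  note ex = this
  obtain m where m: "?r (P 0) = P m" "0 \<le> m" "m < N" using ex[of 0 0] by auto
  have center: "z = c" if "?r z = z" for z using that by (simp add: point_reflection_def)
  \<comment> \<open>A fixed vertex would be the center, which is the midpoint of another vertex and
    its reflection and so not extreme.\<close>
  have m0: "m \<noteq> 0"
  proof
    assume "m = 0"
    then have 0: "P 0 = c" using center m by metis
    have ne: "P 1 \<noteq> P 0" using P_neq[of 0 1] N by auto
    then have "?r (P 1) \<noteq> P 1" using center 0 by metis
    moreover have "c = (1 - 1 / 2) *\<^sub>R P 1 + (1 / 2) *\<^sub>R ?r (P 1)"
      by (simp add: point_reflection_def scaleR_conv_of_real field_simps)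
    moreover have "(0::real) < 1 / 2" "(1::real) / 2 < 1" by simp_all
    ultimately have "c \<in> open_segment (P 1) (?r (P 1))" unfolding in_open_segment_iff by metis
    then show False using extreme_not_between[OF extreme P_in rQ[OF P_in], of 0 1 1] 0 by simp
  qed
  have "\<exists>t. \<forall>k. ?r (P k) = P (m + t k) \<and> 0 \<le> t k \<and> t k < N"
  proof -
    have "\<exists>t. ?r (P k) = P (m + t) \<and> 0 \<le> t \<and> t < N" for k
    proof -
      obtain m' where "?r (P k) = P m'" "m \<le> m'" "m' < m + N" using ex by blast
      then show ?thesis by (intro exI[of _ "m' - m"]) simp
    qed
    then show ?thesis by metis
  qed
  then obtain t where t: "\<And>k. ?r (P k) = P (m + t k)" "\<And>k. 0 \<le> t k" "\<And>k. t k < N" by blast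
  have t0: "t 0 = 0" using t[of 0] m P_neq[of m "m + t 0"] by (metis add.commute add_cancel_right_right add_less_cancel_left less_add_same_cancel2 order_le_less)
  have tpos: "0 < t k" if "0 < k" "k < N" for k
  proof (rule ccontr)
    assume "\<not> 0 < t k"
    then have "t k = 0" using t(2)[of k] by simp
    then have "P k = P 0" using t(1)[of k] m(1) reflection_inj by (metis add.right_neutral)
    then show False using P_neq[of 0 k] that by auto
  qed
  have tmono: "t i < t j" if "0 \<le> i" "i < j" "j < N" for i j
  proof (cases "i = 0")
    case True then show ?thesis using tpos that t0 by simp
  next
    case False
    have "0 < orient (P 0) (P i) (P j)" using ccw[of 0 i j] that False by simp
    then have o: "0 < orient (P m) (P (m + t i)) (P (m + t j))"
      using orient_reflection[of c "P 0" "P i" "P j"] m(1) t(1) by simp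
    show ?thesis
    proof (rule ccontr)
      assume "\<not> t i < t j"
      then have "orient (P m) (P (m + t i)) (P (m + t j)) \<le> 0"
        using orient_nonpos[of m "m + t i" "m + t j"] tpos[of i] that False t(2)[of j] t(3)[of i] by simp
      then show False using o by simp
    qed
  qed
  \<comment> \<open>A strictly increasing map of the indices from 0 to \<open>N - 1\<close> into
    themselves is the identity: it is bounded below by induction from 0 and above by induction from
    \<open>N - 1\<close>.\<close>
  have lower: "int k \<le> t (int k)" if "int k < N" for k
    using that
  proof (induction k)
    case (Suc k)
    then show ?case using tmono[of "int k" "int (Suc k)"] by simp
  qed (simp add: t0)
  have upper: "t (N - 1 - int k) \<le> N - 1 - int k" if "int k < N" for k
    using that
  proof (induction k)
    case 0 then show ?case using t(3)[of "N - 1"] by simp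
  next
    case (Suc k)
    then show ?case using tmono[of "N - 1 - int (Suc k)" "N - 1 - int k"] by simp
  qed
  have tk: "t k = k" if "0 \<le> k" "k < N" for k
    using lower[of "nat k"] upper[of "nat (N - 1 - k)"] that by simp
  have "P (m + m) = P 0" using t(1)[of m] tk[OF m(2,3)] m(1) by (metis reflection_invol)
  then have "N dvd 2 * m" using P_eq_iff[of "m + m" 0] by simp
  then obtain q where q: "2 * m = N * q" by blast
  have "0 < N * q" "N * q < N * 2" using q m m0 by linarith+
  then have "0 < q" "q < 2" using N by (simp_all add: zero_less_mult_iff)
  then have Nm: "N = 2 * m" using q by auto
  have "P (k + m) = ?r (P k)" for k
  proof -
    obtain z where z: "N dvd z" "0 \<le> k + z" "k + z < 0 + N" using representative by blast
    have "?r (P (k + z)) = P (m + (k + z))" using t(1)[of "k + z"] tk[of "k + z"] z by simp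
    then show ?thesis using P_add_multiple[OF z(1), of k] P_add_multiple[OF z(1), of "k + m"]
      by (simp add: algebra_simps)
  qed
  then show ?thesis using Nm N by (intro exI[of _ m]) simp
qed

section \<open>Tangents to the disk\<close>

lemma orient_scale: "orient (c + w * x) (c + w * y) (c + w * z) = (cmod w)\<^sup>2 * orient x y z"
  unfolding orient_altdef cmod_power2 by (simp add: algebra_simps power2_eq_square)

lemma sin_sum_product:
  fixes x y :: real
  shows "sin (2 * x) + sin (2 * y) - sin (2 * (x + y)) = 4 * (sin x * sin y * sin (x + y))"
proof -
  have "sin (2 * x) + sin (2 * y) = 2 * sin (x + y) * cos (x - y)"
    using sin_plus_sin[of "2 * x" "2 * y"] by (simp add: add_divide_distrib diff_divide_distrib)
  moreover have "sin (2 * (x + y)) = 2 * sin (x + y) * cos (x + y)" by (rule sin_double)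
  moreover have "cos (x - y) - cos (x + y) = 2 * sin x * sin y" by (simp add: cos_add cos_diff)
  ultimately show ?thesis by (simp add: algebra_simps)
qed

text \<open>The product form makes the sign visible: for counterclockwise points within one turn,
  all three half-angles lie strictly between 0 and \<open>pi\<close>.\<close>

lemma orient_cis: "orient (cis a) (cis b) (cis d) = 4 * (sin ((b - a) / 2) * sin ((d - b) / 2) * sin ((d - a) / 2))"
proof -
  have "orient (cis a) (cis b) (cis d) = sin (b - a) + sin (d - b) - sin (d - a)"
    by (simp add: orient_altdef sin_diff algebra_simps)
  moreover have "2 * ((b - a) / 2) = b - a" "2 * ((d - b) / 2) = d - b" "2 * ((b - a) / 2 + (d - b) / 2) = d - a"
    "(b - a) / 2 + (d - b) / 2 = (d - a) / 2" by (simp_all add: field_simps)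
  ultimately show ?thesis using sin_sum_product[of "(b - a) / 2" "(d - b) / 2"] by metis
qed

lemma cyclic_regular:
  assumes N: "3 \<le> N" and w: "w \<noteq> 0" and Q: "Q = convex hull ((\<lambda>k. c + w * cis (2 * pi * real k / real N)) ` {..<N})"
  shows "cyclic_polygon (int N) (\<lambda>k. c + w * cis (2 * pi * of_int k / real N)) Q"
proof -
  let ?P = "\<lambda>k::int. c + w * cis (2 * pi * of_int k / real N)"
  have per: "?P (k + int N) = ?P k" for k
  proof -
    have "2 * pi * of_int (k + int N) / real N = 2 * pi * of_int k / real N + 2 * pi"
      using N by (simp add: field_simps)
    then show ?thesis by (simp add: cis_mult [symmetric])
  qed
  have "range ?P = ((\<lambda>k. c + w * cis (2 * pi * real k / real N)) ` {..<N})"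
  proof (intro equalityI subsetI)
    fix z assume "z \<in> range ?P"
    then obtain k where z: "z = ?P k" by blast
    have "?P (k + - (int N * (k div int N))) = ?P k"
      by (rule periodic_multiple[where f = ?P and N = "int N"]) (simp_all only: per dvd_minus_iff dvd_triv_left)
    then have "?P (k mod int N) = ?P k" by (simp only: minus_mult_div_eq_mod [symmetric] add_uminus_conv_diff)
    moreover have "0 \<le> k mod int N" "k mod int N < int N" using N by simp_all
    ultimately show "z \<in> (\<lambda>k. c + w * cis (2 * pi * real k / real N)) ` {..<N}"
      unfolding z by (intro image_eqI[of _ _ "nat (k mod int N)"]) auto
  next
    fix z assume "z \<in> (\<lambda>k. c + w * cis (2 * pi * real k / real N)) ` {..<N}"
    then obtain k where "z = c + w * cis (2 * pi * real k / real N)" by blast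
    then have "z = ?P (int k)" by simp
    then show "z \<in> range ?P" by blast
  qed
  then have hull: "Q = convex hull (range ?P)" using Q by simp
  have sub: "Q \<subseteq> cball c (cmod w)" unfolding hull
    by (rule hull_minimal) (auto simp: dist_norm norm_mult)
  show ?thesis
  proof
    show "3 \<le> int N" using N by simp
    show "?P (k + int N) = ?P k" for k by (fact per)
    show "convex Q" unfolding hull by (rule convex_convex_hull)
    show "Q = convex hull (range ?P)" by (fact hull)
    show "vertices Q = range ?P"
    proof
      show "vertices Q \<subseteq> range ?P" unfolding vertices_def hull using extreme_point_of_convex_hull by blast
      show "range ?P \<subseteq> vertices Q"
      proof
        fix z assume z: "z \<in> range ?P"
        then have dz: "dist c z = cmod w" by (auto simp: dist_norm norm_mult)
        have "z \<in> Q" unfolding hull by (rule hull_inc[OF z])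
        moreover have "z \<notin> open_segment x y" if "x \<in> Q" "y \<in> Q" for x y
        proof
          assume "z \<in> open_segment x y"
          then have "dist c z < dist c x \<or> dist c z < dist c y" by (rule dist_decreases_open_segment)
          moreover have "dist c x \<le> cmod w" "dist c y \<le> cmod w" using that sub by auto
          ultimately show False using dz by simp
        qed
        ultimately show "z \<in> vertices Q" by (auto simp: vertices_def extreme_point_of_def)
      qed
    qed
  next
    fix i j k :: int assume ijk: "i < j" "j < k" "k < i + int N"
    have s: "0 < sin ((2 * pi * of_int y / real N - 2 * pi * of_int x / real N) / 2)"
      if "x < y" "y < x + int N" for x y :: int
    proof -
      have "(2 * pi * of_int y / real N - 2 * pi * of_int x / real N) / 2 = pi * (of_int (y - x) / real N)"
        using N by (simp add: field_simps)
      note eq = this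
      have yx: "y - x < int N" using that by simp
      then have "real_of_int (y - x) < real N" by (metis of_int_less_iff of_int_of_nat_eq)
      then have "0 < of_int (y - x) / real N" "of_int (y - x) / real N < 1" using that N by (simp_all add: field_simps)
      moreover have "0 < pi * q" "pi * q < pi" if "0 < q" "q < 1" for q using that by simp_all
      ultimately have "0 < pi * (of_int (y - x) / real N)" "pi * (of_int (y - x) / real N) < pi" by blast+
      then show ?thesis using sin_gt_zero eq by metis
    qed
    show "0 < orient (?P i) (?P j) (?P k)"
      unfolding orient_scale orient_cis using s[of i j] s[of j k] s[of i k] ijk w by simp
  qed
qed

lemma (in cyclic_polygon) edge_not_interior:
  assumes "orient (P i) (P (i + 1)) z = 0"
  shows "z \<notin> interior Q"
proof
  assume "z \<in> interior Q"
  then obtain e where e: "0 < e" "ball z e \<subseteq> Q" using mem_interior by blast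
  define k where "k = i + 2"
  have fk: "0 < orient (P i) (P (i + 1)) (P k)" using ccw[of i "i + 1" k] N by (simp add: k_def)
  have ne: "z \<noteq> P k" using fk assms by auto
  \<comment> \<open>Chosen so that \<open>z'\<close> is \<open>z\<close> moved by
    \<open>e / 2\<close> straight away from \<open>P k\<close>, that is, to the outer side of the
    edge but still inside the ball.\<close>
  define d where "d = e / (2 * norm (z - P k))"
  have d: "0 < d" using e ne by (simp add: d_def)
  define z' where "z' = (1 - (- d)) *\<^sub>R z + (- d) *\<^sub>R P k"
  have "z' - z = d *\<^sub>R (z - P k)" by (simp add: z'_def algebra_simps)
  then have "norm (z' - z) = e / 2" using ne e by (simp add: d_def)
  then have "z' \<in> Q" using e by (auto simp: dist_norm norm_minus_commute subset_iff)
  moreover have nn: "0 \<le> orient (P i) (P (i + 1)) (P l)" for l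
  proof -
    obtain m where m: "N dvd m" "i + 1 \<le> l + m" "l + m < i + 1 + N" using representative by blast
    then show ?thesis using orient_nonneg[of i "i + 1" "l + m"] P_add_multiple[OF m(1), of l] by simp
  qed
  ultimately have "0 \<le> orient (P i) (P (i + 1)) z'" using Q_side by blast
  moreover have "orient (P i) (P (i + 1)) z' = - d * orient (P i) (P (i + 1)) (P k)"
    unfolding z'_def orient_affine using assms by simp
  moreover have "0 < d * orient (P i) (P (i + 1)) (P k)" using d fk by simp
  ultimately show False by linarith
qed

definition side :: "bool \<Rightarrow> real" where
  "side a = (if a then 1 else - 1)"

text \<open>With circumradius 1 the disk has radius \<open>cos \<phi>\<close>, and its tangent from
  \<open>cis \<alpha>\<close> touches in direction \<open>\<alpha> + s * \<phi>\<close>. The last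
  factor is the signed distance of \<open>z\<close> from this tangent line.\<close>

lemma orient_tangent:
  assumes "s = 1 \<or> s = - 1"
  shows "orient (cis \<alpha>) (of_real (cos \<phi>) * cis (\<alpha> + s * \<phi>)) z =
    - (s * sin \<phi> * (Re (cis (- (\<alpha> + s * \<phi>)) * z) - cos \<phi>))"
proof -
  define \<theta> where "\<theta> = \<alpha> + s * \<phi>"
  have \<alpha>: "\<alpha> = \<theta> - s * \<phi>" by (simp add: \<theta>_def)
  have ss: "s * s = 1" using assms by auto
  have sc: "cos (s * \<phi>) = cos \<phi>" "sin (s * \<phi>) = s * sin \<phi>" using assms by auto
  have c2: "cos \<theta> * cos \<theta> = 1 - sin \<theta> * sin \<theta>" "sin \<phi> * sin \<phi> = 1 - cos \<phi> * cos \<phi>"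
    using sin_cos_squared_add[of \<theta>] sin_cos_squared_add[of \<phi>] by (simp_all add: power2_eq_square)
  have "Re (cis \<alpha>) = cos \<theta> * cos \<phi> + s * (sin \<theta> * sin \<phi>)" "Im (cis \<alpha>) = sin \<theta> * cos \<phi> - s * (cos \<theta> * sin \<phi>)"
    unfolding \<alpha> by (simp_all add: cos_diff sin_diff sc)
  note R = this
  have T: "Re (of_real (cos \<phi>) * cis \<theta>) = cos \<phi> * cos \<theta>" "Im (of_real (cos \<phi>) * cis \<theta>) = cos \<phi> * sin \<theta>"
    by simp_all
  have "orient (cis \<alpha>) (of_real (cos \<phi>) * cis \<theta>) z =
      (- (s * (sin \<theta> * sin \<phi>))) * (Im z - (sin \<theta> * cos \<phi> - s * (cos \<theta> * sin \<phi>)))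
      - (s * (cos \<theta> * sin \<phi>)) * (Re z - (cos \<theta> * cos \<phi> + s * (sin \<theta> * sin \<phi>)))"
    unfolding orient_altdef R T by (simp add: algebra_simps)
  also have "\<dots> = - (s * sin \<phi> * (cos \<theta> * Re z + sin \<theta> * Im z - cos \<phi>))"
  proof -
    have "sin \<theta> * sin \<theta> + cos \<theta> * cos \<theta> = 1" using c2(1) by simp
    then show ?thesis by algebra
  qed
  also have "\<dots> = - (s * sin \<phi> * (Re (cis (- \<theta>) * z) - cos \<phi>))"
    by simp
  finally show ?thesis by (simp add: \<theta>_def)
qed

section \<open>Vertices, tangent points and chords of a type D configuration\<close>

locale type_D =
  fixes n :: nat and c :: complex and r :: real and Q :: "complex set"
  assumes conf: "type_D_configuration n c r Q"
begin

definition w :: complex where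
  "w = (SOME w. w \<noteq> 0 \<and> Q = convex hull ((\<lambda>k. c + w * cis (2 * pi * real k / real (2 * n))) ` {..<2 * n}))"

definition ang :: "int \<Rightarrow> real" where
  "ang k = pi * of_int k / real n"

definition P :: "int \<Rightarrow> complex" where
  "P k = c + w * cis (ang k)"

text \<open>The angle at the center between a vertex and its points of tangency, in the right
  triangle with hypotenuse \<open>cmod w\<close> and leg \<open>r\<close>.\<close>

definition \<phi> :: real where
  "\<phi> = arccos (r / cmod w)"

text \<open>\<open>True\<close> selects the point of tangency counterclockwise from the direction of
  the vertex, \<open>False\<close> the clockwise one.\<close>

definition T :: "int \<Rightarrow> bool \<Rightarrow> complex" where
  "T k a = c + w * (of_real (cos \<phi>) * cis (ang k + side a * \<phi>))"

definition tangent :: "int \<Rightarrow> bool \<Rightarrow> chord" where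
  "tangent k a = closed_segment (P k) (T k a)"

lemma n: "2 \<le> n"
  using conf by (simp add: type_D_configuration_def)

lemma r: "0 < r" "cball c r \<subseteq> interior Q" "s \<in> diagonals Q - long_diagonals c Q \<Longrightarrow> s \<inter> cball c r = {}"
  using conf by (auto simp: type_D_configuration_def)

lemma w: "w \<noteq> 0" "Q = convex hull ((\<lambda>k. c + w * cis (2 * pi * real k / real (2 * n))) ` {..<2 * n})"
proof -
  have ex: "\<exists>w. w \<noteq> 0 \<and> Q = convex hull ((\<lambda>k. c + w * cis (2 * pi * real k / real (2 * n))) ` {..<2 * n})"
    using conf by (auto simp: type_D_configuration_def regular_polygon_def)
  show "w \<noteq> 0" "Q = convex hull ((\<lambda>k. c + w * cis (2 * pi * real k / real (2 * n))) ` {..<2 * n})"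
    using someI_ex[OF ex] unfolding w_def by blast+
qed

sublocale cyclic_polygon "2 * int n" P Q
proof -
  have "(\<lambda>k. c + w * cis (2 * pi * of_int k / real (2 * n))) = P" by (simp add: P_def ang_def fun_eq_iff)
  moreover have "3 \<le> 2 * n" using n by simp
  ultimately show "cyclic_polygon (2 * int n) P Q" using cyclic_regular[OF _ w, of] by simp
qed

lemma ang_add: "ang (j + k) = ang j + ang k"
  by (simp add: ang_def ring_distribs add_divide_distrib)

lemma ang_n: "ang (int n) = pi"
  using n by (simp add: ang_def)

lemma reflect_P: "point_reflection c (P k) = P (k + int n)"
  by (simp add: point_reflection_def P_def ang_add ang_n cis_mult [symmetric])

lemma reflect_T: "point_reflection c (T k a) = T (k + int n) a"
proof -
  have "ang (k + int n) + side a * \<phi> = (ang k + side a * \<phi>) + pi" by (simp add: ang_add ang_n)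
  then have "cis (ang (k + int n) + side a * \<phi>) = - cis (ang k + side a * \<phi>)"
    by (simp only: cis_mult [symmetric] cis_pi mult_minus1_right)
  then show ?thesis by (simp add: point_reflection_def T_def)
qed

lemma long_diagonals_eq: "long_diagonals c Q = {seg k (k + int n) | k. True}"
proof -
  have "long_diagonals c Q = (\<lambda>p. closed_segment p (point_reflection c p)) ` range P"
    unfolding long_diagonals_def vertices by blast
  also have "\<dots> = range (\<lambda>k. seg k (k + int n))" by (simp add: image_image reflect_P seg_def)
  finally show ?thesis by blast
qed

lemma short_diagonals: "diagonals Q - long_diagonals c Q = {seg i j | i j. 2 \<le> j - i \<and> j - i < int n}"
proof (intro equalityI subsetI)
  fix s assume s: "s \<in> diagonals Q - long_diagonals c Q"
  then obtain i j where ij: "s = seg i j" "2 \<le> j - i" "j - i \<le> 2 * int n - 2" unfolding diagonals_eq by blast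
  have "j - i \<noteq> int n"
  proof
    assume "j - i = int n"
    then have "j = i + int n" by simp
    then have "s = seg i (i + int n)" using ij(1) by simp
    then show False using s long_diagonals_eq by blast
  qed
  then consider "j - i < int n" | "int n < j - i" by linarith
  then show "s \<in> {seg i j | i j. 2 \<le> j - i \<and> j - i < int n}"
  proof cases
    case 2
    have "s = seg j (i + 2 * int n)" using ij periodic[of i] by (simp add: seg_def closed_segment_commute)
    then show ?thesis using 2 ij by (intro CollectI exI[of _ j] exI[of _ "i + 2 * int n"]) auto
  qed (use ij in blast)
next
  fix s assume "s \<in> {seg i j | i j. 2 \<le> j - i \<and> j - i < int n}"
  then obtain i j where ij: "s = seg i j" "2 \<le> j - i" "j - i < int n" by blast
  have "s \<notin> long_diagonals c Q"
  proof
    assume "s \<in> long_diagonals c Q"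
    then obtain k where "seg i j = seg k (k + int n)" using ij long_diagonals_eq by auto
    then have "2 * int n dvd (j - i) - int n \<or> 2 * int n dvd (j - i) + int n"
      unfolding seg_eq_iff using dvd_diff[of "2 * int n" "j - (k + int n)" "i - k"] dvd_diff[of "2 * int n" "j - k" "i - (k + int n)"]
      by (auto simp: algebra_simps)
    then show False using ij(2,3) zdvd_imp_le[of "2 * int n" "int n - (j - i)"] zdvd_imp_le[of "2 * int n" "(j - i) + int n"]
      by (auto simp: dvd_diff_commute)
  qed
  moreover have "s \<in> diagonals Q" unfolding diagonals_eq using ij by (intro CollectI exI[of _ i] exI[of _ j]) auto
  ultimately show "s \<in> diagonals Q - long_diagonals c Q" by blast
qed

end

lemma crossing_sym: "crossing s t \<Longrightarrow> crossing t s"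
  unfolding crossing_def by blast

lemma rel_interior_reflection: "rel_interior (point_reflection c ` S) = point_reflection c ` rel_interior S"
proof -
  have e: "point_reflection c ` X = (+) (2 * c) ` uminus ` X" for X
    by (simp add: image_image point_reflection_def)
  have "bounded_linear (uminus :: complex \<Rightarrow> complex)" by (rule bounded_linear_minus[OF bounded_linear_ident])
  then have "rel_interior (uminus ` S) = uminus ` rel_interior S"
    by (rule rel_interior_injective_linear_image) simp
  then show ?thesis unfolding e rel_interior_translation by simp
qed

lemma crossing_reflection: "crossing (point_reflection c ` s) (point_reflection c ` t) \<longleftrightarrow> crossing s t"
proof -
  have "inj (point_reflection c)" by (auto intro: injI simp: reflection_inj)
  then show ?thesis
    unfolding crossing_def rel_interior_reflection by (simp add: inj_image_eq_iff image_Int [symmetric])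
qed

context type_D
begin

lemma ang_diff: "ang (j - k) = ang j - ang k"
  by (simp add: ang_def ring_distribs diff_divide_distrib)

lemma ang_mono: "i \<le> j \<Longrightarrow> ang i \<le> ang j" and ang_strict: "i < j \<Longrightarrow> ang i < ang j"
  using n by (simp_all add: ang_def divide_right_mono divide_strict_right_mono)

lemma ang_0 [simp]: "ang 0 = 0" and ang_2n: "ang (2 * int n) = 2 * pi"
  using n by (simp_all add: ang_def)

text \<open>For \<open>n = 2\<close> the two vertices span an edge, which the disk avoids by lying
  in the interior; for larger \<open>n\<close> they span a short diagonal, which it avoids by
  hypothesis.\<close>

lemma midpoint_outside: "P 0 + P (int n - 1) \<noteq> 2 * z" if "z \<in> cball c r"
proof
  assume e: "P 0 + P (int n - 1) = 2 * z"
  have z: "z = (1 - 1 / 2) *\<^sub>R P 0 + (1 / 2) *\<^sub>R P (int n - 1)" using e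
    by (simp add: scaleR_conv_of_real field_simps)
  show False
  proof (cases "n = 2")
    case True
    have "orient (P 0) (P (0 + 1)) z = 0" unfolding z orient_affine using True by simp
    then have "z \<notin> interior Q" by (rule edge_not_interior)
    then show False using r(2) that by blast
  next
    case False
    then have "seg 0 (int n - 1) \<in> diagonals Q - long_diagonals c Q"
      unfolding short_diagonals using n by (intro CollectI exI[of _ 0] exI[of _ "int n - 1"]) auto
    moreover have "z \<in> seg 0 (int n - 1)"
      unfolding seg_def in_segment by (intro exI[of _ "1 / 2"] conjI z) simp_all
    ultimately show False using r(3) that by blast
  qed
qed

lemma half_angle: "0 < ang (int n - 1)" "ang (int n - 1) < pi"
  using n ang_strict[of 0 "int n - 1"] ang_strict[of "int n - 1" "int n"] ang_n by simp_all

text \<open>The right-hand side is the distance of the center from the chord between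
  \<open>P 0\<close> and \<open>P (n - 1)\<close>, attained at its midpoint.\<close>

lemma r_less: "r < cmod w * cos (ang (int n - 1) / 2)"
proof (rule ccontr)
  assume "\<not> ?thesis"
  then have le: "cmod w * cos (ang (int n - 1) / 2) \<le> r" by simp
  define b where "b = ang (int n - 1) / 2"
  have cb: "0 < cos b" using half_angle by (intro cos_gt_zero_pi) (auto simp: b_def)
  have "1 + cis (2 * b) = 2 * (of_real (cos b) * cis b)"
    by (simp add: complex_eq_iff cos_double_cos sin_double power2_eq_square)
  moreover have "P 0 + P (int n - 1) = 2 * c + w * (1 + cis (2 * b))"
    by (simp add: P_def b_def algebra_simps)
  ultimately have "P 0 + P (int n - 1) = 2 * c + 2 * (w * (of_real (cos b) * cis b))"
    by simp
  then have "(P 0 + P (int n - 1)) / 2 - c = w * (of_real (cos b) * cis b)"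
    by (simp add: add_divide_distrib)
  then have "cmod ((P 0 + P (int n - 1)) / 2 - c) = cmod w * cos b"
    using cb by (simp add: norm_mult)
  then have "(P 0 + P (int n - 1)) / 2 \<in> cball c r" using le by (simp add: b_def dist_norm norm_minus_commute)
  then show False using midpoint_outside by fastforce
qed

text \<open>The fifth part is where the size of the disk enters. A tangent line from a vertex meets
  the circumcircle again at angular distance \<open>2 * \<phi>\<close>, strictly between the vertex
  \<open>n - 1\<close> steps away and the opposite one.\<close>

lemma \<phi>: "cos \<phi> = r / cmod w" "0 < cos \<phi>" "0 < \<phi>" "\<phi> < pi / 2" "ang (int n - 1) < 2 * \<phi>" "0 < sin \<phi>"
proof -
  have w0: "0 < cmod w" using w by simp
  have k: "0 < r / cmod w" "r / cmod w < cos (ang (int n - 1) / 2)"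
    using r(1) r_less w0 by (simp_all add: field_simps)
  have k1: "r / cmod w < 1" using k(2) cos_le_one[of "ang (int n - 1) / 2"] by linarith
  show c: "cos \<phi> = r / cmod w" unfolding \<phi>_def using k(1) k1 by (intro cos_arccos) auto
  then show "0 < cos \<phi>" using k(1) by simp
  have b: "0 \<le> \<phi>" "\<phi> \<le> pi" unfolding \<phi>_def using k(1) k1 arccos_bounded[of "r / cmod w"] by auto
  have "\<phi> \<noteq> 0" using c k1 by auto
  then show p: "0 < \<phi>" using b by simp
  show p2: "\<phi> < pi / 2"
    using arccos_less_arccos[of 0 "r / cmod w"] k(1) k1 by (simp add: \<phi>_def)
  show "ang (int n - 1) < 2 * \<phi>"
  proof (rule ccontr)
    assume "\<not> ?thesis"
    then have "cos (ang (int n - 1) / 2) \<le> cos \<phi>"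
      using half_angle b by (intro cos_monotone_0_pi_le) auto
    then show False using c k(2) by simp
  qed
  show "0 < sin \<phi>" using p p2 by (intro sin_gt_zero) auto
qed

lemma T_dist: "dist c (T k a) = r"
proof -
  have "dist c (T k a) = cmod w * cos \<phi>"
    using \<phi>(2) by (simp add: T_def dist_norm norm_mult)
  then show ?thesis using \<phi>(1) w by simp
qed

lemma P_dist: "dist c (P k) = cmod w"
  by (simp add: P_def dist_norm norm_mult)

lemma r_less_w: "r < cmod w"
proof -
  have "cmod w * cos (ang (int n - 1) / 2) \<le> cmod w * 1" by (intro mult_left_mono) simp_all
  then show ?thesis using r_less by simp
qed

lemma T_neq_P: "T k a \<noteq> P j"
  using T_dist[of k a] P_dist[of j] r_less_w by auto

lemma T_in: "T k a \<in> Q"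
proof -
  have "T k a \<in> cball c r" using T_dist by simp
  then show ?thesis using r(2) interior_subset by blast
qed

lemma side_cases: "side a = 1 \<or> side a = - 1"
  by (simp add: side_def)

lemma orient_PT: "orient (P p) (T p a) (c + w * z) =
    - ((cmod w)\<^sup>2 * (side a * sin \<phi> * (Re (cis (- (ang p + side a * \<phi>)) * z) - cos \<phi>)))"
  unfolding P_def T_def orient_scale orient_tangent[OF side_cases] by simp

lemma orient_PTP: "orient (P p) (T p a) (P q) = - ((cmod w)\<^sup>2 * sin \<phi> * (side a * (cos (ang (q - p) - side a * \<phi>) - cos \<phi>)))"
proof -
  have "cis (- (ang p + side a * \<phi>)) * cis (ang q) = cis (ang (q - p) - side a * \<phi>)"
    by (simp add: cis_mult ang_diff algebra_simps)
  then have "Re (cis (- (ang p + side a * \<phi>)) * cis (ang q)) = cos (ang (q - p) - side a * \<phi>)" by simp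
  then show ?thesis using orient_PT[of p a "cis (ang q)"] unfolding P_def by simp
qed

lemma side_distance: "a \<noteq> b \<Longrightarrow> \<bar>side b * \<phi> - side a * \<phi>\<bar> = 2 * \<phi>"
  using \<phi>(3) by (cases a) (simp_all add: side_def)

lemma cos_side_\<phi>: "cos (side a * \<phi>) = cos \<phi>"
  by (cases a) (simp_all add: side_def)

lemma Re_of_real_mult: "Re (x * (of_real k * y)) = k * Re (x * y)"
  by (simp add: algebra_simps)

lemma orient_PTT: "orient (P p) (T p a) (T q b) =
  - ((cmod w)\<^sup>2 * sin \<phi> * (side a * (cos \<phi> * (cos (ang (q - p) + side b * \<phi> - side a * \<phi>) - 1))))"
proof -
  have "cis (- (ang p + side a * \<phi>)) * cis (ang q + side b * \<phi>) = cis (ang (q - p) + side b * \<phi> - side a * \<phi>)"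
    by (simp add: cis_mult ang_diff algebra_simps)
  then have "Re (cis (- (ang p + side a * \<phi>)) * (of_real (cos \<phi>) * cis (ang q + side b * \<phi>))) =
      cos \<phi> * cos (ang (q - p) + side b * \<phi> - side a * \<phi>)"
    by (metis Re_of_real_mult cis.sel(1))
  then show ?thesis using orient_PT[of p a "of_real (cos \<phi>) * cis (ang q + side b * \<phi>)"]
    unfolding T_def[of q b] by (simp add: algebra_simps)
qed

text \<open>The vertices 1 to \<open>n - 1\<close> steps ahead come before the second point where
  the tangent line meets the circumcircle, so the line cuts them off from the disk.
  \<open>cos_neg\<close> treats the vertices from the opposite one on, which lie on the side of the
  disk.\<close>

lemma cos_pos: "1 \<le> k \<Longrightarrow> k < int n \<Longrightarrow> cos \<phi> < cos (ang k - \<phi>)"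
proof -
  assume k: "1 \<le> k" "k < int n"
  have "0 < ang k" "ang k < 2 * \<phi>" using ang_strict[of 0 k] ang_mono[of k "int n - 1"] \<phi>(5) k by auto
  then have "cos \<phi> < cos \<bar>ang k - \<phi>\<bar>" using \<phi>(3,4) by (intro cos_monotone_0_pi) auto
  then show ?thesis by simp
qed

lemma cos_neg: "int n \<le> k \<Longrightarrow> k < 2 * int n \<Longrightarrow> cos (ang k - \<phi>) < cos \<phi>"
proof -
  assume k: "int n \<le> k" "k < 2 * int n"
  have b: "pi \<le> ang k" "ang k < 2 * pi" using ang_mono[of "int n" k] ang_strict[of k "2 * int n"] ang_n ang_2n k by auto
  show ?thesis
  proof (cases "ang k - \<phi> \<le> pi")
    case True
    then show ?thesis using b \<phi>(3,4) by (intro cos_monotone_0_pi) auto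
  next
    case False
    have "cos (2 * pi - (ang k - \<phi>)) < cos \<phi>" using b \<phi>(3,4) False by (intro cos_monotone_0_pi) auto
    then show ?thesis by (simp add: cos_diff)
  qed
qed

lemma cos_side: "cos (ang k - side a * \<phi>) = cos (ang (if a then k else - k) - \<phi>)"
proof (cases a)
  case False
  have "ang k - side a * \<phi> = - (ang (- k) - \<phi>)" using False by (simp add: side_def ang_def)
  then have "cos (ang k - side a * \<phi>) = cos (ang (- k) - \<phi>)" by (simp only: cos_minus)
  then show ?thesis using False by simp
qed (simp add: side_def)

lemma rel_interior_tangent: "rel_interior (tangent p a) = open_segment (P p) (T p a)"
  unfolding tangent_def using T_neq_P[of p a p] by (auto simp: rel_interior_segment)

lemma rel_interior_seg: "i < j \<Longrightarrow> j < i + 2 * int n \<Longrightarrow> rel_interior (seg i j) = open_segment (P i) (P j)"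
  unfolding seg_def using P_neq[of i j] by (auto simp: rel_interior_segment)

text \<open>The point of tangency \<open>T q b\<close> lies on the circle and so on the disk side of
  the tangent line at \<open>p\<close>. The hypotheses put \<open>P q\<close> on that side too, and
  one of the two points strictly.\<close>

lemma no_tangent_crossing:
  assumes "cos (ang (q - p) - side a * \<phi>) \<le> cos \<phi>"
    and "cos (ang (q - p) - side a * \<phi>) < cos \<phi> \<or> cos (ang (q - p) + side b * \<phi> - side a * \<phi>) < 1"
  shows "\<not> crossing (tangent p a) (tangent q b)"
proof -
  define W where "W = (cmod w)\<^sup>2 * sin \<phi>"
  have W: "0 < W" using \<phi>(6) w by (simp add: W_def)
  have ss: "side a * side a = 1" using side_cases[of a] by auto
  have o: "orient (P p) (T p a) (P q) = side a * (W * (cos \<phi> - cos (ang (q - p) - side a * \<phi>)))"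
    "orient (P p) (T p a) (T q b) = side a * (W * (cos \<phi> * (1 - cos (ang (q - p) + side b * \<phi> - side a * \<phi>))))"
    unfolding orient_PTP orient_PTT W_def by (simp_all add: algebra_simps)
  have "open_segment (P p) (T p a) \<inter> open_segment (P q) (T q b) = {}"
  proof (rule disjoint_same_side)
    show "0 \<le> side a * orient (P p) (T p a) (P q)"
      unfolding o mult.assoc [symmetric] ss using W assms(1) by simp
    show "0 \<le> side a * orient (P p) (T p a) (T q b)"
      unfolding o mult.assoc [symmetric] ss using W \<phi>(2) by simp
    show "orient (P p) (T p a) (P q) \<noteq> 0 \<or> orient (P p) (T p a) (T q b) \<noteq> 0"
      unfolding o using W \<phi>(2) assms(2) ss by auto
  qed (use ss in auto)
  then show ?thesis unfolding crossing_def rel_interior_tangent by blast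
qed

lemma tangent_shift: "2 * int n dvd m \<Longrightarrow> tangent (k + m) a = tangent k a"
proof -
  assume m: "2 * int n dvd m"
  have "T (k + 2 * int n) a = T k a" for k
  proof -
    have "ang (k + 2 * int n) + side a * \<phi> = (ang k + side a * \<phi>) + 2 * pi" using ang_2n by (simp add: ang_add)
    then show ?thesis unfolding T_def by (simp only: cis_mult [symmetric] cis_2pi mult_1_right)
  qed
  then have "T (k + m) a = T k a" using periodic_multiple[of "\<lambda>k. T k a" "2 * int n" m k] m by blast
  then show ?thesis unfolding tangent_def using P_add_multiple[OF m] by simp
qed

lemma tangent_window:
  obtains m where "2 * int n dvd m" "p \<le> q + m" "q + m < p + 2 * int n"
  using representative by blast

text \<open>For distinct vertices, one of the two tangent lines has the other chord on its disk
  side. Which one depends on the sign and on which vertex is less than half a turn ahead.\<close>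

lemma tangent_no_crossing_same_tag: "\<not> crossing (tangent p a) (tangent q a)"
proof -
  obtain m where m: "2 * int n dvd m" "p \<le> q + m" "q + m < p + 2 * int n" by (rule tangent_window)
  define k where "k = q + m - p"
  have k: "0 \<le> k" "k < 2 * int n" using m by (auto simp: k_def)
  have main: "\<not> crossing (tangent p a) (tangent (q + m) a)"
  proof -
    have nc: "\<not> crossing (tangent p' a) (tangent q' a)" if "cos (ang (q' - p') - side a * \<phi>) < cos \<phi>" for p' q'
      using no_tangent_crossing[of q' p' a a] that by simp
    have per: "cos (ang (j + 2 * int n) - \<phi>) = cos (ang j - \<phi>)" for j
    proof -
      have "ang (j + 2 * int n) - \<phi> = (ang j - \<phi>) + 2 * pi" using ang_2n by (simp add: ang_add)
      then show ?thesis by (simp only: cos_periodic)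
    qed
    have neg: "cos (ang j - \<phi>) < cos \<phi>" if "- int n \<le> j" "j < 0" for j
      using cos_neg[of "j + 2 * int n"] per[of j] that by simp
    consider "k = 0" | "0 < k" "k < int n" | "int n \<le> k" using k by linarith
    then show ?thesis
    proof cases
      case 1
      then have "q + m = p" by (simp add: k_def)
      then show ?thesis unfolding crossing_def by simp
    next
      case 2
      show ?thesis
      proof (cases a)
        case True
        have "cos (ang (p - (q + m)) - side a * \<phi>) < cos \<phi>"
          unfolding cos_side using neg[of "p - (q + m)"] 2 True by (simp add: k_def)
        then show ?thesis using nc crossing_sym by blast
      next
        case False
        have "cos (ang ((q + m) - p) - side a * \<phi>) < cos \<phi>"
          unfolding cos_side using neg[of "- k"] 2 False by (simp add: k_def)
        then show ?thesis using nc by blast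
      qed
    next
      case 3
      show ?thesis
      proof (cases a)
        case True
        have "cos (ang ((q + m) - p) - side a * \<phi>) < cos \<phi>"
          unfolding cos_side using cos_neg[of k] 3 k True by (simp add: k_def)
        then show ?thesis using nc by blast
      next
        case False
        have "cos (ang (p - (q + m)) - side a * \<phi>) < cos \<phi>"
          unfolding cos_side using cos_neg[of k] 3 k False by (simp add: k_def)
        then show ?thesis using nc crossing_sym by blast
      qed
    qed
  qed
  then show ?thesis using tangent_shift[OF m(1)] by simp
qed

text \<open>Up to a full turn the vertices are equal or opposite. In the first case the chords leave
  the common vertex in different directions; in the second the opposite vertex is strictly on the
  disk side.\<close>

lemma tangent_no_crossing_same_base:
  assumes "int n dvd p - q"
  shows "\<not> crossing (tangent p a) (tangent q b)"
proof (cases "a = b")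
  case True then show ?thesis using tangent_no_crossing_same_tag by simp
next
  case False
  obtain m where m: "2 * int n dvd m" "p \<le> q + m" "q + m < p + 2 * int n" by (rule tangent_window)
  have "int n dvd m" by (rule dvd_trans[OF _ m(1)]) simp
  then have "int n dvd m - (p - q)" using assms by (rule dvd_diff)
  then have dv: "int n dvd q + m - p" by (simp add: algebra_simps)
  then obtain z where z: "q + m - p = int n * z" by blast
  have "0 \<le> int n * z" "int n * z < int n * 2" using m z by linarith+
  moreover have "0 < int n" using n by simp
  ultimately have "0 \<le> z" "z < 2" by (auto simp: zero_le_mult_iff)
  then have "z = 0 \<or> z = 1" by auto
  then have "q + m - p = 0 \<or> q + m - p = int n" using z by auto
  then have "\<not> crossing (tangent p a) (tangent (q + m) b)"
  proof
    assume k: "q + m - p = 0"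
    have ab: "\<bar>side b * \<phi> - side a * \<phi>\<bar> = 2 * \<phi>" using False by (rule side_distance)
    have "cos \<bar>side b * \<phi> - side a * \<phi>\<bar> < cos 0"
      unfolding ab using \<phi>(3,4) by (intro cos_monotone_0_pi) auto
    then have 1: "cos (side b * \<phi> - side a * \<phi>) < 1" by simp
    have "cos (ang (q + m - p) - side a * \<phi>) \<le> cos \<phi>" unfolding k using cos_side_\<phi> by simp
    moreover have "cos (ang (q + m - p) + side b * \<phi> - side a * \<phi>) < 1" unfolding k using 1 by simp
    ultimately show ?thesis by (intro no_tangent_crossing disjI2)
  next
    assume k: "q + m - p = int n"
    have "cos (ang (q + m - p) - side a * \<phi>) < cos \<phi>"
      unfolding k ang_n cos_diff using cos_side_\<phi> \<phi>(2) by simp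
    then show ?thesis by (intro no_tangent_crossing disjI1) simp_all
  qed
  then show ?thesis using tangent_shift[OF m(1)] by simp
qed

text \<open>The tangent at \<open>p\<close> cuts off \<open>P q\<close> but not the point of
  tangency of the other chord, and the same holds with the roles exchanged, so each line separates
  the ends of the other chord.\<close>

lemma tangent_crossing_left:
  assumes "1 \<le> q - p" "q - p < int n"
  shows "crossing (tangent p True) (tangent q False)"
proof -
  define W where "W = (cmod w)\<^sup>2 * sin \<phi>"
  have W: "0 < W" using \<phi>(6) w by (simp add: W_def)
  have s: "side True = 1" "side False = - 1" by (simp_all add: side_def)
  have k: "0 < ang (q - p)" "ang (q - p) < 2 * \<phi>" using ang_strict[of 0 "q - p"] ang_mono[of "q - p" "int n - 1"] \<phi>(5) assms by auto
  have c1: "cos \<phi> < cos (ang (q - p) - \<phi>)" by (rule cos_pos[OF assms])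
  have neg: "ang (p - q) = - ang (q - p)" by (simp add: ang_diff)
  have c1': "cos (ang (p - q) + \<phi>) = cos (ang (q - p) - \<phi>)"
    unfolding neg by (metis cos_minus minus_diff_eq uminus_add_conv_diff)
  have "cos \<bar>ang (q - p) - 2 * \<phi>\<bar> < cos 0"
    using k \<phi>(3,4) by (intro cos_monotone_0_pi) auto
  then have c2: "cos (ang (q - p) - \<phi> - \<phi>) < 1" by (simp add: algebra_simps)
  have c2': "cos (ang (p - q) + \<phi> + \<phi>) = cos (ang (q - p) - \<phi> - \<phi>)"
  proof -
    have "ang (p - q) + \<phi> + \<phi> = - (ang (q - p) - \<phi> - \<phi>)" by (simp add: neg)
    then show ?thesis by (metis cos_minus)
  qed
  have o1: "orient (P p) (T p True) (P q) < 0"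
    unfolding orient_PTP s W_def [symmetric] using W c1 by simp
  have o2: "0 < orient (P p) (T p True) (T q False)"
    unfolding orient_PTT s W_def [symmetric] using W c2 \<phi>(2)
    by (simp add: mult_less_0_iff zero_less_mult_iff)
  have o3: "0 < orient (P q) (T q False) (P p)"
    unfolding orient_PTP s W_def [symmetric] using W c1 c1'
    by (simp add: mult_less_0_iff zero_less_mult_iff)
  have o4: "orient (P q) (T q False) (T p True) < 0"
    unfolding orient_PTT s W_def [symmetric] using W c2 c2' \<phi>(2)
    by (simp add: mult_less_0_iff zero_less_mult_iff)
  have "orient (P q) (T q False) (P p) * orient (P q) (T q False) (T p True) < 0"
    using o3 o4 by (simp add: mult_less_0_iff)
  then have "open_segment (P p) (T p True) \<inter> open_segment (P q) (T q False) \<noteq> {}"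
    by (rule mutual_sides_meet[OF o1 o2])
  moreover have "P q \<notin> {P p, T p True}" using o1 by auto
  then have "tangent p True \<noteq> tangent q False" unfolding tangent_def closed_segment_eq by blast
  ultimately show ?thesis unfolding crossing_def rel_interior_tangent by blast
qed

text \<open>Some translate of \<open>q\<close> by a multiple of \<open>n\<close> is 1 to
  \<open>n - 1\<close> steps ahead of \<open>p\<close>, which is the position of
  \<open>tangent_crossing_left\<close>. With the signs in the other order the roles are exchanged
  and, if necessary, everything is reflected.\<close>

lemma tangent_crossing:
  assumes "\<not> int n dvd p - q" "a \<noteq> b"
  shows "crossing (tangent p a) (tangent q b) \<or> crossing (tangent p a) (tangent (q + int n) b)"
proof -
  have main: "\<exists>m. int n dvd m \<and> crossing (tangent p True) (tangent (q + m) False)" if nd: "\<not> int n dvd p - q" for p q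
  proof -
    define m where "m = (p - q) - (p - q) mod int n"
    have dv: "int n dvd m" by (simp add: m_def minus_mod_eq_mult_div)
    have "(p - q) mod int n \<noteq> 0" using nd by (simp add: dvd_eq_mod_eq_0)
    moreover have "0 \<le> (p - q) mod int n" "(p - q) mod int n < int n" using n by simp_all
    ultimately have "1 \<le> q + (m + int n) - p" "q + (m + int n) - p < int n" by (auto simp: m_def)
    then have "crossing (tangent p True) (tangent (q + (m + int n)) False)" by (rule tangent_crossing_left)
    then show ?thesis using dv by (metis dvd_add dvd_refl)
  qed
  \<comment> \<open>Even multiples of \<open>n\<close> give the same chord, odd ones its
    reflection.\<close>
  have par: "tangent (k + m) x = tangent k x \<or> tangent (k + m) x = tangent (k + int n) x" if dv: "int n dvd m" for k m x
  proof -
    obtain z where z: "m = int n * z" using dv by blast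
    show ?thesis
    proof (cases "even z")
      case True
      then have "2 * int n dvd m" using z by auto
      then show ?thesis using tangent_shift by blast
    next
      case False
      then have "2 * int n dvd m - int n" using z by (auto elim!: oddE simp: algebra_simps)
      then have "tangent ((k + int n) + (m - int n)) x = tangent (k + int n) x" by (rule tangent_shift)
      then show ?thesis by simp
    qed
  qed
  show ?thesis
  proof (cases a)
    case True
    then show ?thesis using main[OF assms(1)] par[of _ q False] assms(2) by metis
  next
    case False
    have "\<not> int n dvd q - p" using assms(1) by (simp add: dvd_diff_commute)
    then obtain m where m: "int n dvd m" "crossing (tangent q True) (tangent (p + m) False)" using main by blast
    have c: "crossing (tangent (p + m) False) (tangent q True)" using m(2) by (rule crossing_sym)
    show ?thesis
    proof (cases "tangent (p + m) False = tangent p False")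
      case True
      then show ?thesis using c False assms(2) by auto
    next
      case F: False
      then have e: "tangent (p + m) False = tangent (p + int n) False" using par[OF m(1)] by blast
      have refl: "point_reflection c ` tangent k x = tangent (k + int n) x" for k x
        unfolding tangent_def reflection_closed_segment reflect_P reflect_T ..
      have "crossing (point_reflection c ` tangent (p + int n) False) (point_reflection c ` tangent q True)"
        using c unfolding e crossing_reflection .
      moreover have "tangent (p + int n + int n) False = tangent p False"
        using tangent_shift[of "2 * int n" p False] by (simp add: algebra_simps)
      ultimately show ?thesis unfolding refl using False assms(2) by auto
    qed
  qed
qed

text \<open>The center is on the left, being the midpoint of \<open>P i\<close> and
  \<open>P (i + n)\<close>. A point of the disk that is not would yield a point of the disk on the
  line, hence on the short diagonal.\<close>

lemma disk_side:
  assumes ij: "2 \<le> j - i" "j - i < int n" and t: "t \<in> cball c r"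
  shows "0 < orient (P i) (P j) t"
proof (rule ccontr)
  assume neg: "\<not> ?thesis"
  have "c = (1 - 1 / 2) *\<^sub>R P i + (1 / 2) *\<^sub>R P (i + int n)"
    using reflect_P[of i] by (simp add: point_reflection_def scaleR_conv_of_real field_simps)
  then have "orient (P i) (P j) c = orient (P i) (P j) (P (i + int n)) / 2" by (metis orient_affine orient_simps(2) add_0 mult_zero_right mult.commute mult_1_right times_divide_eq_right)
  moreover have "0 < orient (P i) (P j) (P (i + int n))" using ccw[of i j "i + int n"] ij by simp
  ultimately have oc: "0 < orient (P i) (P j) c" by simp
  have cc: "c \<in> cball c r" using r(1) by simp
  have "\<exists>z. z \<in> cball c r \<and> orient (P i) (P j) z = 0"
  proof (cases "orient (P i) (P j) t = 0")
    case True then show ?thesis using t by blast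
  next
    case False
    then have "orient (P i) (P j) t < 0" using neg by simp
    then obtain z where z: "z \<in> open_segment t c" "orient (P i) (P j) z = 0" using opposite_sides_zero[OF _ oc] by blast
    have "z \<in> cball c r" using z(1) closed_segment_subset[OF t cc convex_cball] open_closed_segment by blast
    then show ?thesis using z by blast
  qed
  then obtain z where z: "z \<in> cball c r" "orient (P i) (P j) z = 0" by blast
  have "z \<in> Q" using z(1) r(2) interior_subset by blast
  then have "z \<in> seg i j" using line_in_segment[OF z(2) _ extreme extreme P_neq] ij by (simp add: seg_def)
  moreover have "seg i j \<in> diagonals Q - long_diagonals c Q" unfolding short_diagonals using ij by blast
  ultimately show False using r(3) z(1) by blast
qed

lemma T_side: "2 \<le> j - i \<Longrightarrow> j - i < int n \<Longrightarrow> 0 < orient (P i) (P j) (T k a)"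
  using disk_side T_dist by simp

lemma seg_neq_tangent: "seg i j \<noteq> tangent k a"
proof
  assume "seg i j = tangent k a"
  then have "T k a \<in> {P i, P j}" unfolding seg_def tangent_def closed_segment_eq by blast
  then show False using T_neq_P by blast
qed

lemma seg_crosses_tangent:
  assumes "2 \<le> j - i" "j - i < int n" "i < p" "p < j"
  shows "crossing (seg i j) (tangent p a)"
proof -
  have "open_segment (P i) (P j) \<inter> open_segment (P p) (T p a) \<noteq> {}"
    by (rule opposite_sides_meet[OF extreme extreme Q P_in T_in orient_right T_side]) (use assms in auto)
  then show ?thesis unfolding crossing_def rel_interior_tangent
    using seg_neq_tangent rel_interior_seg[of i j] assms by auto
qed

lemma seg_not_crosses_tangent:
  assumes "2 \<le> j - i" "j - i < int n" "j \<le> p" "p \<le> i + 2 * int n"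
  shows "\<not> crossing (seg i j) (tangent p a)"
proof -
  have "open_segment (P i) (P j) \<inter> open_segment (P p) (T p a) = {}"
    by (rule disjoint_same_side[where e = 1])
      (use assms T_side[OF assms(1,2), of p a] orient_nonneg[of i j p] in auto)
  then show ?thesis unfolding crossing_def rel_interior_tangent
    using rel_interior_seg[of i j] assms by auto
qed

lemma tangent_eq_iff: "tangent p a = tangent q b \<longleftrightarrow> 2 * int n dvd p - q \<and> a = b"
proof
  assume e: "tangent p a = tangent q b"
  then have pt: "P p = P q" "T p a = T q b"
    unfolding tangent_def closed_segment_eq doubleton_eq_iff using T_neq_P by metis+
  have m: "2 * int n dvd p - q" using pt(1) P_eq_iff by blast
  moreover have "a = b"
  proof (rule ccontr)
    assume ab: "a \<noteq> b"
    have "\<bar>side b * \<phi> - side a * \<phi>\<bar> = 2 * \<phi>" using ab by (rule side_distance)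
    then have "cos \<bar>side b * \<phi> - side a * \<phi>\<bar> < cos 0"
      using \<phi>(3,4) by (simp only:) (intro cos_monotone_0_pi, auto)
    then have "cos (side b * \<phi> - side a * \<phi>) < 1" by simp
    then have "orient (P p) (T p a) (T p b) \<noteq> 0"
      unfolding orient_PTT using \<phi>(2,6) w side_cases[of a] by auto
    moreover have "T p b = T q b"
    proof -
      have "tangent (q + (p - q)) b = tangent q b" using tangent_shift[OF m] by blast
      then show ?thesis unfolding tangent_def closed_segment_eq doubleton_eq_iff using T_neq_P by (metis add.commute diff_add_cancel)
    qed
    ultimately show False using pt by simp
  qed
  ultimately show "2 * int n dvd p - q \<and> a = b" by blast
next
  assume "2 * int n dvd p - q \<and> a = b"
  then show "tangent p a = tangent q b" using tangent_shift[of "p - q" q b] by simp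
qed

text \<open>For a point of the circle in direction \<open>\<tau>\<close>, orthogonality to the
  radius reads \<open>cos (ang p - \<tau>) = cos \<phi>\<close>. So \<open>\<tau>\<close> differs
  from \<open>ang p\<close> by \<open>\<phi>\<close> on one side or the other, up to full
  turns.\<close>

lemma tangent_chords_eq: "tangent_chords c r Q = {tangent p a | p a. True}"
proof (intro equalityI subsetI)
  fix s assume "s \<in> tangent_chords c r Q"
  then obtain p t where t: "s = closed_segment (P p) t" "dist c t = r" "(P p - t) \<bullet> (t - c) = 0"
    unfolding tangent_chords_def vertices by auto
  define z where "z = (t - c) / (w * of_real (cos \<phi>))"
  have w0: "0 < cmod w" using w by simp
  have tz: "t = c + w * (of_real (cos \<phi>) * z)" using w \<phi>(2) by (simp add: z_def field_simps)
  have "cmod w * (cos \<phi> * cmod z) = r" using t(2) \<phi>(2) unfolding tz by (simp add: dist_norm norm_mult)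
  then have "cmod z = 1" using \<phi>(1) r(1) w0 by simp
  then obtain \<tau> where \<tau>: "z = cis \<tau>" using complex_unit_circle by (metis cis_Arg sgn_eq div_by_1 norm_zero zero_neq_one of_real_1)
  have "(P p - t) \<bullet> (t - c) = (cmod w)\<^sup>2 * (cos \<phi> * (cos (ang p - \<tau>) - cos \<phi>))"
  proof -
    have "(w * x) \<bullet> (w * y) = (cmod w)\<^sup>2 * (x \<bullet> y)" for x y
      unfolding cmod_power2 inner_complex_def by (simp add: algebra_simps power2_eq_square)
    moreover have "P p - t = w * (cis (ang p) - of_real (cos \<phi>) * cis \<tau>)" unfolding P_def tz \<tau> by (simp add: algebra_simps)
    moreover have "t - c = w * (of_real (cos \<phi>) * cis \<tau>)" unfolding tz \<tau> by simp
    moreover have "(cis (ang p) - of_real (cos \<phi>) * cis \<tau>) \<bullet> (of_real (cos \<phi>) * cis \<tau>) = cos \<phi> * (cos (ang p - \<tau>) - cos \<phi>)"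
    proof -
      have "sin \<tau> * sin \<tau> + cos \<tau> * cos \<tau> = 1" using sin_cos_squared_add[of \<tau>] by (simp add: power2_eq_square)
      then show ?thesis unfolding inner_complex_def cos_diff by simp algebra
    qed
    ultimately show ?thesis by simp
  qed
  then have "cos (ang p - \<tau>) = cos \<phi>" using t(3) \<phi>(2) w0 by simp
  then obtain x where x: "x \<in> \<int>" "ang p - \<tau> = \<phi> + 2 * x * pi \<or> ang p - \<tau> = - \<phi> + 2 * x * pi"
    unfolding cos_eq by blast
  have cx: "cis (2 * x * pi) = 1" using cis_multiple_2pi[OF x(1)] by (simp add: mult_ac)
  define a where "a = (ang p - \<tau> = - \<phi> + 2 * x * pi)"
  have "ang p + side a * \<phi> = \<tau> + 2 * x * pi" using x(2) by (auto simp: a_def side_def)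
  then have "cis (ang p + side a * \<phi>) = cis \<tau>" using cx by (simp add: cis_mult [symmetric])
  then have "t = T p a" unfolding tz \<tau> T_def by simp
  then show "s \<in> {tangent p a | p a. True}" unfolding t(1) tangent_def by blast
next
  fix s assume "s \<in> {tangent p a | p a. True}"
  then obtain p a where s: "s = tangent p a" by blast
  have "(P p - T p a) \<bullet> (T p a - c) = 0"
  proof -
    have "(w * x) \<bullet> (w * y) = (cmod w)\<^sup>2 * (x \<bullet> y)" for x y
      unfolding cmod_power2 inner_complex_def by (simp add: algebra_simps power2_eq_square)
    moreover have "P p - T p a = w * (cis (ang p) - of_real (cos \<phi>) * cis (ang p + side a * \<phi>))"
      unfolding P_def T_def right_diff_distrib by simp
    moreover have "T p a - c = w * (of_real (cos \<phi>) * cis (ang p + side a * \<phi>))" unfolding T_def by simp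
    moreover have "(cis (ang p) - of_real (cos \<phi>) * cis \<tau>) \<bullet> (of_real (cos \<phi>) * cis \<tau>) = cos \<phi> * (cos (ang p - \<tau>) - cos \<phi>)" for \<tau>
    proof -
      have "sin \<tau> * sin \<tau> + cos \<tau> * cos \<tau> = 1" using sin_cos_squared_add[of \<tau>] by (simp add: power2_eq_square)
      then show ?thesis unfolding inner_complex_def cos_diff by simp algebra
    qed
    moreover have "cos (ang p - (ang p + side a * \<phi>)) = cos \<phi>" using cos_side_\<phi> by simp
    ultimately show ?thesis by simp
  qed
  then show "s \<in> tangent_chords c r Q"
    unfolding tangent_chords_def vertices s tangent_def using T_dist[of p a] by auto
qed

end

section \<open>From combinatorics to chords\<close>

lemma shortest_exists:
  assumes "walk cr D ts"
  obtains us where "shortest cr D us" "hd us = hd ts" "last us = last ts"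
proof -
  let ?P = "\<lambda>us. walk cr D us \<and> hd us = hd ts \<and> last us = last ts"
  have P: "?P ts" using assms by simp
  define us where "us = arg_min length ?P"
  have "?P us" unfolding us_def by (rule arg_min_natI[of ?P, OF P])
  moreover have "length us \<le> length vs" if "?P vs" for vs
    unfolding us_def by (rule arg_min_nat_le[of ?P, OF that])
  ultimately show ?thesis using that[of us] unfolding shortest_def by simp
qed

text \<open>Inserting \<open>e\<close> identifies the triangulations of the link with those
  containing \<open>e\<close>. Shortest walks between the latter keep \<open>e\<close> throughout,
  so deleting \<open>e\<close> turns them into walks of the link. Hence distances agree, a shortest
  walk of the link stays shortest after inserting \<open>e\<close>, and it inherits the
  property.\<close>

lemma (in crossing_system)
  fixes e :: 'a
  defines "D' \<equiv> {x \<in> D. x \<noteq> e \<and> \<not> cr x e}"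
  assumes e: "e \<in> D" and nl: "non_leaving cr D"
  shows crossing_system_link: "crossing_system cr D'" and non_leaving_link: "non_leaving cr D'"
proof -
  have up: "insert e T \<in> tri cr D" if T: "T \<in> tri cr D'" for T
  proof -
    have s: "T \<subseteq> D'" "\<And>x y. x \<in> T \<Longrightarrow> y \<in> T \<Longrightarrow> \<not> cr x y"
      "\<And>z. z \<in> D' \<Longrightarrow> (\<And>x. x \<in> T \<Longrightarrow> \<not> cr z x) \<Longrightarrow> z \<in> T"
      using T unfolding tri_def by blast+
    have ce: "\<not> cr x e" "\<not> cr e x" if "x \<in> T" for x using that s(1) cr_sym unfolding D'_def by blast+
    have "z \<in> insert e T" if "z \<in> D" "\<forall>x\<in>insert e T. \<not> cr z x" for z
      using that s(3)[of z] unfolding D'_def by blast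
    then show ?thesis unfolding tri_def using s(1,2) ce e cr_irrefl[OF e] unfolding D'_def by blast
  qed
  have down: "S - {e} \<in> tri cr D'" if S: "S \<in> tri cr D" "e \<in> S" for S
  proof -
    have "S - {e} \<subseteq> D'" using triD(1,2)[OF S(1)] S(2) unfolding D'_def by blast
    moreover have "z \<in> S - {e}" if z: "z \<in> D'" "\<forall>x\<in>S - {e}. \<not> cr z x" for z
      using triD(3)[OF S(1), of z] z unfolding D'_def by blast
    ultimately show ?thesis using triD(2)[OF S(1)] unfolding tri_def by blast
  qed
  have notin: "e \<notin> T" if "T \<in> tri cr D'" for T using that unfolding tri_def D'_def by blast
  show "crossing_system cr D'"
  proof
    show "cr x y \<Longrightarrow> cr y x" for x y by (rule cr_sym)
    show "x \<in> D' \<Longrightarrow> \<not> cr x x" for x using cr_irrefl unfolding D'_def by blast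
    fix S S' x y y'
    assume a: "S \<in> tri cr D'" "S' \<in> tri cr D'" "x \<in> S" "S - {x} \<subseteq> S'" "y \<in> S' - S" "y' \<in> S' - S"
    show "y = y'"
      by (rule unique_exchange[OF up[OF a(1)] up[OF a(2)], of x]) (use a notin in blast)+
  qed
  have wup: "walk cr D (map (insert e) ts)" if w: "walk cr D' ts" for ts
  proof -
    have "successively (\<lambda>S S'. exchange (insert e S) (insert e S')) ts"
    proof (rule successively_mono)
      show "successively exchange ts" using w by (simp add: walk_def)
      fix S S' assume S: "S \<in> set ts" "S' \<in> set ts" "exchange S S'"
      have e: "e \<notin> S" "e \<notin> S'" using notin w S(1,2) by (auto simp: walk_def)
      obtain x y where xy: "x \<in> S" "y \<notin> S" "S' = insert y (S - {x})" using S(3) unfolding exchange_def by blast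
      then show "exchange (insert e S) (insert e S')" unfolding exchange_def
        using e by (intro bexI[of _ x] exI[of _ y]) auto
    qed
    then show ?thesis using w up unfolding walk_def by (auto simp: successively_map)
  qed
  have wdown: "walk cr D' (map (\<lambda>S. S - {e}) us)" if w: "walk cr D us" "\<forall>S\<in>set us. e \<in> S" for us
  proof -
    have "successively (\<lambda>S S'. exchange (S - {e}) (S' - {e})) us"
    proof (rule successively_mono)
      show "successively exchange us" using w by (simp add: walk_def)
      fix S S' assume S: "S \<in> set us" "S' \<in> set us" "exchange S S'"
      have "e \<in> S" "e \<in> S'" using w S by blast+
      obtain x y where xy: "x \<in> S" "y \<notin> S" "S' = insert y (S - {x})" using S(3) unfolding exchange_def by blast
      have "x \<noteq> e" "y \<noteq> e" using xy \<open>e \<in> S\<close> \<open>e \<in> S'\<close> by auto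
      then show "exchange (S - {e}) (S' - {e})" unfolding exchange_def
        using xy by (intro bexI[of _ x] exI[of _ y]) auto
    qed
    then show ?thesis using w down unfolding walk_def by (auto simp: successively_map)
  qed
  show "non_leaving cr D'" unfolding non_leaving_def
  proof (intro allI impI ballI)
    fix ts S assume sh: "shortest cr D' ts" and S: "S \<in> set ts"
    have w: "walk cr D' ts" and ne: "ts \<noteq> []" using sh by (simp_all add: shortest_def walk_def)
    let ?ts = "map (insert e) ts"
    have "length ?ts \<le> length us" if us: "walk cr D us" "hd us = hd ?ts" "last us = last ?ts" for us
    proof -
      obtain vs where vs: "shortest cr D vs" "hd vs = hd us" "last vs = last us"
        by (rule shortest_exists[OF us(1)])
      have wv: "walk cr D vs" "vs \<noteq> []" using vs(1) by (simp_all add: shortest_def walk_def)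
      have ends: "hd vs = insert e (hd ts)" "last vs = insert e (last ts)"
        using vs us ne by (simp_all add: hd_map last_map)
      then have "\<forall>S\<in>set vs. e \<in> S" using nl vs(1) unfolding non_leaving_def by blast
      then have w': "walk cr D' (map (\<lambda>S. S - {e}) vs)" using wdown wv(1) by blast
      have "hd ts \<in> tri cr D'" "last ts \<in> tri cr D'" using w ne by (auto simp: walk_def)
      then have "e \<notin> hd ts" "e \<notin> last ts" using notin by blast+
      then have "hd (map (\<lambda>S. S - {e}) vs) = hd ts" "last (map (\<lambda>S. S - {e}) vs) = last ts"
        using ends wv(2) by (simp_all add: hd_map last_map)
      then have "length ts \<le> length vs" using sh w' unfolding shortest_def by fastforce
      moreover have "length vs \<le> length us" using vs us(1) unfolding shortest_def by simp
      ultimately show ?thesis by simp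
    qed
    then have "shortest cr D ?ts" using wup[OF w] unfolding shortest_def by blast
    then have "hd ?ts \<inter> last ?ts \<subseteq> insert e S" using nl S unfolding non_leaving_def by simp
    moreover have "e \<notin> hd ts" by (rule notin) (use w ne in \<open>auto simp: walk_def\<close>)
    ultimately show "hd ts \<inter> last ts \<subseteq> S" using ne by (auto simp: hd_map last_map)
  qed
qed

section \<open>Transfer to sets of chords\<close>

definition symmetric_triangulations :: "(chord \<Rightarrow> chord) \<Rightarrow> chord set \<Rightarrow> chord set set" where
  "symmetric_triangulations \<sigma> Ch = {T. T \<subseteq> Ch \<and> crossing_free T \<and> \<sigma> ` T = T \<and>
     (\<forall>X. T \<subseteq> X \<and> X \<subseteq> Ch \<and> crossing_free X \<and> \<sigma> ` X = X \<longrightarrow> X = T)}"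

text \<open>\<open>\<sigma>\<close> is the reflection for types B/C and D and the identity for type
  A, where \<open>h X\<close> becomes a singleton; one transfer serves all types.\<close>

locale chord_model = crossing_system cr D for cr :: "'a \<Rightarrow> 'a \<Rightarrow> bool" and D +
  fixes h :: "'a \<Rightarrow> chord set" and \<sigma> :: "chord \<Rightarrow> chord" and Ch :: "chord set"
  assumes non_leaving: "non_leaving cr D"
    and \<sigma>: "s \<in> Ch \<Longrightarrow> \<sigma> s \<in> Ch" "s \<in> Ch \<Longrightarrow> \<sigma> (\<sigma> s) = s"
    and h: "X \<in> D \<Longrightarrow> \<exists>s\<in>Ch. h X = {s, \<sigma> s}"
    and h_surj: "s \<in> Ch \<Longrightarrow> \<exists>X\<in>D. h X = {s, \<sigma> s}"
    and h_inj: "X \<in> D \<Longrightarrow> Y \<in> D \<Longrightarrow> h X = h Y \<Longrightarrow> X = Y"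
    and h_cr: "X \<in> D \<Longrightarrow> Y \<in> D \<Longrightarrow> cr X Y \<longleftrightarrow> (\<exists>x\<in>h X. \<exists>y\<in>h Y. crossing x y)"
begin

abbreviation "\<T> \<equiv> symmetric_triangulations \<sigma> Ch"

definition \<D> :: "chord set set" where
  "\<D> = {{s, \<sigma> s} | s. s \<in> Ch}"

lemma \<T>D:
  assumes "T \<in> \<T>"
  shows "s \<in> T \<Longrightarrow> s \<in> Ch" "s \<in> T \<Longrightarrow> t \<in> T \<Longrightarrow> \<not> crossing s t" "s \<in> T \<Longrightarrow> \<sigma> s \<in> T"
    "\<lbrakk>T \<subseteq> X; X \<subseteq> Ch; crossing_free X; \<sigma> ` X = X\<rbrakk> \<Longrightarrow> X = T"
proof -
  have T: "T \<subseteq> Ch" "crossing_free T" "\<sigma> ` T = T"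
    "\<forall>X. T \<subseteq> X \<and> X \<subseteq> Ch \<and> crossing_free X \<and> \<sigma> ` X = X \<longrightarrow> X = T"
    using assms unfolding symmetric_triangulations_def by simp_all
  show "s \<in> T \<Longrightarrow> s \<in> Ch" using T(1) by blast
  show "s \<in> T \<Longrightarrow> t \<in> T \<Longrightarrow> \<not> crossing s t" using T(2) unfolding crossing_free_def by blast
  show "s \<in> T \<Longrightarrow> \<sigma> s \<in> T" using T(3) by blast
  show "\<lbrakk>T \<subseteq> X; X \<subseteq> Ch; crossing_free X; \<sigma> ` X = X\<rbrakk> \<Longrightarrow> X = T" using T(4) by simp
qed

lemma h_eq:
  assumes X: "X \<in> D" and s: "s \<in> h X"
  shows "s \<in> Ch" "\<sigma> s \<in> h X" "h X = {s, \<sigma> s}"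
proof -
  obtain t where t: "t \<in> Ch" "h X = {t, \<sigma> t}" using h[OF X] by blast
  then show "s \<in> Ch" "\<sigma> s \<in> h X" "h X = {s, \<sigma> s}" using s \<sigma> by auto
qed

lemma h_nonempty: "X \<in> D \<Longrightarrow> \<exists>s. s \<in> h X"
  using h by blast

lemma h_disjoint: "X \<in> D \<Longrightarrow> Y \<in> D \<Longrightarrow> s \<in> h X \<Longrightarrow> s \<in> h Y \<Longrightarrow> X = Y"
  using h_eq(3)[of X s] h_eq(3)[of Y s] h_inj[of X Y] by simp

lemma h_\<D>: "d \<in> \<D> \<longleftrightarrow> (\<exists>X\<in>D. d = h X)"
proof
  assume "d \<in> \<D>"
  then obtain s where "s \<in> Ch" "d = {s, \<sigma> s}" unfolding \<D>_def by blast
  then show "\<exists>X\<in>D. d = h X" using h_surj[of s] by auto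
next
  assume "\<exists>X\<in>D. d = h X"
  then obtain X where "X \<in> D" "d = h X" by blast
  then show "d \<in> \<D>" using h[of X] unfolding \<D>_def by auto
qed

lemma \<sigma>_closed: "X \<subseteq> Ch \<Longrightarrow> (\<And>s. s \<in> X \<Longrightarrow> \<sigma> s \<in> X) \<Longrightarrow> \<sigma> ` X = X"
proof (intro equalityI subsetI)
  fix s assume X: "X \<subseteq> Ch" "\<And>s. s \<in> X \<Longrightarrow> \<sigma> s \<in> X" and s: "s \<in> X"
  then have "s = \<sigma> (\<sigma> s)" "\<sigma> s \<in> X" using \<sigma>(2)[of s] by auto
  then show "s \<in> \<sigma> ` X" by (rule image_eqI)
qed auto

definition f :: "chord set \<Rightarrow> 'a set" where
  "f T = {X \<in> D. h X \<subseteq> T}"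

lemma Union_f: "T \<in> \<T> \<Longrightarrow> \<Union>(h ` f T) = T"
proof (intro equalityI subsetI)
  fix s assume T: "T \<in> \<T>" and s: "s \<in> T"
  obtain X where "X \<in> D" "h X = {s, \<sigma> s}" using h_surj[OF \<T>D(1)[OF T s]] by blast
  then have "X \<in> f T" "s \<in> h X" using s \<T>D(3)[OF T s] by (simp_all add: f_def)
  then show "s \<in> \<Union>(h ` f T)" by (rule UN_I)
qed (auto simp: f_def)

lemma f_Union: "A \<subseteq> D \<Longrightarrow> f (\<Union>(h ` A)) = A"
proof (intro equalityI subsetI)
  fix X assume A: "A \<subseteq> D" and "X \<in> f (\<Union>(h ` A))"
  then have X: "X \<in> D" "h X \<subseteq> \<Union>(h ` A)" by (simp_all add: f_def)
  obtain s where s: "s \<in> h X" using h_nonempty[OF X(1)] by blast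
  then obtain Y where Y: "Y \<in> A" "s \<in> h Y" using X(2) by blast
  then show "X \<in> A" using h_disjoint[OF X(1) _ s Y(2)] A by blast
qed (auto simp: f_def)

lemma no_self_crossing: "s \<in> Ch \<Longrightarrow> \<not> crossing s (\<sigma> s)"
proof -
  assume "s \<in> Ch"
  then obtain X where X: "X \<in> D" "h X = {s, \<sigma> s}" using h_surj[of s] by blast
  then show ?thesis using h_cr[OF X(1) X(1)] cr_irrefl[OF X(1)] by simp
qed

lemma Union_\<T>:
  assumes A: "A \<in> tri cr D"
  shows "\<Union>(h ` A) \<in> \<T>"
proof -
  have AD: "A \<subseteq> D" using triD(1)[OF A] by blast
  have sub: "\<Union>(h ` A) \<subseteq> Ch" using AD h_eq(1) by blast
  have "X = \<Union>(h ` A)" if X: "\<Union>(h ` A) \<subseteq> X" "X \<subseteq> Ch" "crossing_free X" "\<sigma> ` X = X" for X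
  proof -
    have "s \<in> \<Union>(h ` A)" if s: "s \<in> X" for s
    proof -
      obtain Z where Z: "Z \<in> D" "h Z = {s, \<sigma> s}" using h_surj[of s] s X(2) by blast
      have "\<sigma> s \<in> X" using imageI[OF s, of \<sigma>] unfolding X(4) .
      then have ZX: "h Z \<subseteq> X" using Z(2) s by simp
      have "\<not> cr Z Y" if Y: "Y \<in> A" for Y
      proof
        assume "cr Z Y"
        then obtain a b where "a \<in> h Z" "b \<in> h Y" "crossing a b" using h_cr[OF Z(1), of Y] Y AD by blast
        moreover from this have "a \<in> X" "b \<in> X" using ZX X(1) Y by blast+
        ultimately show False using X(3) unfolding crossing_free_def by blast
      qed
      then have "Z \<in> A" using triD(3)[OF A Z(1)] by blast
      moreover have "s \<in> h Z" using Z(2) by simp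
      ultimately show ?thesis by (rule UN_I)
    qed
    then show ?thesis using X(1) by blast
  qed
  moreover have "crossing_free (\<Union>(h ` A))" unfolding crossing_free_def
  proof (intro ballI notI)
    fix s t assume s: "s \<in> \<Union>(h ` A)" and t: "t \<in> \<Union>(h ` A)" and c: "crossing s t"
    obtain X Y where XY: "X \<in> A" "s \<in> h X" "Y \<in> A" "t \<in> h Y" using s t by blast
    then have "cr X Y" using iffD2[OF h_cr[of X Y]] AD c by blast
    then show False using triD(2)[OF A XY(1,3)] by simp
  qed
  moreover have "\<sigma> ` \<Union>(h ` A) = \<Union>(h ` A)"
    by (rule \<sigma>_closed[OF sub]) (use AD h_eq(2) in blast)
  ultimately show ?thesis using sub unfolding symmetric_triangulations_def by simp
qed

lemma f_tri:
  assumes T: "T \<in> \<T>"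
  shows "f T \<in> tri cr D"
proof -
  have "\<not> cr X Y" if XY: "X \<in> f T" "Y \<in> f T" for X Y
  proof
    assume "cr X Y"
    moreover have D: "X \<in> D" "Y \<in> D" "h X \<subseteq> T" "h Y \<subseteq> T" using XY by (simp_all add: f_def)
    ultimately obtain a b where ab: "a \<in> h X" "b \<in> h Y" "crossing a b"
      using h_cr[of X Y] by blast
    then have "a \<in> T" "b \<in> T" using D by blast+
    then show False using \<T>D(2)[OF T] ab(3) by blast
  qed
  moreover have "Z \<in> f T" if Z: "Z \<in> D" "\<forall>X\<in>f T. \<not> cr Z X" for Z
  proof -
    have n: "\<not> crossing s t" if s: "s \<in> h Z" and t: "t \<in> T" for s t
    proof -
      have "t \<in> \<Union>(h ` f T)" using t Union_f[OF T] by simp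
      then obtain X where X: "X \<in> f T" "t \<in> h X" by blast
      have XD: "X \<in> D" using X(1) by (simp add: f_def)
      have "\<not> cr Z X" using Z(2) X(1) by blast
      then show ?thesis unfolding h_cr[OF Z(1) XD] using s X(2) by blast
    qed
    have n': "\<not> crossing t s" if "s \<in> h Z" "t \<in> T" for s t using n[OF that] crossing_sym by blast
    have nZ: "\<not> crossing s t" if "s \<in> h Z" "t \<in> h Z" for s t
      using cr_irrefl[OF Z(1)] that unfolding h_cr[OF Z(1) Z(1)] by blast
    have c: "T \<union> h Z \<subseteq> Ch" using \<T>D(1)[OF T] h_eq(1)[OF Z(1)] by blast
    have "T \<union> h Z = T"
    proof (rule \<T>D(4)[OF T _ c])
      show "crossing_free (T \<union> h Z)" unfolding crossing_free_def using \<T>D(2)[OF T] n n' nZ by blast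
      show "\<sigma> ` (T \<union> h Z) = T \<union> h Z"
        by (rule \<sigma>_closed[OF c]) (use \<T>D(3)[OF T] h_eq(2)[OF Z(1)] in blast)
    qed simp
    then show ?thesis using Z(1) by (auto simp: f_def)
  qed
  moreover have "f T \<subseteq> D" by (auto simp: f_def)
  ultimately show ?thesis unfolding tri_def by simp
qed

text \<open>Distinct elements of \<open>D\<close> have disjoint chord sets, so replacing
  \<open>X\<close> by \<open>Y\<close> in \<open>f T\<close> is the same as replacing the chords
  \<open>h X\<close> by \<open>h Y\<close> in \<open>T\<close>.\<close>

lemma exchange_f:
  assumes T: "T \<in> \<T>" and T': "T' \<in> \<T>"
  shows "exchange (f T) (f T') \<longleftrightarrow> flip_adjacent \<T> \<D> T T'"
proof
  assume "exchange (f T) (f T')"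
  then obtain X Y where XY: "X \<in> f T" "Y \<notin> f T" "f T' = insert Y (f T - {X})" unfolding exchange_def by blast
  have X: "X \<in> D" "h X \<subseteq> T" and Y: "Y \<in> D" using XY(1,3) unfolding f_def by blast+
  have "s \<notin> h X" if "Z \<in> f T" "Z \<noteq> X" "s \<in> h Z" for Z s
    using that h_disjoint[of Z X s] X(1) by (auto simp: f_def)
  then have "\<Union>(h ` (f T - {X})) = \<Union>(h ` f T) - h X" by blast
  then have e: "T' = (T - h X) \<union> h Y" using Union_f[OF T] Union_f[OF T'] XY(3) by auto
  have ne: "h Y \<noteq> h X" using h_inj[OF Y X(1)] XY by blast
  have XY\<D>: "h X \<in> \<D>" "h Y \<in> \<D>" using h_\<D> X(1) Y by blast+
  have "flips \<T> \<D> (h X) T T'" unfolding flips_def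
    by (intro conjI bexI[of _ "h Y"]) (fact T T' X(2) ne e XY\<D>)+
  then show "flip_adjacent \<T> \<D> T T'" unfolding flip_adjacent_def by blast
next
  assume "flip_adjacent \<T> \<D> T T'"
  then obtain d d' where d: "d \<in> \<D>" "d' \<in> \<D>" "d \<subseteq> T" "d' \<noteq> d" "T' = (T - d) \<union> d'"
    unfolding flip_adjacent_def flips_def by blast
  obtain X where X: "X \<in> D" "d = h X" using iffD1[OF h_\<D> d(1)] by blast
  obtain Y where Y: "Y \<in> D" "d' = h Y" using iffD1[OF h_\<D> d(2)] by blast
  have XY: "X \<noteq> Y" using d(4) X Y by blast
  have Xf: "X \<in> f T" using X d(3) by (simp add: f_def)
  have Xf': "X \<notin> f T'"
  proof
    assume "X \<in> f T'"
    then have "h X \<subseteq> (T - h X) \<union> h Y" using X d(5) Y(2) by (simp add: f_def)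
    then show False using h_nonempty[OF X(1)] h_disjoint[OF X(1) Y(1)] XY by blast
  qed
  have e: "f T' = insert Y (f T - {X})"
  proof (intro equalityI subsetI)
    fix Z assume Z: "Z \<in> f T'"
    have ZD: "Z \<in> D" using Z unfolding f_def by blast
    have "h Z \<subseteq> T" if "Z \<noteq> Y"
    proof
      fix s assume s: "s \<in> h Z"
      then have "s \<in> T'" using Z unfolding f_def by blast
      moreover have "s \<notin> h Y" using h_disjoint[OF ZD Y(1) s] that by blast
      ultimately show "s \<in> T" using d(5) Y(2) by blast
    qed
    then show "Z \<in> insert Y (f T - {X})" using Xf' Z ZD unfolding f_def by blast
  next
    fix Z assume Z: "Z \<in> insert Y (f T - {X})"
    show "Z \<in> f T'"
    proof (cases "Z = Y")
      case True
      then show ?thesis using Y d(5) unfolding f_def by blast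
    next
      case False
      then have ZT: "Z \<in> D" "h Z \<subseteq> T" "Z \<noteq> X" using Z by (auto simp: f_def)
      have "s \<notin> h X" if "s \<in> h Z" for s using h_disjoint[OF ZT(1) X(1) that] ZT(3) by blast
      then have "h Z \<subseteq> T'" using ZT(2) d(5) X(2) by blast
      then show ?thesis using ZT(1) by (simp add: f_def)
    qed
  qed
  moreover have "Y \<notin> f T"
  proof
    assume "Y \<in> f T"
    then have "f T' \<subseteq> f T" unfolding e by blast
    then have "f T' = f T" by (rule tri_subset_eq[OF f_tri[OF T'] f_tri[OF T]])
    then show False using Xf Xf' by simp
  qed
  ultimately show "exchange (f T) (f T')" unfolding exchange_def using Xf by blast
qed

lemma shortest_f:
  assumes g: "geodesic \<T> \<D> T ts T'"
  shows "shortest cr D (map f ts)"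
proof -
  have p: "ts \<noteq> []" "set ts \<subseteq> \<T>" "successively (flip_adjacent \<T> \<D>) ts" "hd ts = T" "last ts = T'"
    using g unfolding geodesic_def flip_path_def by blast+
  have "successively (\<lambda>S S'. exchange (f S) (f S')) ts"
    by (rule successively_mono[OF p(3)]) (use exchange_f p(2) in blast)
  then have w: "walk cr D (map f ts)" using p f_tri unfolding walk_def by (auto simp: successively_map)
  have "length ts \<le> length us"
    if us: "walk cr D us" "hd us = hd (map f ts)" "last us = last (map f ts)" for us
  proof -
    let ?g = "\<lambda>A. \<Union>(h ` A)"
    have u: "us \<noteq> []" "set us \<subseteq> tri cr D" "successively exchange us" using us(1) unfolding walk_def by blast+
    have fg: "f (?g A) = A" if "A \<in> set us" for A
      by (rule f_Union) (use that u(2) triD(1) in blast)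
    have "successively (\<lambda>A B. flip_adjacent \<T> \<D> (?g A) (?g B)) us"
    proof (rule successively_mono[OF u(3)])
      fix A B assume "A \<in> set us" "B \<in> set us" "exchange A B"
      then show "flip_adjacent \<T> \<D> (?g A) (?g B)"
        using exchange_f[OF Union_\<T> Union_\<T>, of A B] fg u(2) by auto
    qed
    moreover have "hd (map ?g us) = T" "last (map ?g us) = T'"
    proof -
      have "T \<in> \<T>" "T' \<in> \<T>" using p by auto
      then show "hd (map ?g us) = T" "last (map ?g us) = T'"
        using us(2,3) u(1) p Union_f by (simp_all add: hd_map last_map)
    qed
    ultimately have "flip_path \<T> \<D> T (map ?g us) T'"
      unfolding flip_path_def using u Union_\<T> by (auto simp: successively_map)
    then show ?thesis using g unfolding geodesic_def by fastforce
  qed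
  then show ?thesis using w unfolding shortest_def by simp
qed

theorem geodesics_preserve_common_diagonals:
  "non_leaving_face_property \<T> \<D>" "common_diagonals_never_flipped \<T> \<D>"
proof -
  have main: "T \<inter> T' \<subseteq> S" if g: "geodesic \<T> \<D> T ts T'" and S: "S \<in> set ts" for T T' ts S
  proof
    fix s assume s: "s \<in> T \<inter> T'"
    have p: "ts \<noteq> []" "set ts \<subseteq> \<T>" "hd ts = T" "last ts = T'"
      using g unfolding geodesic_def flip_path_def by blast+
    have T: "T \<in> \<T>" "T' \<in> \<T>" using p by auto
    have "f S \<in> set (map f ts)" using S by simp
    then have "hd (map f ts) \<inter> last (map f ts) \<subseteq> f S"
      using non_leaving shortest_f[OF g] unfolding non_leaving_def by blast
    then have sub: "f T \<inter> f T' \<subseteq> f S" using p by (simp add: hd_map last_map)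
    obtain X where X: "X \<in> D" "h X = {s, \<sigma> s}" using h_surj[of s] \<T>D(1)[OF T(1), of s] s by blast
    have "X \<in> f T \<inter> f T'" using X s \<T>D(3)[OF T(1), of s] \<T>D(3)[OF T(2), of s] by (simp add: f_def)
    then have "X \<in> f S" using sub by blast
    then show "s \<in> S" using X(2) by (simp add: f_def)
  qed
  show "non_leaving_face_property \<T> \<D>" unfolding non_leaving_face_property_def
  proof (intro ballI allI impI subsetI)
    fix T T' ts S assume g: "geodesic \<T> \<D> T ts T'" and S: "S \<in> set ts"
    have "S \<in> \<T>" using g S unfolding geodesic_def flip_path_def by blast
    then show "S \<in> minimal_face \<T> \<D> T T'"
      unfolding minimal_face_def is_face_def using main[OF g S] by blast
  qed
  show "common_diagonals_never_flipped \<T> \<D>" unfolding common_diagonals_never_flipped_def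
  proof (intro ballI allI impI conjI)
    fix T T' ts d i
    assume g: "geodesic \<T> \<D> T ts T'" and d: "d \<in> \<D>" "d \<subseteq> T \<inter> T'" and i: "Suc i < length ts"
    show "\<not> flips \<T> \<D> d (ts ! i) (ts ! Suc i)"
    proof
      assume "flips \<T> \<D> d (ts ! i) (ts ! Suc i)"
      then obtain d' where d': "d' \<in> \<D>" "d' \<noteq> d" "ts ! Suc i = (ts ! i - d) \<union> d'" unfolding flips_def by blast
      \<comment> \<open>A common diagonal must still be there after its own flip, hence inside the
        inserted \<open>d'\<close>, although different diagonals share no chord.\<close>
      have "d \<subseteq> ts ! Suc i" using main[OF g nth_mem[OF i]] d(2) by blast
      then have "d \<subseteq> d'" using d'(3) by blast
      moreover obtain X Y where "X \<in> D" "d = h X" "Y \<in> D" "d' = h Y"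
        using iffD1[OF h_\<D> d(1)] iffD1[OF h_\<D> d'(1)] by blast
      ultimately show False using h_nonempty h_disjoint d'(2) by blast
    qed
  qed (use main in blast)
qed

text \<open>This bridges the definition for type B/C, which demands maximality among all
  crossing-free sets. A chord compatible with a symmetric \<open>T\<close> has a compatible
  reflection, which it does not cross, so both could be added symmetrically.\<close>

lemma maximal_symmetric:
  assumes inv: "\<And>s t. crossing (\<sigma> s) (\<sigma> t) \<longleftrightarrow> crossing s t"
  shows "\<T> = {T. T \<subseteq> Ch \<and> crossing_free T \<and> \<sigma> ` T = T \<and> (\<forall>X. T \<subseteq> X \<and> X \<subseteq> Ch \<and> crossing_free X \<longrightarrow> X = T)}"
proof -
  have "X = T" if T: "T \<in> \<T>" and X: "T \<subseteq> X" "X \<subseteq> Ch" "crossing_free X" for T X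
  proof -
    have "s \<in> T" if s: "s \<in> X" for s
    proof -
      have sC: "s \<in> Ch" using s X by blast
      have n: "\<not> crossing s t" if "t \<in> T" for t using that s X unfolding crossing_free_def by blast
      have n': "\<not> crossing (\<sigma> s) t" if "t \<in> T" for t
        using inv[of s "\<sigma> t"] n[OF \<T>D(3)[OF T that]] \<sigma>(2)[OF \<T>D(1)[OF T that]] by simp
      have self: "\<not> crossing x x" for x unfolding crossing_def by simp
      have c: "T \<union> {s, \<sigma> s} \<subseteq> Ch" using \<T>D(1)[OF T] sC \<sigma>(1) by blast
      have "T \<union> {s, \<sigma> s} = T"
      proof (rule \<T>D(4)[OF T _ c])
        show "crossing_free (T \<union> {s, \<sigma> s})"
          unfolding crossing_free_def using \<T>D(2)[OF T] n n' no_self_crossing[OF sC] self crossing_sym by blast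
        show "\<sigma> ` (T \<union> {s, \<sigma> s}) = T \<union> {s, \<sigma> s}"
          by (rule \<sigma>_closed[OF c]) (use \<T>D(3)[OF T] \<sigma>(2)[OF sC] in auto)
      qed blast
      then show ?thesis by blast
    qed
    then show ?thesis using X(1) by blast
  qed
  note max = this
  show ?thesis
  proof (intro set_eqI iffI)
    fix T assume T: "T \<in> \<T>"
    then have "T \<subseteq> Ch \<and> crossing_free T \<and> \<sigma> ` T = T" unfolding symmetric_triangulations_def by simp
    then show "T \<in> {T. T \<subseteq> Ch \<and> crossing_free T \<and> \<sigma> ` T = T \<and>
        (\<forall>X. T \<subseteq> X \<and> X \<subseteq> Ch \<and> crossing_free X \<longrightarrow> X = T)}"
      using max[OF T] by simp
  qed (simp add: symmetric_triangulations_def)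
qed

end

text \<open>Translation by \<open>n\<close> acts on chords as \<open>\<sigma>\<close>, so an orbit
  corresponds to a chord and its reflection. The second alternative in the last hypothesis is for
  tangent chords: \<open>crs\<close> sees their vertices only modulo \<open>n\<close>, so a given
  lift may meet just the reflected copy.\<close>

lemma (in cover) chord_model_orbits:
  assumes \<sigma>: "\<And>s. s \<in> Ch \<Longrightarrow> \<sigma> (\<sigma> s) = s"
    and g: "\<And>x. valid x \<Longrightarrow> g x \<in> Ch" "\<And>s. s \<in> Ch \<Longrightarrow> \<exists>x. valid x \<and> g x = s"
    and g_shift: "\<And>x. valid x \<Longrightarrow> g (shift n x) = \<sigma> (g x)"
    and g_inj: "\<And>x y. valid x \<Longrightarrow> valid y \<Longrightarrow> g x = g y \<Longrightarrow> y \<in> orb x"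
    and crossing_cro: "\<And>x y. valid x \<Longrightarrow> valid y \<Longrightarrow> crossing (g x) (g y) \<Longrightarrow> cro (orb x) (orb y)"
    and crs_crossing: "\<And>x y. valid x \<Longrightarrow> valid y \<Longrightarrow> crs x y \<Longrightarrow> crossing (g x) (g y) \<or> crossing (g x) (\<sigma> (g y))"
  shows "chord_model cro orbits (\<lambda>X. g ` X) \<sigma> Ch"
proof -
  have add: "shift n (shift m x) = shift (m + n) x" for m x by (cases x) auto
  have up: "g (shift (int k * n) x) \<in> {g x, \<sigma> (g x)}" if x: "valid x" for x k
  proof (induction k)
    case (Suc k)
    have "g (shift (int (Suc k) * n) x) = \<sigma> (g (shift (int k * n) x))"
      using g_shift[of "shift (int k * n) x"] x unfolding add by (simp add: algebra_simps)
    then show ?case using Suc \<sigma> g(1)[OF x] by auto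
  qed simp
  have gs: "g (shift m x) \<in> {g x, \<sigma> (g x)}" if x: "valid x" and m: "n dvd m" for x m
  proof -
    obtain z where z: "m = n * z" using m by blast
    show ?thesis
    proof (cases "0 \<le> z")
      case True
      then show ?thesis using up[OF x, of "nat z"] z by (simp add: mult.commute)
    next
      case False
      have "shift (int (nat (- z)) * n) (shift m x) = x" using False z by (cases x) (auto simp: algebra_simps)
      then have "g x \<in> {g (shift m x), \<sigma> (g (shift m x))}" using up[of "shift m x" "nat (- z)"] x by simp
      then show ?thesis using \<sigma> g(1)[of "shift m x"] x by auto
    qed
  qed
  have im: "g ` orb x = {g x, \<sigma> (g x)}" if x: "valid x" for x
  proof
    show "g ` orb x \<subseteq> {g x, \<sigma> (g x)}" using gs[OF x] by (auto simp: orb_def)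
    have "g x \<in> g ` orb x" by simp
    moreover have "\<sigma> (g x) \<in> g ` orb x" using shift_in_orb[of n x] g_shift[OF x] by (metis dvd_refl imageI)
    ultimately show "{g x, \<sigma> (g x)} \<subseteq> g ` orb x" by blast
  qed
  show ?thesis
  proof
    show "non_leaving cro orbits" by (rule non_leaving_cover)
    fix s assume s: "s \<in> Ch"
    then obtain x where x: "valid x" "g x = s" using g(2) by blast
    show "\<sigma> s \<in> Ch" using g(1)[of "shift n x"] g_shift[OF x(1)] x by simp
    show "\<sigma> (\<sigma> s) = s" using \<sigma> s .
    show "\<exists>X\<in>orbits. g ` X = {s, \<sigma> s}" using im[OF x(1)] x by (auto simp: orbits_def)
  next
    fix X assume "X \<in> orbits"
    then obtain x where "X = orb x" "valid x" by (auto simp: orbits_def)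
    then show "\<exists>s\<in>Ch. g ` X = {s, \<sigma> s}" using im[of x] g(1)[of x] by (intro bexI[of _ "g x"]) simp_all
  next
    fix X Y assume X: "X \<in> orbits" and Y: "Y \<in> orbits"
    obtain x where x: "X = orb x" "valid x" using X by (auto simp: orbits_def)
    obtain y where y: "Y = orb y" "valid y" using Y by (auto simp: orbits_def)
    show "X = Y" if "g ` X = g ` Y"
    proof -
      have "g x \<in> g ` Y" unfolding that [symmetric] using x by simp
      then obtain y' where y': "y' \<in> Y" "g x = g y'" by blast
      then have "y' \<in> orb x" using g_inj[OF x(2)] orbitsE(2)[OF Y] by blast
      then show ?thesis using orb_eq orbitsE(1)[OF Y y'(1)] x(1) by simp
    qed
    show "cro X Y \<longleftrightarrow> (\<exists>x\<in>g ` X. \<exists>y\<in>g ` Y. crossing x y)"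
    proof
      assume "cro X Y"
      then obtain m where m: "n dvd m" "crs x (shift m y)" using cro_orb x y by blast
      have v: "valid (shift m y)" using y(2) by simp
      have gx: "g x \<in> g ` X" using x by simp
      have "g ` Y = {g (shift m y), \<sigma> (g (shift m y))}" using im[OF v] y(1) m(1) by simp
      then have gy: "g (shift m y) \<in> g ` Y" "\<sigma> (g (shift m y)) \<in> g ` Y" by simp_all
      show "\<exists>x\<in>g ` X. \<exists>y\<in>g ` Y. crossing x y"
        using crs_crossing[OF x(2) v m(2)] by (elim disjE) (intro bexI[OF _ gx] bexI[OF _ gy(1)] bexI[OF _ gy(2)], assumption)+
    next
      assume "\<exists>x\<in>g ` X. \<exists>y\<in>g ` Y. crossing x y"
      then obtain a b where ab: "a \<in> X" "b \<in> Y" "crossing (g a) (g b)" by blast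
      have "cro (orb a) (orb b)" by (rule crossing_cro[OF orbitsE(2)[OF X ab(1)] orbitsE(2)[OF Y ab(2)] ab(3)])
      then show "cro X Y" using orbitsE(1)[OF X ab(1)] orbitsE(1)[OF Y ab(2)] by simp
    qed
  qed
qed

text \<open>Equal segments match ends directly or swapped. Since both lengths are at most half the
  period, a swap forces both to be \<open>n\<close>, and then it amounts to a translation by an odd
  multiple of \<open>n\<close>.\<close>

lemma (in cyclic_polygon) short_seg_eq:
  assumes Nn: "N = 2 * n" and ij: "2 \<le> j - i" "j - i \<le> n" and kl: "2 \<le> l - k" "l - k \<le> n" and e: "seg i j = seg k l"
  shows "\<exists>m. n dvd m \<and> k = i + m \<and> l = j + m"
proof -
  have pos: "0 < 2 * n" using N Nn by simp
  note cancel = iffD1[OF mult_less_cancel_left_pos[OF pos]]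
  consider z z' where "i - k = 2 * n * z" "j - l = 2 * n * z'" | z z' where "i - l = 2 * n * z" "j - k = 2 * n * z'"
    using e unfolding seg_eq_iff Nn dvd_def by blast
  then show ?thesis
  proof cases
    case 1
    have "(j - i) - (l - k) = 2 * n * (z' - z)" using 1 by (simp add: algebra_simps)
    then have "2 * n * (z' - z) < 2 * n * 1" "2 * n * (- 1) < 2 * n * (z' - z)" using ij kl pos by linarith+
    then have "z' - z < 1" "- 1 < z' - z" by (blast dest: cancel)+
    then have "z' = z" by linarith
    then show ?thesis using 1 by (intro exI[of _ "n * (- 2 * z)"]) (simp add: algebra_simps)
  next
    case 2
    have s: "(j - i) + (l - k) = 2 * n * (z' - z)" using 2 by (simp add: algebra_simps)
    then have "2 * n * 0 < 2 * n * (z' - z)" "2 * n * (z' - z) < 2 * n * 2" using ij kl pos by linarith+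
    then have "0 < z' - z" "z' - z < 2" by (blast dest: cancel)+
    then have "z' = z + 1" by linarith
    then have "(j - i) + (l - k) = 2 * n" using s by simp
    then have "j = i + n" "l = k + n" using ij kl by linarith+
    then show ?thesis using 2 by (intro exI[of _ "n * (- 1 - 2 * z)"]) (simp add: algebra_simps)
  qed
qed

lemma (in cyclic_polygon) short_crossing_iff:
  assumes Nn: "N = 2 * n" and ij: "2 \<le> j - i" "j - i \<le> n" and kl: "2 \<le> l - k" "l - k \<le> n"
  shows "i < k \<and> k < j \<and> j < l \<or> k < i \<and> i < l \<and> l < j \<Longrightarrow> crossing (seg i j) (seg k l)"
    and "crossing (seg i j) (seg k l) \<Longrightarrow>
      \<exists>m. n dvd m \<and> (i < k + m \<and> k + m < j \<and> j < l + m \<or> k + m < i \<and> i < l + m \<and> l + m < j)"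
proof -
  assume "i < k \<and> k < j \<and> j < l \<or> k < i \<and> i < l \<and> l < j"
  then show "crossing (seg i j) (seg k l)"
    using crossing_segI[of i k j l] crossing_sym[OF crossing_segI[of k i l j]] Nn ij kl by fastforce
next
  assume "crossing (seg i j) (seg k l)"
  then obtain m where "N dvd m" "i < k + m \<and> k + m < j \<and> j < l + m \<or> k + m < i \<and> i < l + m \<and> l + m < j"
    using crossing_segD[of i j k l] Nn ij kl by fastforce
  moreover have "n dvd m" using \<open>N dvd m\<close> Nn dvd_mult_right by blast
  ultimately show "\<exists>m. n dvd m \<and> (i < k + m \<and> k + m < j \<and> j < l + m \<or> k + m < i \<and> i < l + m \<and> l + m < j)"
    by blast
qed

section \<open>The three types\<close>

lemma type_A:
  assumes "convex_polygon Q"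
  shows "non_leaving_face_property (triangulations Q) (diagonals_A Q) \<and>
    common_diagonals_never_flipped (triangulations Q) (diagonals_A Q)"
proof -
  obtain N P where "cyclic_polygon N P Q" using convex_polygon_cyclic[OF assms] by blast
  then interpret cyclic_polygon N P Q .
  \<comment> \<open>The half of a \<open>2 * n\<close>-gon on one side of a long diagonal has
    \<open>n + 1\<close> vertices.\<close>
  define n where "n = N - 1"
  have Nn: "N = n + 1" by (simp add: n_def)
  interpret cover n True by unfold_locales (use N n_def in simp)
  define E where "E = orb (Arc 0 n)"
  have E: "E \<in> orbits" unfolding E_def orbits_def using n by simp
  define D where "D = {X \<in> orbits. X \<noteq> E \<and> \<not> cro X E}"
  \<comment> \<open>Arcs under the lift \<open>Arc 0 n\<close> of the fixed long diagonal, other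
    than that lift itself and sides. Each orbit compatible with the long diagonal has exactly one
    representative here.\<close>
  define W where "W i j \<longleftrightarrow> 0 \<le> i \<and> j \<le> n \<and> 2 \<le> j - i \<and> j - i < n" for i j
  define h where "h X = {seg i j | i j. Arc i j \<in> X \<and> W i j}" for X
  have D_W: "\<exists>i j. X = orb (Arc i j) \<and> W i j" if X: "X \<in> D" for X
  proof -
    obtain x where x: "X = orb x" "valid x" using X by (auto simp: D_def orbits_def)
    obtain i0 j0 where x0: "x = Arc i0 j0" using x(2) by (cases x) auto
    define m where "m = - (n * (i0 div n))"
    have dm: "n dvd m" by (simp add: m_def)
    define i j where "i = i0 + m" and "j = j0 + m"
    have "i = i0 mod n" by (simp add: i_def m_def minus_mult_div_eq_mod [symmetric])
    then have i: "0 \<le> i" "i < n" using n by simp_all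
    have Xij: "X = orb (Arc i j)" using orb_shift[OF dm, of x] x x0 by (simp add: i_def j_def)
    have v: "2 \<le> j - i" "j - i \<le> n" using x(2) x0 by (simp_all add: i_def j_def)
    have nc: "\<not> crs (Arc i j) (Arc 0 n)" using X croI[of "Arc i j" "Arc 0 n"] by (auto simp: D_def E_def Xij)
    have "\<not> (i = 0 \<and> j = n)" using X by (auto simp: D_def E_def Xij)
    then have "W i j" using i v nc unfolding W_def by auto
    then show ?thesis using Xij by blast
  qed
  have only0: "m = 0" if "n dvd m" "- n < m" "m < n" for m
    using that zdvd_imp_le[of n m] zdvd_imp_le[of n "- m"] by (cases "0 < m"; cases "m = 0") auto
  have crW: "crossing (seg i j) (seg k l) \<longleftrightarrow> cro (orb (Arc i j)) (orb (Arc k l))" if W: "W i j" "W k l" for i j k l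
  proof
    assume c: "crossing (seg i j) (seg k l)"
    obtain m where m: "N dvd m" "i < k + m \<and> k + m < j \<and> j < l + m \<or> k + m < i \<and> i < l + m \<and> l + m < j"
      using crossing_segD[OF _ _ _ _ c] W Nn by (auto simp: W_def)
    have "m = 0" using m W zdvd_imp_le[of N m] zdvd_imp_le[of N "- m"] Nn unfolding W_def
      by (cases "0 < m"; cases "m = 0") auto
    then show "cro (orb (Arc i j)) (orb (Arc k l))" using m(2) by (intro croI) auto
  next
    assume "cro (orb (Arc i j)) (orb (Arc k l))"
    then obtain m where m: "n dvd m" "crs (Arc i j) (shift m (Arc k l))" using cro_orb by blast
    have "m = 0" using only0[OF m(1)] m(2) W unfolding W_def by auto
    then show "crossing (seg i j) (seg k l)"
      using m(2) W crossing_segI[of i k j l] crossing_sym[OF crossing_segI[of k i l j]] Nn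
      unfolding W_def by auto
  qed
  have W_D: "orb (Arc i j) \<in> D" if W: "W i j" for i j
  proof -
    have "orb (Arc i j) \<in> orbits" using W by (auto simp: orbits_def W_def)
    moreover have "orb (Arc i j) \<noteq> E"
    proof
      assume "orb (Arc i j) = E"
      then have "Arc i j \<in> orb (Arc 0 n)" using in_orb[of "Arc i j"] by (simp add: E_def)
      then show False using W by (auto simp: orb_def W_def)
    qed
    moreover have "\<not> cro (orb (Arc i j)) E"
    proof
      assume "cro (orb (Arc i j)) E"
      then obtain m where m: "n dvd m" "crs (Arc i j) (shift m (Arc 0 n))" unfolding E_def cro_orb by blast
      have "m = 0" using only0[OF m(1)] m(2) W unfolding W_def by auto
      then show False using m(2) W unfolding W_def by auto
    qed
    ultimately show ?thesis by (simp add: D_def)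
  qed
  have hW: "h (orb (Arc i j)) = {seg i j}" if W: "W i j" for i j
  proof
    show "{seg i j} \<subseteq> h (orb (Arc i j))"
      unfolding h_def using W by (intro subsetI CollectI exI[of _ i] exI[of _ j]) simp
    show "h (orb (Arc i j)) \<subseteq> {seg i j}"
    proof
      fix s assume "s \<in> h (orb (Arc i j))"
      then obtain a b where ab: "s = seg a b" "Arc a b \<in> orb (Arc i j)" "W a b"
        unfolding h_def mem_Collect_eq by (elim exE conjE)
      then obtain m where "n dvd m" "Arc a b = shift m (Arc i j)"
        unfolding orb_def mem_Collect_eq by (elim exE conjE)
      then have m: "s = seg (i + m) (j + m)" "n dvd m" "W (i + m) (j + m)" using ab by simp_all
      have "m = 0" using only0[OF m(2)] m(3) W unfolding W_def by auto
      then show "s \<in> {seg i j}" using m(1) by simp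
    qed
  qed
  have diag: "diagonals Q = {seg i j | i j. W i j}"
  proof (intro equalityI subsetI)
    fix s assume "s \<in> diagonals Q"
    then obtain i0 j0 where s0: "s = seg i0 j0" "2 \<le> j0 - i0" "j0 - i0 \<le> N - 2" unfolding diagonals_eq by blast
    obtain m where m: "N dvd m" "0 \<le> i0 + m" "i0 + m < 0 + N" using representative by blast
    define i j where "i = i0 + m" and "j = j0 + m"
    have s1: "s = seg i j" using s0(1) seg_shift[OF m(1), of i0 j0] by (simp add: i_def j_def)
    have "2 \<le> j - i" "j - i \<le> n - 1" "0 \<le> i" "i \<le> n"
      using s0(2,3) m(2,3) Nn unfolding i_def j_def by linarith+
    note s = s1 this
    show "s \<in> {seg i j | i j. W i j}"
    proof (cases "j \<le> n")
      case True
      then have "W i j" using s unfolding W_def by simp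
      then show ?thesis using s(1) by blast
    next
      case False
      \<comment> \<open>A diagonal running past vertex \<open>n\<close> is read from its other
        end.\<close>
      have "seg i j = seg (j - N) i" using P_add_multiple[of "- N" j] by (simp add: seg_def closed_segment_commute)
      moreover have "W (j - N) i" using s False Nn unfolding W_def by simp
      ultimately show ?thesis using s(1) by blast
    qed
  next
    fix s assume "s \<in> {seg i j | i j. W i j}"
    then obtain i j where "s = seg i j" "W i j" by blast
    then show "s \<in> diagonals Q" unfolding diagonals_eq W_def using Nn by (intro CollectI exI[of _ i] exI[of _ j]) simp
  qed
  have window_eq: "a = b" if dv: "N dvd a - b" and ab: "0 \<le> a" "a \<le> n" "0 \<le> b" "b \<le> n" for a b
  proof -
    have "N dvd b - a" using dv by (subst dvd_diff_commute)
    then have "\<not> a < b" using zdvd_imp_le[of N "b - a"] ab Nn by linarith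
    moreover have "\<not> b < a" using zdvd_imp_le[OF dv] ab Nn by linarith
    ultimately show ?thesis by simp
  qed
  interpret L: crossing_system cro D unfolding D_def by (rule crossing_system_link[OF E non_leaving_cover])
  interpret chord_model cro D h "\<lambda>s. s" "diagonals Q"
  proof
    show "non_leaving cro D" unfolding D_def by (rule non_leaving_link[OF E non_leaving_cover])
    show "\<exists>s\<in>diagonals Q. h X = {s, s}" if X: "X \<in> D" for X
    proof -
      obtain i j where "X = orb (Arc i j)" and W: "W i j" using D_W[OF X] by blast
      then have "h X = {seg i j, seg i j}" using hW[OF W] by simp
      moreover have "seg i j \<in> diagonals Q" unfolding diag using W by blast
      ultimately show ?thesis by (rule bexI)
    qed
    show "\<exists>X\<in>D. h X = {s, s}" if s: "s \<in> diagonals Q" for s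
    proof -
      obtain i j where "s = seg i j" and W: "W i j" using s unfolding diag by blast
      then have "h (orb (Arc i j)) = {s, s}" using hW[OF W] by simp
      then show ?thesis using W_D[OF W] by (rule bexI)
    qed
    fix X Y assume X: "X \<in> D" and Y: "Y \<in> D"
    obtain i j where ij: "X = orb (Arc i j)" "W i j" using D_W[OF X] by blast
    obtain k l where kl: "Y = orb (Arc k l)" "W k l" using D_W[OF Y] by blast
    show "cro X Y \<longleftrightarrow> (\<exists>x\<in>h X. \<exists>y\<in>h Y. crossing x y)" using crW ij kl hW by simp
    show "X = Y" if "h X = h Y"
    proof -
      have "seg i j = seg k l" using that ij kl hW by simp
      then consider "N dvd i - k" "N dvd j - l" | "N dvd i - l" "N dvd j - k" unfolding seg_eq_iff by blast
      then have "i = k \<and> j = l"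
      proof cases
        case 1 then show ?thesis using window_eq[of i k] window_eq[of j l] ij(2) kl(2) unfolding W_def by auto
      next
        case 2 then show ?thesis using window_eq[of i l] window_eq[of j k] ij(2) kl(2) unfolding W_def by auto
      qed
      then show ?thesis using ij kl by simp
    qed
  qed auto
  have "triangulations Q = \<T>" unfolding triangulations_def symmetric_triangulations_def by simp
  moreover have "diagonals_A Q = \<D>" unfolding diagonals_A_def \<D>_def by simp
  ultimately show ?thesis using geodesics_preserve_common_diagonals by simp
qed

lemma type_BC:
  assumes "convex_polygon Q" "centrally_symmetric c Q"
  shows "non_leaving_face_property (triangulations_BC c Q) (diagonals_BC c Q) \<and>
    common_diagonals_never_flipped (triangulations_BC c Q) (diagonals_BC c Q)"
proof -
  obtain N P where cp: "cyclic_polygon N P Q" using convex_polygon_cyclic[OF assms(1)] by blast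
  obtain n where n2: "2 \<le> n" and Nn: "N = 2 * n" and refl: "\<And>k. P (k + n) = point_reflection c (P k)"
    using centrally_symmetric_cyclic[OF cp assms(2)] by blast
  interpret cyclic_polygon N P Q by (fact cp)
  interpret cover n True by unfold_locales (fact n2)
  \<comment> \<open>The value on \<open>Cen\<close> is a placeholder: with \<open>K\<close> true no
    such arc is valid.\<close>
  define g where "g x = (case x of Arc i j \<Rightarrow> seg i j | Cen p a \<Rightarrow> {})" for x
  have gA [simp]: "g (Arc i j) = seg i j" for i j by (simp add: g_def)
  interpret chord_model cro orbits "\<lambda>X. g ` X" "\<lambda>s. point_reflection c ` s" "diagonals Q"
  proof (rule chord_model_orbits)
    show "point_reflection c ` point_reflection c ` s = s" for s by (simp add: image_image)
    show "\<exists>x. valid x \<and> g x = s" if s: "s \<in> diagonals Q" for s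
    proof -
      obtain i j where ij: "s = seg i j" "2 \<le> j - i" "j - i \<le> N - 2" using s unfolding diagonals_eq by blast
      show ?thesis
      proof (cases "j - i \<le> n")
        case True
        then show ?thesis using ij by (intro exI[of _ "Arc i j"]) simp
      next
        case False
        \<comment> \<open>A diagonal spanning more than half of the polygon is read from its other
          end.\<close>
        have "s = seg j (i + N)" using ij(1) periodic[of i] by (simp add: seg_def closed_segment_commute)
        then show ?thesis using False ij Nn by (intro exI[of _ "Arc j (i + N)"]) simp
      qed
    qed
  next
    fix x assume x: "valid x"
    then obtain i j where ij: "x = Arc i j" "2 \<le> j - i" "j - i \<le> n" by (cases x) auto
    show "g x \<in> diagonals Q"
      unfolding diagonals_eq using ij Nn n2 by (intro CollectI exI[of _ i] exI[of _ j]) simp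
    show "g (shift n x) = point_reflection c ` g x" using ij refl by (simp add: seg_def reflection_closed_segment)
    fix y assume y: "valid y"
    then obtain k l where kl: "y = Arc k l" "2 \<le> l - k" "l - k \<le> n" by (cases y) auto
    note short = short_crossing_iff[OF Nn ij(2,3) kl(2,3)]
    show "y \<in> orb x" if e: "g x = g y"
    proof -
      obtain m where "n dvd m" "k = i + m" "l = j + m"
        using short_seg_eq[OF Nn ij(2,3) kl(2,3)] e ij kl by auto
      then show ?thesis using shift_in_orb[of m x] ij kl by simp
    qed
    show "cro (orb x) (orb y)" if "crossing (g x) (g y)" using short(2) that ij kl unfolding cro_orb by simp
    show "crossing (g x) (g y) \<or> crossing (g x) (point_reflection c ` g y)" if "crs x y"
      using short(1) that ij kl by simp
  qed
  have "triangulations_BC c Q = \<T>"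
    unfolding maximal_symmetric[OF crossing_reflection] triangulations_BC_def triangulations_def
      centrally_symmetric_chords_def by blast
  moreover have "diagonals_BC c Q = \<D>" unfolding diagonals_BC_def \<D>_def ..
  ultimately show ?thesis using geodesics_preserve_common_diagonals by simp
qed

lemma (in type_D) reflect_tangent: "point_reflection c ` tangent k a = tangent (k + int n) a"
  unfolding tangent_def reflection_closed_segment reflect_P reflect_T ..

lemma type_D_non_leaving:
  assumes "type_D_configuration n c r Q"
  shows "non_leaving_face_property (triangulations_D c r Q) (diagonals_D c r Q) \<and>
    common_diagonals_never_flipped (triangulations_D c r Q) (diagonals_D c r Q)"
proof -
  interpret type_D n c r Q by unfold_locales (fact assms)
  interpret C: cover "int n" False by unfold_locales (use n in simp)
  define g where "g x = (case x of Arc i j \<Rightarrow> seg i j | Cen p a \<Rightarrow> tangent p a)" for x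
  have g_simps [simp]: "g (Arc i j) = seg i j" "g (Cen p a) = tangent p a" for i j p a by (simp_all add: g_def)
  have chords: "chords_D c r Q = {seg i j | i j. 2 \<le> j - i \<and> j - i < int n} \<union> {tangent p a | p a. True}"
    unfolding chords_D_def short_diagonals tangent_chords_eq ..
  have seg_tangent: "\<exists>m. int n dvd m \<and> i < p + m \<and> p + m < j"
    if ij: "2 \<le> j - i" "j - i < int n" and c: "crossing (seg i j) (tangent p a)" for i j p a
  proof -
    obtain m where m: "2 * int n dvd m" "i + 1 \<le> p + m" "p + m < i + 1 + 2 * int n" using representative by blast
    have "crossing (seg i j) (tangent (p + m) a)" using c tangent_shift[OF m(1)] by simp
    then have "p + m < j" using seg_not_crosses_tangent[OF ij, of "p + m" a] m by fastforce
    moreover have "int n dvd m" by (rule dvd_trans[OF _ m(1)]) simp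
    ultimately show ?thesis using m by auto
  qed
  interpret chord_model C.cro C.orbits "\<lambda>X. g ` X" "\<lambda>s. point_reflection c ` s" "chords_D c r Q"
  proof (rule C.chord_model_orbits)
    show "point_reflection c ` point_reflection c ` s = s" for s by (simp add: image_image)
    fix s assume s: "s \<in> chords_D c r Q"
    then consider i j where "s = seg i j" "2 \<le> j - i" "j - i < int n" | p a where "s = tangent p a"
      unfolding chords by blast
    then show "\<exists>x. C.valid x \<and> g x = s"
    proof cases
      case 1 then show ?thesis by (intro exI[of _ "Arc i j"]) simp
    next
      case 2 then show ?thesis by (intro exI[of _ "Cen p a"]) simp
    qed
  next
    fix x assume x: "C.valid x"
    show "g x \<in> chords_D c r Q" unfolding chords using x by (cases x) auto
    show "g (shift (int n) x) = point_reflection c ` g x"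
      by (cases x) (simp_all add: seg_def reflection_closed_segment reflect_P reflect_tangent)
    fix y assume y: "C.valid y"
    have AA: "\<exists>m. int n dvd m \<and> k = i + m \<and> l = j + m"
      if "seg i j = seg k l" "x = Arc i j" "y = Arc k l" for i j k l
      by (rule short_seg_eq[OF refl]) (use that x y in auto)
    show "y \<in> C.orb x" if e: "g x = g y"
    proof (cases x)
      case (Arc i j)
      then obtain k l where kl: "y = Arc k l" using e seg_neq_tangent by (cases y) auto
      then obtain m where "int n dvd m" "k = i + m" "l = j + m" using AA[of i j k l] e Arc by auto
      then show ?thesis using C.shift_in_orb[of m x] Arc kl by simp
    next
      case (Cen p a)
      then obtain q b where q: "y = Cen q b" using e seg_neq_tangent by (cases y) (auto, metis)
      then have "2 * int n dvd p - q" "a = b" using e Cen tangent_eq_iff by auto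
      moreover have "int n dvd p - q" by (rule dvd_trans[OF _ \<open>2 * int n dvd p - q\<close>]) simp
      ultimately show ?thesis using C.shift_in_orb[of "q - p" x] Cen q by (simp add: dvd_diff_commute)
    qed
    have seg_seg: "crossing (seg i j) (seg k l) \<Longrightarrow> C.cro (C.orb x) (C.orb y)"
      "C.crs x y \<Longrightarrow> crossing (seg i j) (seg k l)" if "x = Arc i j" "y = Arc k l" for i j k l
      using short_crossing_iff[OF refl, of j i l k] that x y unfolding C.cro_orb by auto
    show "C.cro (C.orb x) (C.orb y)" if c: "crossing (g x) (g y)"
    proof (cases x)
      case x1: (Arc i j)
      show ?thesis
      proof (cases y)
        case y1: (Arc k l) then show ?thesis using seg_seg(1) x1 c by simp
      next
        case y1: (Cen p a) then show ?thesis using seg_tangent x1 x c unfolding C.cro_orb by auto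
      qed
    next
      case x1: (Cen p a)
      show ?thesis
      proof (cases y)
        case y1: (Arc i j)
        then have "C.cro (C.orb y) (C.orb x)"
          using seg_tangent[of j i p a] x1 y crossing_sym[OF c] unfolding C.cro_orb by auto
        then show ?thesis by (rule C.cro_sym)
      next
        case y1: (Cen q b)
        have "crossing (tangent p a) (tangent q b)" using c x1 y1 by simp
        then have "a \<noteq> b" "\<not> int n dvd p - q"
          using tangent_no_crossing_same_tag tangent_no_crossing_same_base by blast+
        then have "C.crs x y" using x1 y1 by simp
        then show ?thesis by (rule C.croI)
      qed
    qed
    show "crossing (g x) (g y) \<or> crossing (g x) (point_reflection c ` g y)" if c: "C.crs x y"
    proof (cases x)
      case x1: (Arc i j)
      show ?thesis
      proof (cases y)
        case y1: (Arc k l) then show ?thesis using seg_seg(2) x1 c by simp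
      next
        case y1: (Cen p a)
        then have "crossing (seg i j) (tangent p a)" using seg_crosses_tangent[of j i p a] x x1 c by simp
        then show ?thesis using x1 y1 by simp
      qed
    next
      case x1: (Cen p a)
      show ?thesis
      proof (cases y)
        case y1: (Arc i j)
        then have "crossing (seg i j) (tangent p a)" using seg_crosses_tangent[of j i p a] y x1 c by simp
        then show ?thesis using crossing_sym x1 y1 by simp
      next
        case y1: (Cen q b)
        then show ?thesis using tangent_crossing[of p q a b] c x1 by (simp add: reflect_tangent)
      qed
    qed
  qed
  have "triangulations_D c r Q = \<T>"
    unfolding triangulations_D_def symmetric_triangulations_def centrally_symmetric_chords_def ..
  moreover have "diagonals_D c r Q = \<D>" unfolding diagonals_D_def \<D>_def ..
  ultimately show ?thesis using geodesics_preserve_common_diagonals by simp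
qed

theorem theorem4p2:
  "(\<forall>P. convex_polygon P \<longrightarrow>
      non_leaving_face_property (triangulations P) (diagonals_A P) \<and>
      common_diagonals_never_flipped (triangulations P) (diagonals_A P)) \<and>
   (\<forall>P c. convex_polygon P \<and> centrally_symmetric c P \<longrightarrow>
      non_leaving_face_property (triangulations_BC c P) (diagonals_BC c P) \<and>
      common_diagonals_never_flipped (triangulations_BC c P) (diagonals_BC c P)) \<and>
   (\<forall>n P c r. type_D_configuration n c r P \<longrightarrow>
      non_leaving_face_property (triangulations_D c r P) (diagonals_D c r P) \<and>
      common_diagonals_never_flipped (triangulations_D c r P) (diagonals_D c r P))"
proof (rule conjI[OF _ conjI]; (rule allI)+; rule impI)
  fix P c assume "convex_polygon P \<and> centrally_symmetric c P"
  then show "non_leaving_face_property (triangulations_BC c P) (diagonals_BC c P) \<and>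
      common_diagonals_never_flipped (triangulations_BC c P) (diagonals_BC c P)"
    by (elim conjE) (rule type_BC)
qed (erule type_A type_D_non_leaving)+

end
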